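(* Let $y_1,y_2\in\mathbb{C}\setminus(-\infty,1]$, $\alpha,\beta,\gamma\in\mathbb{C}^\ast$, $\Re(\alpha+\gamma)>-1$, $\Re(\alpha+\beta+\gamma)>-1$, $\Re(\alpha+\beta+2\gamma)<-\frac12$. Put $$C:=C(y_1,y_2,y_3):=\frac{1-y_1^2y_2^2-y_1^2y_3^2-y_2^2y_3^2+2y_1^2y_2^2y_3^2}{2y_1y_2y_3\sqrt{(y_1^2-1)(y_2^2-1)(y_3^2-1)}}.$$ Then $$P_\gamma^{(\alpha,\beta)}(2y_1^2-1)P_\gamma^{(\alpha,\beta)}(2y_2^2-1)=\frac{\Gamma(\alpha+2\gamma+2)\Gamma(-\alpha-\beta-2\gamma-1)}{2^{2\alpha+2\beta+4\gamma+2}\Gamma(\gamma+1)\Gamma(\alpha+\beta+\gamma+1)\Gamma(-\alpha-2\beta-2\gamma-1)(y_1y_2)^{\alpha+2\beta+2\gamma+2}(y_1^2-1)^{\frac12\alpha}(y_2^2-1)^{\frac12\alpha}}$$ $$\times\int_{1}^{\frac{y_1y_2+1}{y_1+y_2}}P_\gamma^{(\alpha,\beta)}(2y_3^2-1)\frac{(y_3^2-1)^{\frac12(\alpha-2)}}{y_3^{\alpha+2\gamma+1}}(C^2-1)^{-\alpha-\beta-2\gamma-\frac32}\,C_{\alpha+2\gamma+1}^{-(\alpha+\beta+2\gamma+1)}(C)\,dy_3 .$$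
   Context: $\mathbb{C}^\ast=\mathbb{C}\setminus\{0\}$. The regularized Gauss hypergeometric function is $\mathbf{F}(a,b;c;z)=\sum_{n\ge0}\frac{(a)_n(b)_n}{\Gamma(c+n)}\frac{z^n}{n!}$, continued analytically to $\mathbb{C}\setminus[1,\infty)$. Jacobi function of the first kind: $P_\gamma^{(\alpha,\beta)}(z)=\frac{\Gamma(\alpha+\gamma+1)}{\Gamma(\gamma+1)}\mathbf{F}\big(-\gamma,\alpha+\beta+\gamma+1;\alpha+1;\frac{1-z}{2}\big)$, $z\in\mathbb{C}\setminus(-\infty,-1]$. Gegenbauer function of the first kind (with indices): $C_\lambda^\alpha(z)=\frac{\sqrt\pi\,\Gamma(2\alpha+\lambda)}{2^{2\alpha-1}\Gamma(\alpha)\Gamma(\lambda+1)}\mathbf{F}\big(-\lambda,2\alpha+\lambda;\alpha+\frac12;\frac{1-z}{2}\big)$, $z\in\mathbb{C}\setminus(-\infty,-1]$; the unindexed $C$ is the algebraic expression in the claim. Convention: the basic range is $y_1,y_2>1$ real (all powers and roots of positive numbers positive); for complex values both sides are understood by analytic continuation from that range. Parameters are assumed such that all Gamma factors and functions are defined. *)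

theory Defs
  imports "HOL-Complex_Analysis.Complex_Analysis"
begin

text \<open>
  The reciprocal Gamma factor is written with the entire function \<^const>\<open>rGamma\<close>, so that
  the series is defined for every \<open>c\<close>, as is usual for the regularized function.
\<close>

definition hyp2F1_reg_series :: "complex \<Rightarrow> complex \<Rightarrow> complex \<Rightarrow> complex \<Rightarrow> complex" where
  "hyp2F1_reg_series a b c z =
     (\<Sum>n. pochhammer a n * pochhammer b n * rGamma (c + of_nat n) * z ^ n / fact n)"

text \<open>
  The continuation is unique on the cut plane, which is connected; on the cut itself the value
  is unspecified, hence \<open>SOME\<close> rather than \<open>THE\<close>.
\<close>

definition hyp2F1_reg :: "complex \<Rightarrow> complex \<Rightarrow> complex \<Rightarrow> complex \<Rightarrow> complex" where
  "hyp2F1_reg a b c =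
     (SOME F. F holomorphic_on (- complex_of_real ` {1..}) \<and>
              (\<forall>z\<in>ball 0 1. F z = hyp2F1_reg_series a b c z))"

definition jacobi_fun :: "complex \<Rightarrow> complex \<Rightarrow> complex \<Rightarrow> complex \<Rightarrow> complex" where
  "jacobi_fun \<gamma> \<alpha> \<beta> z =
     Gamma (\<alpha> + \<gamma> + 1) / Gamma (\<gamma> + 1) *
     hyp2F1_reg (- \<gamma>) (\<alpha> + \<beta> + \<gamma> + 1) (\<alpha> + 1) ((1 - z) / 2)"

definition gegenbauer_fun :: "complex \<Rightarrow> complex \<Rightarrow> complex \<Rightarrow> complex" where
  "gegenbauer_fun \<nu> \<alpha> z =
     of_real (sqrt pi) * Gamma (2 * \<alpha> + \<nu>) /
       (2 powr (2 * \<alpha> - 1) * Gamma \<alpha> * Gamma (\<nu> + 1)) *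
     hyp2F1_reg (- \<nu>) (2 * \<alpha> + \<nu>) (\<alpha> + 1 / 2) ((1 - z) / 2)"

definition C_arg :: "real \<Rightarrow> real \<Rightarrow> real \<Rightarrow> real" where
  "C_arg y1 y2 y3 =
     (1 - y1^2 * y2^2 - y1^2 * y3^2 - y2^2 * y3^2 + 2 * y1^2 * y2^2 * y3^2) /
     (2 * y1 * y2 * y3 * sqrt ((y1^2 - 1) * (y2^2 - 1) * (y3^2 - 1)))"

text \<open>
  The two sides of the product formula in the basic range \<open>y1, y2 > 1\<close>. There every base of a
  power is a positive real for \<open>1 < y3 < (y1 * y2 + 1) / (y1 + y2)\<close> (in particular
  \<open>C_arg y1 y2 y3 > 1\<close>), so the principal branch used by \<open>powr\<close> is the positive one.
\<close>

definition jacobi_product :: "complex \<Rightarrow> complex \<Rightarrow> complex \<Rightarrow> real \<Rightarrow> real \<Rightarrow> complex" where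
  "jacobi_product \<alpha> \<beta> \<gamma> y1 y2 =
     jacobi_fun \<gamma> \<alpha> \<beta> (of_real (2 * y1^2 - 1)) * jacobi_fun \<gamma> \<alpha> \<beta> (of_real (2 * y2^2 - 1))"

definition product_integrand ::
  "complex \<Rightarrow> complex \<Rightarrow> complex \<Rightarrow> real \<Rightarrow> real \<Rightarrow> real \<Rightarrow> complex" where
  "product_integrand \<alpha> \<beta> \<gamma> y1 y2 y3 =
     jacobi_fun \<gamma> \<alpha> \<beta> (of_real (2 * y3^2 - 1)) *
     (of_real (y3^2 - 1) powr ((\<alpha> - 2) / 2) / of_real y3 powr (\<alpha> + 2 * \<gamma> + 1)) *
     of_real ((C_arg y1 y2 y3)^2 - 1) powr (- \<alpha> - \<beta> - 2 * \<gamma> - 3 / 2) *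
     gegenbauer_fun (\<alpha> + 2 * \<gamma> + 1) (- (\<alpha> + \<beta> + 2 * \<gamma> + 1)) (of_real (C_arg y1 y2 y3))"

definition product_prefactor ::
  "complex \<Rightarrow> complex \<Rightarrow> complex \<Rightarrow> real \<Rightarrow> real \<Rightarrow> complex" where
  "product_prefactor \<alpha> \<beta> \<gamma> y1 y2 =
     (Gamma (\<alpha> + 2 * \<gamma> + 2) * Gamma (- \<alpha> - \<beta> - 2 * \<gamma> - 1)) /
     (2 powr (2 * \<alpha> + 2 * \<beta> + 4 * \<gamma> + 2) *
      Gamma (\<gamma> + 1) * Gamma (\<alpha> + \<beta> + \<gamma> + 1) * Gamma (- \<alpha> - 2 * \<beta> - 2 * \<gamma> - 1) *
      of_real (y1 * y2) powr (\<alpha> + 2 * \<beta> + 2 * \<gamma> + 2) *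
      of_real (y1^2 - 1) powr (\<alpha> / 2) * of_real (y2^2 - 1) powr (\<alpha> / 2))"

definition jacobi_integral :: "complex \<Rightarrow> complex \<Rightarrow> complex \<Rightarrow> real \<Rightarrow> real \<Rightarrow> complex" where
  "jacobi_integral \<alpha> \<beta> \<gamma> y1 y2 =
     product_prefactor \<alpha> \<beta> \<gamma> y1 y2 *
     integral {1..(y1 * y2 + 1) / (y1 + y2)} (product_integrand \<alpha> \<beta> \<gamma> y1 y2)"

definition cut_plane :: "complex set" where
  "cut_plane = - complex_of_real ` {..1}"

text \<open>
  \<open>G\<close> is the analytic continuation to \<open>cut_plane \<times> cut_plane\<close> of a function \<open>g\<close> given for
  \<open>y1, y2 > 1\<close>. Holomorphy in two variables is expressed as joint continuity together with
  holomorphy in each variable. By the identity theorem, applied in one variable at a time,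
  \<open>g\<close> determines \<open>G\<close> on \<open>cut_plane \<times> cut_plane\<close>.
\<close>

definition analytic_continuation2 ::
  "(real \<Rightarrow> real \<Rightarrow> complex) \<Rightarrow> (complex \<Rightarrow> complex \<Rightarrow> complex) \<Rightarrow> bool" where
  "analytic_continuation2 g G \<longleftrightarrow>
     continuous_on (cut_plane \<times> cut_plane) (\<lambda>(y1, y2). G y1 y2) \<and>
     (\<forall>y2\<in>cut_plane. (\<lambda>y1. G y1 y2) holomorphic_on cut_plane) \<and>
     (\<forall>y1\<in>cut_plane. (\<lambda>y2. G y1 y2) holomorphic_on cut_plane) \<and>
     (\<forall>y1>1. \<forall>y2>1. G (of_real y1) (of_real y2) = g y1 y2)"

end

theory Submission
  imports Defs
begin

text \<open>
  Put \<open>x = 1 - 1 / y^2\<close>, \<open>a = \<alpha> + \<gamma> + 1\<close>, \<open>b = \<alpha> + \<beta> + \<gamma> + 1\<close>, \<open>c = \<alpha> + 1\<close>. By Pfaff's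
  transformation the Jacobi function at \<open>2 y^2 - 1\<close> is an elementary factor times \<open>F(a, b; c; x)\<close>
  or times \<open>F(c - a, c - b; c; x)\<close>. With \<open>p = x1 + x2 - x1 x2\<close> and \<open>r = 1 / C^2\<close> as integration
  variable one finds \<open>x3 = x1 x2 r / (1 + sqrt (1 - p r))^2\<close>, so the kernel depends on \<open>x1, x2\<close>
  only through \<open>p\<close>. Expanding \<open>F(c - a, c - b; c; x3)\<close> and the powers of \<open>1 + sqrt (1 - p r)\<close>
  leaves the moments of the Gegenbauer kernel, which are Gamma quotients by Gauss's theorem, and
  the resulting sum over \<open>(x1 x2)^n F(a + n, b + n; c + 2 n; p)\<close> is the Burchnall--Chaundy expansion
  of \<open>F(a, b; c; x1) F(a, b; c; x2)\<close>. Since both sides agree for \<open>y1, y2 > 1\<close>, they have the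
  same continuation, which exists because the left-hand side is a product of two solutions
  of a linear differential equation without singularities in the cut plane.
\<close>

subsection \<open>The regularized hypergeometric series\<close>

text \<open>In the notation of the overview the hypotheses on real parts say Re a > 0, Re b > 0 and
  Re (c - a - b) > -1/2. They are the conditions for integrability of the kernel: at r = 0 it
  behaves like a combination of r^(a-1) and r^(b-1), at r = 1 like (1 - r)^(c-a-b-1/2). Together
  they give only Re c > -1/2, so c = 0 can occur. For this reason the lower parameter is kept away
  from -1, -2, ... but not from 0, and an identification of a power series by its differential
  equation compares the value and the derivative at 0: for c = 0 the first step of the recurrence
  does not determine the coefficient of z.\<close>

definition hyp_coeff :: "complex \<Rightarrow> complex \<Rightarrow> complex \<Rightarrow> nat \<Rightarrow> complex" where
  "hyp_coeff a b c n = pochhammer a n * pochhammer b n * rGamma (c + of_nat n) / fact n"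

lemma hyp2F1_reg_series_altdef:
  "hyp2F1_reg_series a b c z = (\<Sum>n. hyp_coeff a b c n * z ^ n)"
  unfolding hyp2F1_reg_series_def hyp_coeff_def by (intro suminf_cong) simp

lemma hyp_coeff_0 [simp]: "hyp_coeff a b c 0 = rGamma c"
  by (simp add: hyp_coeff_def)

lemma hyp_coeff_1: "hyp_coeff a b c (Suc 0) = a * b * rGamma (c + 1)"
  by (simp add: hyp_coeff_def)

lemma rGamma_plus_of_nat_Suc:
  "(c + of_nat n) * rGamma (c + of_nat (Suc n)) = (rGamma (c + of_nat n) :: complex)"
  using rGamma_plus1[of "c + of_nat n"] by (simp add: add_ac)

lemma hyp_coeff_Suc:
  "of_nat (Suc n) * (c + of_nat n) * hyp_coeff a b c (Suc n) =
     (a + of_nat n) * (b + of_nat n) * hyp_coeff a b c n"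
proof -
  have "of_nat (Suc n) * (c + of_nat n) * hyp_coeff a b c (Suc n) =
     (of_nat (Suc n) / fact (Suc n)) * (pochhammer a (Suc n) * pochhammer b (Suc n) *
       ((c + of_nat n) * rGamma (c + of_nat (Suc n))))"
    unfolding hyp_coeff_def by simp
  also have "of_nat (Suc n) / fact (Suc n) = (1 / fact n :: complex)"
    by (simp add: divide_simps del: of_nat_Suc)
  also note rGamma_plus_of_nat_Suc
  finally show ?thesis
    by (simp add: hyp_coeff_def pochhammer_Suc mult_ac)
qed

text \<open>The equation forces a recurrence on the Taylor coefficients of \<open>f\<close>, and the
  first two determine the rest because \<open>c + of_nat (Suc n)\<close> never vanishes. The
  transformation formulas below are reduced to this: check the equation, then compare value and
  derivative at 0. The sequence \<open>e\<close> is arbitrary, so multiples and other closed forms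
  of the coefficients are covered.\<close>

lemma hypergeometric_ode_sums:
  fixes f f' f'' :: "complex \<Rightarrow> complex" and e :: "nat \<Rightarrow> complex"
  assumes der1: "\<And>z. z \<in> ball 0 r \<Longrightarrow> (f has_field_derivative f' z) (at z)"
    and der2: "\<And>z. z \<in> ball 0 r \<Longrightarrow> (f' has_field_derivative f'' z) (at z)"
    and ode: "\<And>z. z \<in> ball 0 r \<Longrightarrow>
      z * (1 - z) * f'' z + (c - (a + b + 1) * z) * f' z - a * b * f z = 0"
    and c: "\<And>n. c + of_nat (Suc n) \<noteq> 0"
    and rec: "\<And>n. of_nat (Suc n) * (c + of_nat n) * e (Suc n) = (a + of_nat n) * (b + of_nat n) * e n"
    and e0: "e 0 = f 0" and e1: "e (Suc 0) = f' 0"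
    and z: "z \<in> ball 0 r"
  shows "(\<lambda>n. e n * z ^ n) sums f z"
proof -
  have r: "r > 0"
    using z norm_ge_zero[of z] by (simp add: dist_norm del: norm_ge_zero)
  have holf: "f holomorphic_on ball 0 r"
    using der1 by (meson holomorphic_on_def has_field_derivative_at_within field_differentiable_def)
  define F where "F = fps_expansion f 0"
  have F: "f has_fps_expansion F"
    unfolding F_def using holf r by (intro has_fps_expansion_fps_expansion[of "ball 0 r"]) auto
  have ev: "eventually (\<lambda>z. z \<in> ball 0 r) (nhds 0)"
    using r by (intro eventually_nhds_in_open) auto
  have F': "f' has_fps_expansion fps_deriv F"
  proof -
    have "eventually (\<lambda>z. deriv f z = f' z) (nhds 0)"
      using ev by eventually_elim (use der1 DERIV_imp_deriv in blast)
    with has_fps_expansion_deriv[OF F] show ?thesis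
      by (subst (asm) has_fps_expansion_cong[OF _ refl])
  qed
  have F'': "f'' has_fps_expansion fps_deriv (fps_deriv F)"
  proof -
    have "eventually (\<lambda>z. deriv f' z = f'' z) (nhds 0)"
      using ev by eventually_elim (use der2 DERIV_imp_deriv in blast)
    with has_fps_expansion_deriv[OF F'] show ?thesis
      by (subst (asm) has_fps_expansion_cong[OF _ refl])
  qed
  define G where "G = fps_X * (1 - fps_X) * fps_deriv (fps_deriv F)
      + (fps_const c - fps_const (a + b + 1) * fps_X) * fps_deriv F - fps_const (a * b) * F"
  have "(\<lambda>z. z * (1 - z) * f'' z + (c - (a + b + 1) * z) * f' z - a * b * f z) has_fps_expansion G"
    unfolding G_def by (intro fps_expansion_intros F F' F'')
  moreover have "eventually (\<lambda>z. z * (1 - z) * f'' z + (c - (a + b + 1) * z) * f' z - a * b * f z = 0) (nhds 0)"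
    using ev by eventually_elim (use ode in blast)
  ultimately have "(\<lambda>z. 0) has_fps_expansion G"
    by (subst (asm) has_fps_expansion_cong[OF _ refl])
  hence G0: "G = 0"
    using fps_expansion_unique_complex has_fps_expansion_0 by blast
  have recF: "of_nat (Suc n) * (c + of_nat n) * fps_nth F (Suc n) =
      (a + of_nat n) * (b + of_nat n) * fps_nth F n" for n
  proof -
    define D where "D = fps_deriv F"
    define E where "E = fps_deriv D"
    have "G = fps_X * E - fps_X * (fps_X * E) + fps_const c * D
       - fps_const (a + b + 1) * (fps_X * D) - fps_const (a * b) * F"
      unfolding G_def D_def E_def by (simp add: algebra_simps)
    hence "0 = fps_nth (fps_X * E - fps_X * (fps_X * E) + fps_const c * D
       - fps_const (a + b + 1) * (fps_X * D) - fps_const (a * b) * F) n"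
      using G0 by simp
    \<comment> \<open>The truncated \<open>n - 1\<close> is harmless at \<open>n = 0\<close>, since
      its factor \<open>of_nat n\<close> vanishes there.\<close>
    also have "\<dots> = of_nat n * of_nat (Suc n) * fps_nth F (Suc n)
        - of_nat n * of_nat (n - 1) * fps_nth F n
       + c * of_nat (Suc n) * fps_nth F (Suc n) - (a + b + 1) * of_nat n * fps_nth F n - a * b * fps_nth F n"
    proof (cases n)
      case (Suc m)
      show ?thesis by (cases m) (simp_all add: Suc D_def E_def algebra_simps)
    qed (simp add: D_def)
    also have "\<dots> = of_nat (Suc n) * (c + of_nat n) * fps_nth F (Suc n) - (a + of_nat n) * (b + of_nat n) * fps_nth F n"
      by (cases n) (simp_all add: algebra_simps)
    finally show ?thesis by simp
  qed
  have "fps_nth F n = e n" for n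
  proof (induction n)
    case 0
    have "fps_nth F 0 = f 0" unfolding F_def fps_expansion_def by simp
    thus ?case using e0 by simp
  next
    case (Suc n)
    show ?case
    proof (cases n)
      \<comment> \<open>At \<open>n = 0\<close> the recurrence carries the factor \<open>c\<close>,
        which may be 0; the coefficient of index 1 is therefore compared with
        \<open>f' 0\<close>.\<close>
      case 0
      have "fps_nth F (Suc 0) = deriv f 0" unfolding F_def fps_expansion_def by simp
      also have "\<dots> = f' 0" using der1[of 0] r by (simp add: DERIV_imp_deriv)
      finally show ?thesis using e1 0 by simp
    next
      case (Suc m)
      have "of_nat (Suc n) * (c + of_nat n) \<noteq> 0"
        using c[of m] Suc by (simp del: of_nat_Suc)
      moreover have "of_nat (Suc n) * (c + of_nat n) * fps_nth F (Suc n) =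
                     of_nat (Suc n) * (c + of_nat n) * e (Suc n)"
        using recF[of n] rec[of n] Suc.IH by simp
      ultimately show ?thesis using mult_left_cancel by blast
    qed
  qed
  moreover have "(\<lambda>n. fps_nth F n * (z - 0) ^ n) sums f z"
    using holomorphic_power_series[OF holf z] unfolding F_def fps_expansion_def by simp
  ultimately show ?thesis by simp
qed

section \<open>Growth of Pochhammer symbols, reciprocal Gamma values and series coefficients\<close>

text \<open>The symbol is (n - 1)! n^a divided by \<open>Gamma_series' a n\<close>, which tends to
  the nonzero value Gamma a. At a nonpositive integer this limit fails, but there the symbol
  vanishes eventually.\<close>

lemma pochhammer_bound:
  fixes a :: complex
  obtains K where "\<And>n. n > 0 \<Longrightarrow> norm (pochhammer a n) \<le> K * fact (n - 1) * real n powr Re a"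
proof (cases "a \<in> \<int>\<^sub>\<le>\<^sub>0")
  case True
  then obtain m where m: "a = - of_nat m" by (auto elim!: nonpos_Ints_cases')
  \<comment> \<open>The sum over the finitely many nonzero symbols bounds each single
    quotient.\<close>
  define K where "K = (\<Sum>n\<le>m. norm (pochhammer a n) / (fact (n - 1) * real n powr Re a))"
  have K0: "K \<ge> 0" unfolding K_def by (intro sum_nonneg) auto
  have "norm (pochhammer a n) \<le> K * fact (n - 1) * real n powr Re a" if "n > 0" for n
  proof (cases "n \<le> m")
    case True
    have "norm (pochhammer a n) / (fact (n - 1) * real n powr Re a) \<le> K"
      unfolding K_def using True by (intro member_le_sum) auto
    thus ?thesis using that by (simp add: divide_simps mult_ac)
  next
    case False
    hence "pochhammer a n = 0" unfolding m by (intro pochhammer_of_nat_eq_0_lemma) auto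
    thus ?thesis using K0 by simp
  qed
  thus ?thesis using that by blast
next
  case False
  have "(\<lambda>n. inverse (Gamma_series' a n)) \<longlonglongrightarrow> inverse (Gamma a)"
    using False by (intro tendsto_inverse Gamma_series'_LIMSEQ) (simp add: Gamma_eq_zero_iff)
  hence "Bseq (\<lambda>n. inverse (Gamma_series' a n))"
    by (intro convergent_imp_Bseq) (auto simp: convergent_def)
  then obtain K where K: "\<And>n. norm (inverse (Gamma_series' a n)) \<le> K"
    by (auto simp: Bseq_def)
  have "norm (pochhammer a n) \<le> K * fact (n - 1) * real n powr Re a" if "n > 0" for n
    using K[of n] that
    by (simp add: Gamma_series'_def norm_divide norm_mult norm_inverse powr_def divide_simps mult_ac)
  thus ?thesis using that by blast
qed

text \<open>The value is \<open>rGamma c / pochhammer c n\<close>, and the convergent, hence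
  bounded, sequence \<open>Gamma_series' c\<close> controls the reciprocal of the symbol.\<close>

lemma rGamma_bound_pos:
  fixes c :: complex
  assumes "Re c > 0"
  obtains K where "\<And>n. n > 0 \<Longrightarrow> norm (rGamma (c + of_nat n)) \<le> K / (fact (n - 1) * real n powr Re c)"
proof -
  have c: "c \<notin> \<int>\<^sub>\<le>\<^sub>0" using assms by (auto elim!: nonpos_Ints_cases')
  have "Bseq (\<lambda>n. Gamma_series' c n)"
    by (intro convergent_imp_Bseq) (use Gamma_series'_LIMSEQ in \<open>auto simp: convergent_def\<close>)
  then obtain K where K: "\<And>n. norm (Gamma_series' c n) \<le> K"
    by (auto simp: Bseq_def)
  have "norm (rGamma (c + of_nat n)) \<le> (norm (rGamma c) * K) / (fact (n - 1) * real n powr Re c)" if n: "n > 0" for n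
  proof -
    have nz: "pochhammer c n \<noteq> 0" using c pochhammer_eq_0_imp_nonpos_Int by blast
    have "rGamma (c + of_nat n) = rGamma c / pochhammer c n"
      using pochhammer_rGamma[of c n] nz by (simp add: field_simps)
    hence "norm (rGamma (c + of_nat n)) = norm (rGamma c) * (1 / norm (pochhammer c n))"
      by (simp add: norm_divide)
    also have "1 / norm (pochhammer c n) \<le> K / (fact (n - 1) * real n powr Re c)"
      using K[of n] n nz
      by (simp add: Gamma_series'_def norm_divide norm_mult powr_def divide_simps mult_ac)
    finally show ?thesis by (simp add: mult_left_mono)
  qed
  thus ?thesis using that by blast
qed

lemma pochhammer_poly_bound:
  fixes a :: complex
  obtains K N where "K \<ge> 0" "\<And>n. norm (pochhammer a n) \<le> K * fact n * real (Suc n) ^ N"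
proof -
  obtain K0 where K0: "\<And>n. n > 0 \<Longrightarrow> norm (pochhammer a n) \<le> K0 * fact (n - 1) * real n powr Re a"
    using pochhammer_bound[of a] by blast
  define N where "N = nat \<lceil>\<bar>Re a\<bar>\<rceil>"
  define K where "K = max 1 \<bar>K0\<bar>"
  have "norm (pochhammer a n) \<le> K * fact n * real (Suc n) ^ N" for n
  proof (cases "n = 0")
    case False
    have "real n powr Re a \<le> real (Suc n) powr real N"
    proof -
      have "real n powr Re a \<le> real n powr real N"
        using False unfolding N_def by (intro powr_mono) (linarith, simp)
      also have "\<dots> \<le> real (Suc n) powr real N" by (intro powr_mono2) auto
      finally show ?thesis .
    qed
    hence "real n powr Re a \<le> real (Suc n) ^ N" by (simp add: powr_realpow)
    moreover have "fact (n - 1) \<le> (fact n :: real)" by (intro fact_mono) auto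
    moreover have "K0 \<le> K" "K \<ge> 0" unfolding K_def by auto
    ultimately have "K0 * fact (n - 1) * real n powr Re a \<le> K * fact n * real (Suc n) ^ N"
      by (intro mult_mono) auto
    with K0[of n] False show ?thesis by simp
  qed (simp add: K_def)
  moreover have "K \<ge> 0" unfolding K_def by auto
  ultimately show ?thesis using that by blast
qed

text \<open>The argument is shifted by \<open>m\<close> into the right half-plane, where
  \<open>rGamma_bound_pos\<close> applies. The shift costs \<open>m\<close> linear factors, and
  passing from (n - 1)! to n! costs one more power.\<close>

lemma rGamma_poly_bound:
  fixes c :: complex
  obtains K N where "K \<ge> 0" "\<And>n. norm (rGamma (c + of_nat n)) \<le> K * real (Suc n) ^ N / fact n"
proof -
  define m where "m = nat \<lceil>\<bar>Re c\<bar>\<rceil> + 1"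
  have m: "Re (c + of_nat m) > 0" unfolding m_def by simp linarith
  obtain K0 where K0: "\<And>n. n > 0 \<Longrightarrow> norm (rGamma (c + of_nat m + of_nat n)) \<le> K0 / (fact (n - 1) * real n powr Re (c + of_nat m))"
    using rGamma_bound_pos[OF m] by blast
  define L where "L = norm c + real m + 1"
  have L: "L \<ge> 1" unfolding L_def by auto
  define K where "K = max (norm (rGamma c)) (L ^ m * \<bar>K0\<bar>)"
  have K: "K \<ge> 0" unfolding K_def by (simp add: le_max_iff_disj)
  have "norm (rGamma (c + of_nat n)) \<le> K * real (Suc n) ^ (m + 1) / fact n" for n
  proof (cases "n = 0")
    case False
    have "norm (pochhammer (c + of_nat n) m) = (\<Prod>i<m. norm (c + of_nat n + of_nat i))"
      by (simp add: pochhammer_prod prod_norm[symmetric] lessThan_atLeast0)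
    also have "\<dots> \<le> (\<Prod>i<m. L * real (Suc n))"
    proof (intro prod_mono conjI)
      fix i assume "i \<in> {..<m}"
      have "norm (c + of_nat n + of_nat i) \<le> norm c + norm (of_nat n :: complex) + norm (of_nat i :: complex)"
        by (metis (no_types, lifting) add_mono_thms_linordered_semiring(3) norm_triangle_ineq order_trans)
      also have "\<dots> \<le> L + real n" using \<open>i \<in> {..<m}\<close> unfolding L_def by simp
      also have "\<dots> \<le> L * real (Suc n)" using L mult_right_mono[of 1 L "real n"] by (simp add: algebra_simps)
      finally show "norm (c + of_nat n + of_nat i) \<le> L * real (Suc n)" .
    qed auto
    also have "\<dots> = L ^ m * real (Suc n) ^ m" by (simp add: power_mult_distrib)
    finally have 1: "norm (pochhammer (c + of_nat n) m) \<le> L ^ m * real (Suc n) ^ m" .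
    have "norm (rGamma (c + of_nat m + of_nat n)) \<le> \<bar>K0\<bar> * real (Suc n) / fact n"
    proof -
      have "1 \<le> real n powr Re (c + of_nat m)"
        using False m by (intro ge_one_powr_ge_zero) auto
      hence "fact (n - 1) \<le> fact (n - 1) * real n powr Re (c + of_nat m)"
        by simp
      hence "K0 / (fact (n - 1) * real n powr Re (c + of_nat m)) \<le> \<bar>K0\<bar> / fact (n - 1)"
        using False by (intro frac_le) auto
      also have "\<dots> = \<bar>K0\<bar> * real n / fact n"
        using False by (simp add: fact_reduce[of n])
      also have "\<dots> \<le> \<bar>K0\<bar> * real (Suc n) / fact n"
        by (intro divide_right_mono mult_left_mono) auto
      finally show ?thesis using K0[of n] False by simp
    qed
    hence "norm (pochhammer (c + of_nat n) m * rGamma (c + of_nat m + of_nat n)) \<le>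
       (L ^ m * real (Suc n) ^ m) * (\<bar>K0\<bar> * real (Suc n) / fact n)"
      unfolding norm_mult using 1 L by (intro mult_mono) auto
    also have "\<dots> = (L ^ m * \<bar>K0\<bar>) * real (Suc n) ^ (m + 1) / fact n" by simp
    also have "\<dots> \<le> K * real (Suc n) ^ (m + 1) / fact n"
      unfolding K_def by (intro divide_right_mono mult_right_mono) auto
    also have "pochhammer (c + of_nat n) m * rGamma (c + of_nat m + of_nat n) = rGamma (c + of_nat n)"
      using pochhammer_rGamma[of "c + of_nat n" m] by (simp add: add_ac)
    finally show ?thesis .
  qed (simp add: K_def)
  thus ?thesis using that K by blast
qed

text \<open>Since \<open>diffs\<close> turns n^N into (n + 1)^(N + 1), each further power comes from
  differentiating a convergent power series once more.\<close>

lemma summable_poly_powser: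
  fixes x :: real
  assumes "\<bar>x\<bar> < 1"
  shows "summable (\<lambda>n. real (Suc n) ^ N * x ^ n)"
proof -
  have *: "summable (\<lambda>n. real n ^ N * x ^ n)" if "\<bar>x\<bar> < 1" for x and N
    using that
  proof (induction N arbitrary: x)
    case 0
    thus ?case by (simp add: summable_geometric)
  next
    case (Suc N)
    have "summable (\<lambda>n. diffs (\<lambda>n. real n ^ N) n * x ^ n)"
      by (rule termdiff_converges[where K = 1]) (use Suc in auto)
    hence "summable (\<lambda>n. x * (diffs (\<lambda>n. real n ^ N) n * x ^ n))"
      by (intro summable_mult)
    hence "summable (\<lambda>n. real (Suc n) ^ Suc N * x ^ Suc n)"
      by (simp add: diffs_def mult_ac)
    thus ?case by (subst (asm) summable_Suc_iff)
  qed
  show ?thesis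
  proof (cases N)
    case 0
    thus ?thesis using assms by (simp add: summable_geometric)
  next
    case (Suc M)
    have "summable (\<lambda>n. diffs (\<lambda>n. real n ^ M) n * x ^ n)"
      by (rule termdiff_converges[where K = 1]) (use assms * in auto)
    thus ?thesis by (simp add: diffs_def Suc mult_ac)
  qed
qed

text \<open>Equivalent to the maximality of the central binomial coefficient in row 2n + 2k.\<close>

lemma fact_mult_fact_le:
  "fact (n + k) * fact (n + k) \<le> (fact (2 * n + k) * fact k :: real)"
proof -
  have "(2 * n + 2 * k) choose k \<le> (2 * (n + k)) choose (n + k)"
    using binomial_maximum'[of "n + k" k] by simp
  hence "real ((2 * (n + k)) choose k) \<le> real ((2 * (n + k)) choose (n + k))"
    by (intro of_nat_mono) (simp add: algebra_simps)
  also have "real ((2 * (n + k)) choose (n + k)) = fact (2 * (n + k)) / (fact (n + k) * fact (2 * (n + k) - (n + k)))"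
    by (rule binomial_fact) simp
  also have "2 * (n + k) - (n + k) = n + k" by simp
  also have "real ((2 * (n + k)) choose k) = fact (2 * (n + k)) / (fact k * fact (2 * (n + k) - k))"
    by (rule binomial_fact) simp
  also have "2 * (n + k) - k = 2 * n + k" by simp
  finally show ?thesis by (simp add: divide_simps mult_ac)
qed

text \<open>By \<open>fact_mult_fact_le\<close> the factorials of the three estimates cancel, so the
  growth is polynomial in both indices. The case n = 0 gives convergence of the hypergeometric
  series, the general case that of the Burchnall--Chaundy expansion.\<close>

lemma hyp_double_coeff_bound:
  fixes a b c :: complex
  obtains K N where "K \<ge> 0"
    "\<And>n k. norm (pochhammer a (n + k) * pochhammer b (n + k) * rGamma (c + of_nat (2 * n + k)) / fact k)
       \<le> K * real (Suc n) ^ N * real (Suc k) ^ N"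
proof -
  obtain K1 N1 where K1: "K1 \<ge> 0" "\<And>n. norm (pochhammer a n) \<le> K1 * fact n * real (Suc n) ^ N1"
    using pochhammer_poly_bound[of a] by blast
  obtain K2 N2 where K2: "K2 \<ge> 0" "\<And>n. norm (pochhammer b n) \<le> K2 * fact n * real (Suc n) ^ N2"
    using pochhammer_poly_bound[of b] by blast
  obtain K3 N3 where K3: "K3 \<ge> 0" "\<And>n. norm (rGamma (c + of_nat n)) \<le> K3 * real (Suc n) ^ N3 / fact n"
    using rGamma_poly_bound[of c] by blast
  define N where "N = N1 + N2 + N3"
  define K where "K = K1 * K2 * (K3 * 2 ^ N3)"
  have "norm (pochhammer a (n + k) * pochhammer b (n + k) * rGamma (c + of_nat (2 * n + k)) / fact k)
       \<le> K * real (Suc n) ^ N * real (Suc k) ^ N" for n k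
  proof -
    \<comment> \<open>\<open>M\<close> dominates n + k + 1 and, up to the factor 2, also 2n + k + 1;
      as a product it separates the two indices.\<close>
    define M where "M = real (Suc n) * real (Suc k)"
    have M: "real (Suc (n + k)) \<le> M" "real (Suc (2 * n + k)) \<le> 2 * M"
      unfolding M_def by (simp_all add: algebra_simps)
    have a: "norm (pochhammer a (n + k)) \<le> K1 * fact (n + k) * M ^ N1"
      by (rule order_trans[OF K1(2)]) (use K1 M in \<open>intro mult_left_mono power_mono; simp\<close>)
    have b: "norm (pochhammer b (n + k)) \<le> K2 * fact (n + k) * M ^ N2"
      by (rule order_trans[OF K2(2)]) (use K2 M in \<open>intro mult_left_mono power_mono; simp\<close>)
    have c: "norm (rGamma (c + of_nat (2 * n + k))) \<le> K3 * (2 * M) ^ N3 / fact (2 * n + k)"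
      by (rule order_trans[OF K3(2)])
        (use K3 M in \<open>intro divide_right_mono mult_left_mono power_mono; simp\<close>)
    have M0: "M \<ge> 0" unfolding M_def by simp
    have "norm (pochhammer a (n + k) * pochhammer b (n + k) * rGamma (c + of_nat (2 * n + k)) / fact k)
       \<le> (K1 * fact (n + k) * M ^ N1) * (K2 * fact (n + k) * M ^ N2) * (K3 * (2 * M) ^ N3 / fact (2 * n + k)) / fact k"
      unfolding norm_mult norm_divide norm_fact
      using K1(1) K2(1) K3(1) M0
      by (intro divide_right_mono mult_mono a b c mult_nonneg_nonneg) simp_all
    also have "\<dots> = K * M ^ N * ((fact (n + k) * fact (n + k)) / (fact (2 * n + k) * fact k))"
      unfolding K_def N_def by (simp add: power_mult_distrib power_add mult_ac)
    also have "\<dots> \<le> K * M ^ N * 1"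
      using fact_mult_fact_le[of n k] K1 K2 K3 M0
      by (intro mult_left_mono) (auto simp: K_def divide_simps)
    finally show ?thesis by (simp add: M_def power_mult_distrib mult_ac)
  qed
  moreover have "K \<ge> 0" unfolding K_def using K1 K2 K3 by simp
  ultimately show ?thesis using that by blast
qed

lemma hyp_coeff_poly_bound:
  obtains K N where "K \<ge> 0" "\<And>n. norm (hyp_coeff a b c n) \<le> K * real (Suc n) ^ N"
proof -
  obtain K N where KN: "K \<ge> 0"
    "\<And>n k. norm (pochhammer a (n + k) * pochhammer b (n + k) * rGamma (c + of_nat (2 * n + k)) / fact k)
       \<le> K * real (Suc n) ^ N * real (Suc k) ^ N"
    using hyp_double_coeff_bound[of a b c] by blast
  show ?thesis
    by (rule that[of K N]) (use KN(1) KN(2)[of 0] in \<open>simp_all add: hyp_coeff_def\<close>)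
qed

lemma summable_norm_hyp_coeff:
  assumes "0 \<le> x" "x < (1::real)"
  shows "summable (\<lambda>n. norm (hyp_coeff a b c n) * x ^ n)"
proof -
  obtain K N where KN: "K \<ge> 0" "\<And>n. norm (hyp_coeff a b c n) \<le> K * real (Suc n) ^ N"
    using hyp_coeff_poly_bound by blast
  have "summable (\<lambda>n. K * (real (Suc n) ^ N * x ^ n))"
    using assms by (intro summable_mult summable_poly_powser) auto
  thus ?thesis
    by (rule summable_comparison_test'[where N = 0])
      (use KN assms in \<open>auto simp: norm_mult mult.assoc[symmetric] intro!: mult_right_mono\<close>)
qed

section \<open>Derivative, differential equation and contiguous relation of the series\<close>

lemma summable_hyp_series:
  assumes "norm z < 1"
  shows "summable (\<lambda>n. hyp_coeff a b c n * z ^ n)"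
  by (rule summable_norm_cancel)
    (use summable_norm_hyp_coeff[of "norm z" a b c] assms in \<open>simp add: norm_mult norm_power\<close>)

lemma hyp_series_sums:
  assumes "norm z < 1"
  shows "(\<lambda>n. hyp_coeff a b c n * z ^ n) sums hyp2F1_reg_series a b c z"
  unfolding hyp2F1_reg_series_altdef using summable_hyp_series[OF assms] by (rule summable_sums)

lemma hyp_series_0 [simp]: "hyp2F1_reg_series a b c 0 = rGamma c"
  unfolding hyp2F1_reg_series_altdef by (subst powser_zero) simp

lemma diffs_hyp_coeff:
  "diffs (hyp_coeff a b c) = (\<lambda>n. a * b * hyp_coeff (a + 1) (b + 1) (c + 1) n)"
proof
  fix n
  have "diffs (hyp_coeff a b c) n = (of_nat (Suc n) / fact (Suc n)) *
      (pochhammer a (Suc n) * pochhammer b (Suc n) * rGamma (c + of_nat (Suc n)))"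
    unfolding diffs_def hyp_coeff_def by simp
  also have "of_nat (Suc n) / fact (Suc n) = (1 / fact n :: complex)"
    by (simp add: divide_simps del: of_nat_Suc)
  also have "1 / fact n * (pochhammer a (Suc n) * pochhammer b (Suc n) * rGamma (c + of_nat (Suc n))) =
      a * b * hyp_coeff (a + 1) (b + 1) (c + 1) n"
    by (simp add: hyp_coeff_def pochhammer_rec add_ac mult_ac)
  finally show "diffs (hyp_coeff a b c) n = a * b * hyp_coeff (a + 1) (b + 1) (c + 1) n" .
qed

lemma hyp_series_diffs_sums:
  assumes "norm z < 1"
  shows "(\<lambda>n. diffs (hyp_coeff a b c) n * z ^ n) sums (a * b * hyp2F1_reg_series (a + 1) (b + 1) (c + 1) z)"
  unfolding diffs_hyp_coeff mult.assoc[of "a * b"] by (intro sums_mult hyp_series_sums assms)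

lemma hyp_series_deriv:
  assumes "norm z < 1"
  shows "(hyp2F1_reg_series a b c has_field_derivative
            a * b * hyp2F1_reg_series (a + 1) (b + 1) (c + 1) z) (at z)"
proof -
  obtain r where r: "norm z < r" "r < 1" using assms dense by blast
  have "((\<lambda>z. \<Sum>n. hyp_coeff a b c n * z ^ n) has_field_derivative
          (\<Sum>n. diffs (hyp_coeff a b c) n * z ^ n)) (at z)"
    by (rule termdiffs_strong[where K = "of_real r"])
      (use r norm_ge_zero[of z] in \<open>auto intro!: summable_hyp_series simp del: norm_ge_zero\<close>)
  also have "(\<Sum>n. diffs (hyp_coeff a b c) n * z ^ n) = a * b * hyp2F1_reg_series (a + 1) (b + 1) (c + 1) z"
    using hyp_series_diffs_sums[OF assms] by (simp add: sums_iff)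
  finally show ?thesis unfolding hyp2F1_reg_series_altdef[abs_def] .
qed

lemma hyp_series_holomorphic: "hyp2F1_reg_series a b c holomorphic_on ball 0 1"
  unfolding holomorphic_on_def field_differentiable_def
proof
  fix z :: complex assume "z \<in> ball 0 1"
  hence "norm z < 1" by simp
  from hyp_series_deriv[OF this, of a b c]
  show "\<exists>f'. (hyp2F1_reg_series a b c has_field_derivative f') (at z within ball 0 1)"
    by (blast intro: has_field_derivative_at_within)
qed

lemma sums_times_diffs:
  fixes h :: "nat \<Rightarrow> complex"
  assumes "(\<lambda>n. diffs h n * z ^ n) sums s"
  shows "(\<lambda>n. of_nat n * h n * z ^ n) sums (z * s)"
proof -
  have "(\<lambda>n. z * (diffs h n * z ^ n)) sums (z * s)"
    using assms by (rule sums_mult)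
  hence "(\<lambda>n. of_nat (Suc n) * h (Suc n) * z ^ Suc n) sums (z * s)"
    by (simp add: diffs_def mult_ac)
  thus ?thesis by (subst (asm) sums_Suc_iff) simp
qed

text \<open>The coefficient of z^n in the equation is the recurrence
  \<open>hyp_coeff_Suc\<close>.\<close>

lemma hyp_series_ode:
  assumes "norm z < 1"
  shows "z * (1 - z) * (a * b * ((a + 1) * (b + 1) * hyp2F1_reg_series (a + 2) (b + 2) (c + 2) z))
     + (c - (a + b + 1) * z) * (a * b * hyp2F1_reg_series (a + 1) (b + 1) (c + 1) z)
     - a * b * hyp2F1_reg_series a b c z = 0"
proof -
  define h where "h = hyp_coeff a b c"
  define F0 where "F0 = hyp2F1_reg_series a b c z"
  define F1 where "F1 = a * b * hyp2F1_reg_series (a + 1) (b + 1) (c + 1) z"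
  define F2 where "F2 = a * b * ((a + 1) * (b + 1) * hyp2F1_reg_series (a + 2) (b + 2) (c + 2) z)"
  have s0: "(\<lambda>n. h n * z ^ n) sums F0"
    unfolding h_def F0_def by (rule hyp_series_sums[OF assms])
  have s1: "(\<lambda>n. diffs h n * z ^ n) sums F1"
    unfolding h_def F1_def by (rule hyp_series_diffs_sums[OF assms])
  have "(\<lambda>n. a * b * (diffs (hyp_coeff (a + 1) (b + 1) (c + 1)) n * z ^ n)) sums F2"
    unfolding F2_def using hyp_series_diffs_sums[OF assms, of "a + 1" "b + 1" "c + 1"]
    by (intro sums_mult) (simp add: add.assoc)
  hence s2: "(\<lambda>n. diffs (diffs h) n * z ^ n) sums F2"
    unfolding h_def diffs_hyp_coeff[of a b c] by (simp add: diffs_def mult_ac)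
  have t1: "(\<lambda>n. of_nat n * h n * z ^ n) sums (z * F1)" by (rule sums_times_diffs[OF s1])
  have t2: "(\<lambda>n. of_nat n * diffs h n * z ^ n) sums (z * F2)" by (rule sums_times_diffs[OF s2])
  \<comment> \<open>In this form z^2 F'' is again z times a derivative, so
    \<open>sums_times_diffs\<close> applies a second time.\<close>
  have "diffs (\<lambda>n. (of_nat n - 1) * h n) = (\<lambda>n. of_nat n * diffs h n)"
    by (auto simp: diffs_def fun_eq_iff)
  with t2 have "(\<lambda>n. diffs (\<lambda>n. (of_nat n - 1) * h n) n * z ^ n) sums (z * F2)" by simp
  from sums_times_diffs[OF this]
  have t3: "(\<lambda>n. of_nat n * ((of_nat n - 1) * h n) * z ^ n) sums (z * (z * F2))" .
  have "(\<lambda>n. of_nat n * diffs h n * z ^ n - of_nat n * ((of_nat n - 1) * h n) * z ^ n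
          + (c * (diffs h n * z ^ n) - (a + b + 1) * (of_nat n * h n * z ^ n)) - a * b * (h n * z ^ n))
     sums (z * F2 - z * (z * F2) + (c * F1 - (a + b + 1) * (z * F1)) - a * b * F0)"
    by (intro sums_add sums_diff sums_mult s0 s1 t1 t2 t3)
  also have "(\<lambda>n. of_nat n * diffs h n * z ^ n - of_nat n * ((of_nat n - 1) * h n) * z ^ n
          + (c * (diffs h n * z ^ n) - (a + b + 1) * (of_nat n * h n * z ^ n)) - a * b * (h n * z ^ n)) = (\<lambda>n. 0)"
  proof
    fix n
    have "of_nat n * diffs h n * z ^ n - of_nat n * ((of_nat n - 1) * h n) * z ^ n
          + (c * (diffs h n * z ^ n) - (a + b + 1) * (of_nat n * h n * z ^ n)) - a * b * (h n * z ^ n)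
        = (of_nat (Suc n) * (c + of_nat n) * h (Suc n) - (a + of_nat n) * (b + of_nat n) * h n) * z ^ n"
      by (simp add: diffs_def algebra_simps)
    thus "of_nat n * diffs h n * z ^ n - of_nat n * ((of_nat n - 1) * h n) * z ^ n
          + (c * (diffs h n * z ^ n) - (a + b + 1) * (of_nat n * h n * z ^ n)) - a * b * (h n * z ^ n) = 0"
      using hyp_coeff_Suc[of n c a b] by (simp add: h_def)
  qed
  finally have "z * F2 - z * (z * F2) + (c * F1 - (a + b + 1) * (z * F1)) - a * b * F0 = 0"
    using sums_unique2 sums_zero by blast
  thus ?thesis unfolding F0_def[symmetric] F1_def[symmetric] F2_def[symmetric]
    by (simp add: algebra_simps)
qed

text \<open>All terms are multiples of \<open>A\<close>; what remains is (a + n)(b + n) - n (c + n)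
  + (c - a - b)(c + n) = (c - a)(c - b). Summed at z = 1 the relation drives Gauss's theorem; as a
  relation between functions it causes the telescoping in the Burchnall--Chaundy expansion.\<close>

lemma hyp_coeff_contiguous:
  "of_nat (Suc n) * hyp_coeff a b c (Suc n) - of_nat n * hyp_coeff a b c n + (c - a - b) * hyp_coeff a b c n
     = (c - a) * (c - b) * hyp_coeff a b (c + 1) n"
proof -
  define A where "A = pochhammer a n * pochhammer b n * rGamma (c + 1 + of_nat n) / fact n"
  have "diffs (hyp_coeff a b c) n = (a * pochhammer (a + 1) n) * (b * pochhammer (b + 1) n) * rGamma (c + 1 + of_nat n) / fact n"
    unfolding diffs_hyp_coeff hyp_coeff_def by simp
  hence d: "of_nat (Suc n) * hyp_coeff a b c (Suc n) = (a + of_nat n) * (b + of_nat n) * A"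
    unfolding pochhammer_rec[symmetric] pochhammer_Suc A_def diffs_def by simp
  have h: "hyp_coeff a b c n = (c + of_nat n) * A"
    unfolding hyp_coeff_def A_def using rGamma_plus_of_nat_Suc[of c n]
    by (simp add: add_ac mult_ac)
  have "hyp_coeff a b (c + 1) n = A"
    unfolding hyp_coeff_def A_def by simp
  thus ?thesis
    unfolding d h by (simp add: algebra_simps)
qed

lemma hyp_series_contiguous:
  assumes "norm z < 1"
  shows "(1 - z) * (a * b * hyp2F1_reg_series (a + 1) (b + 1) (c + 1) z)
     + (c - a - b) * hyp2F1_reg_series a b c z = (c - a) * (c - b) * hyp2F1_reg_series a b (c + 1) z"
proof -
  define h where "h = hyp_coeff a b c"
  define F0 where "F0 = hyp2F1_reg_series a b c z"
  define F1 where "F1 = a * b * hyp2F1_reg_series (a + 1) (b + 1) (c + 1) z"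
  have s0: "(\<lambda>n. h n * z ^ n) sums F0"
    unfolding h_def F0_def by (rule hyp_series_sums[OF assms])
  have s1: "(\<lambda>n. diffs h n * z ^ n) sums F1"
    unfolding h_def F1_def by (rule hyp_series_diffs_sums[OF assms])
  have t1: "(\<lambda>n. of_nat n * h n * z ^ n) sums (z * F1)" by (rule sums_times_diffs[OF s1])
  have "(\<lambda>n. diffs h n * z ^ n - of_nat n * h n * z ^ n + (c - a - b) * (h n * z ^ n))
     sums (F1 - z * F1 + (c - a - b) * F0)"
    by (intro sums_add sums_diff sums_mult s0 s1 t1)
  also have "(\<lambda>n. diffs h n * z ^ n - of_nat n * h n * z ^ n + (c - a - b) * (h n * z ^ n)) =
     (\<lambda>n. (c - a) * (c - b) * (hyp_coeff a b (c + 1) n * z ^ n))"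
  proof
    fix n
    show "diffs h n * z ^ n - of_nat n * h n * z ^ n + (c - a - b) * (h n * z ^ n) =
       (c - a) * (c - b) * (hyp_coeff a b (c + 1) n * z ^ n)"
      using arg_cong[OF hyp_coeff_contiguous[of n a b c], of "\<lambda>t. t * z ^ n"]
      by (simp add: h_def diffs_def algebra_simps)
  qed
  finally have "(\<lambda>n. (c - a) * (c - b) * (hyp_coeff a b (c + 1) n * z ^ n)) sums (F1 - z * F1 + (c - a - b) * F0)" .
  moreover have "(\<lambda>n. (c - a) * (c - b) * (hyp_coeff a b (c + 1) n * z ^ n)) sums
      ((c - a) * (c - b) * hyp2F1_reg_series a b (c + 1) z)"
    by (intro sums_mult hyp_series_sums assms)
  ultimately have "F1 - z * F1 + (c - a - b) * F0 = (c - a) * (c - b) * hyp2F1_reg_series a b (c + 1) z"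
    by (rule sums_unique2)
  thus ?thesis unfolding F0_def[symmetric] F1_def[symmetric] by (simp add: algebra_simps)
qed

subsection \<open>Linear second-order differential equations on starlike domains\<close>

text \<open>Integrating a bound of order \<open>k\<close> along the segment raises it to order
  \<open>k + 1\<close>, as in Gronwall's argument. It serves both the convergence of the Picard
  iterates and uniqueness.\<close>

lemma segment_growth:
  fixes g g' :: "complex \<Rightarrow> complex"
  assumes der: "\<And>w. w \<in> closed_segment z0 z \<Longrightarrow> (g has_field_derivative g' w) (at w)"
    and bound: "\<And>w. w \<in> closed_segment z0 z \<Longrightarrow> norm (g' w) \<le> D * M * (M * norm (w - z0)) ^ k / fact k"
    and g0: "g z0 = 0"
  shows "norm (g z) \<le> D * (M * norm (z - z0)) ^ Suc k / fact (Suc k)"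
proof -
  define L where "L = norm (z - z0)"
  define p where "p = (\<lambda>t. z0 + of_real t * (z - z0))"
  have p_mem: "p t \<in> closed_segment z0 z" if "0 \<le> t" "t \<le> 1" for t
    unfolding p_def in_segment using that
    by (intro exI[of _ t]) (auto simp: scaleR_conv_of_real algebra_simps)
  have dp: "(g \<circ> p has_vector_derivative (z - z0) * g' (p t)) (at t)" if "0 \<le> t" "t \<le> 1" for t
  proof -
    have "(p has_vector_derivative (z - z0)) (at t)"
      unfolding p_def by (auto intro!: derivative_eq_intros)
    thus ?thesis by (rule field_vector_diff_chain_at) (rule der[OF p_mem[OF that]])
  qed
  have "norm ((g \<circ> p) 1 - (g \<circ> p) 0) \<le>
      D * (M * (1 * L)) ^ Suc k / fact (Suc k) - D * (M * (0 * L)) ^ Suc k / fact (Suc k)"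
  proof (rule differentiable_bound_general[where f' = "\<lambda>t. (z - z0) * g' (p t)" and
        \<phi> = "\<lambda>t. D * (M * (t * L)) ^ Suc k / fact (Suc k)" and
        \<phi>' = "\<lambda>t. L * (D * M * (M * (t * L)) ^ k / fact k)"])
    show "continuous_on {0..1} (g \<circ> p)"
      by (intro continuous_at_imp_continuous_on ballI has_vector_derivative_continuous[OF dp]) auto
    show "continuous_on {0..1} (\<lambda>t. D * (M * (t * L)) ^ Suc k / fact (Suc k))"
      by (intro continuous_intros) auto
    fix t :: real assume t: "0 < t" "t < 1"
    show "(g \<circ> p has_vector_derivative (z - z0) * g' (p t)) (at t)"
      using dp t by auto
    have "((\<lambda>t. D * (M * L) ^ Suc k / fact (Suc k) * t ^ Suc k) has_real_derivative
        D * (M * L) ^ Suc k / fact (Suc k) * (real (Suc k) * t ^ (Suc k - Suc 0))) (at t)"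
      by (intro DERIV_cmult DERIV_pow)
    also have "(\<lambda>t. D * (M * L) ^ Suc k / fact (Suc k) * t ^ Suc k) = (\<lambda>t. D * (M * (t * L)) ^ Suc k / fact (Suc k))"
      by (auto simp: fun_eq_iff power_mult_distrib)
    also have "D * (M * L) ^ Suc k / fact (Suc k) * (real (Suc k) * t ^ (Suc k - Suc 0)) = L * (D * M * (M * (t * L)) ^ k / fact k)"
      by (simp add: divide_simps power_mult_distrib del: of_nat_Suc)
    finally show "((\<lambda>t. D * (M * (t * L)) ^ Suc k / fact (Suc k)) has_vector_derivative
        L * (D * M * (M * (t * L)) ^ k / fact k)) (at t)"
      by (simp add: has_real_derivative_iff_has_vector_derivative)
    have "norm (p t - z0) = t * L"
      unfolding p_def L_def using t by (simp add: norm_mult)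
    hence "norm (g' (p t)) \<le> D * M * (M * (t * L)) ^ k / fact k"
      using bound[OF p_mem[of t]] t by simp
    thus "norm ((z - z0) * g' (p t)) \<le> L * (D * M * (M * (t * L)) ^ k / fact k)"
      unfolding norm_mult L_def[symmetric] by (intro mult_left_mono) (auto simp: L_def)
  qed simp
  thus ?thesis by (simp add: p_def g0 L_def)
qed

text \<open>A continuous image of a product of compact sets. It provides one compact set that
  contains all segments from \<open>z0\<close> to the points of a ball and on which the coefficients
  of an equation are bounded.\<close>

lemma compact_segment_hull:
  fixes z0 :: complex
  assumes "compact K"
  shows "compact (\<Union>z\<in>K. closed_segment z0 z)"
proof -
  have "(\<Union>z\<in>K. closed_segment z0 z) = (\<lambda>(t, z). z0 + of_real t * (z - z0)) ` ({0..1::real} \<times> K)"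
  proof -
    have "closed_segment z0 z = (\<lambda>t. z0 + of_real t * (z - z0)) ` {0..1}" for z
      unfolding closed_segment_image_interval by (simp add: scaleR_conv_of_real algebra_simps)
    thus ?thesis by force
  qed
  thus ?thesis
    by (auto intro!: compact_continuous_image compact_Times assms continuous_intros simp: case_prod_unfold)
qed

text \<open>Picard iteration along segments from \<open>z0\<close>; the iterates decay like \<open>(M |z - z0|)^k / k!\<close>.\<close>

lemma linear_ode_starlike:
  fixes P Q :: "complex \<Rightarrow> complex"
  assumes S: "open S" and z0: "z0 \<in> S" and star: "\<And>z. z \<in> S \<Longrightarrow> closed_segment z0 z \<subseteq> S"
    and P: "P holomorphic_on S" and Q: "Q holomorphic_on S"
  obtains w w' where "\<And>z. z \<in> S \<Longrightarrow> (w has_field_derivative w' z) (at z)"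
    "\<And>z. z \<in> S \<Longrightarrow> (w' has_field_derivative P z * w' z + Q z * w z) (at z)"
    "w z0 = A" "w' z0 = B"
proof -
  \<comment> \<open>The implication stands under the existential so that a choice yields one
    operator \<open>I\<close>, the primitive vanishing at \<open>z0\<close>.\<close>
  have "\<exists>g. f holomorphic_on S \<longrightarrow> g z0 = 0 \<and> (\<forall>z\<in>S. (g has_field_derivative f z) (at z))" for f
  proof (cases "f holomorphic_on S")
    case True
    have "\<exists>g. \<forall>x\<in>S. (g has_field_derivative f x) (at x)"
    proof (rule holomorphic_starlike_primitive[where k = "{}"])
      show "starlike S" unfolding starlike_def using z0 star by blast
    qed (use True S in \<open>auto simp: holomorphic_on_imp_continuous_on holomorphic_on_imp_differentiable_at\<close>)
    then obtain g where "\<forall>x\<in>S. (g has_field_derivative f x) (at x)" by blast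
    hence "\<forall>x\<in>S. ((\<lambda>z. g z - g z0) has_field_derivative f x) (at x)"
      by (auto intro!: derivative_eq_intros)
    thus ?thesis by (intro exI[of _ "\<lambda>z. g z - g z0"]) auto
  qed auto
  then obtain I where I0: "\<And>f. f holomorphic_on S \<Longrightarrow> I f z0 = 0"
    and I: "\<And>f z. f holomorphic_on S \<Longrightarrow> z \<in> S \<Longrightarrow> (I f has_field_derivative f z) (at z)"
    by metis
  have holI: "I f holomorphic_on S" if "f holomorphic_on S" for f
    using I[OF that] S by (auto simp: holomorphic_on_open)
  \<comment> \<open>The pairs are the successive increments of w and w' in the Picard iteration for
    the equivalent first-order system, so the solution is the sum of these functions.\<close>
  define X where "X = rec_nat (\<lambda>z::complex. A, \<lambda>z::complex. B) (\<lambda>_ x. (I (snd x), I (\<lambda>z. P z * snd x z + Q z * fst x z)))"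
  define u where "u = (\<lambda>n. fst (X n))"
  define v where "v = (\<lambda>n. snd (X n))"
  have u0: "u 0 = (\<lambda>_. A)" and v0: "v 0 = (\<lambda>_. B)"
    and uS: "u (Suc n) = I (v n)" and vS: "v (Suc n) = I (\<lambda>z. P z * v n z + Q z * u n z)" for n
    by (simp_all add: u_def v_def X_def)
  have hol: "u n holomorphic_on S \<and> v n holomorphic_on S" for n
  proof (induction n)
    case 0
    show ?case unfolding u0 v0 by simp
  next
    case (Suc n)
    thus ?case unfolding uS vS
      by (intro conjI holI holomorphic_on_add holomorphic_on_mult P Q) blast+
  qed
  have hol': "(\<lambda>z. P z * v n z + Q z * u n z) holomorphic_on S" for n
    using hol[of n] by (intro holomorphic_on_add holomorphic_on_mult P Q) blast+
  define u' where "u' = (\<lambda>n. case n of 0 \<Rightarrow> (\<lambda>_. 0) | Suc n \<Rightarrow> v n)"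
  define v' where "v' = (\<lambda>n. case n of 0 \<Rightarrow> (\<lambda>_. 0) | Suc n \<Rightarrow> (\<lambda>z. P z * v n z + Q z * u n z))"
  have der: "(u n has_field_derivative u' n z) (at z)" "(v n has_field_derivative v' n z) (at z)" if "z \<in> S" for n z
  proof -
    show "(u n has_field_derivative u' n z) (at z)"
    proof (cases n)
      case (Suc m)
      thus ?thesis using I[OF _ that, of "v m"] hol[of m] by (simp add: uS u'_def)
    qed (simp add: u0 u'_def)
    show "(v n has_field_derivative v' n z) (at z)"
    proof (cases n)
      case (Suc m)
      thus ?thesis using I[OF hol'[of m] that] by (simp add: vS v'_def)
    qed (simp add: v0 v'_def)
  qed
  define D where "D = norm A + norm B"
  have bound: "\<exists>d h. 0 < d \<and> summable (\<lambda>n. complex_of_real (h n)) \<and> (\<forall>n. h n \<ge> 0) \<and>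
      (\<forall>n. \<forall>y\<in>ball x d \<inter> S. norm (u n y) \<le> h n \<and> norm (v n y) \<le> h n)" if x: "x \<in> S" for x
  proof -
    obtain d where d: "d > 0" "cball x d \<subseteq> S" using S x by (meson open_contains_cball)
    define K where "K = (\<Union>z\<in>cball x d. closed_segment z0 z)"
    have K: "compact K" unfolding K_def by (intro compact_segment_hull) auto
    have KS: "K \<subseteq> S" unfolding K_def using d star by blast
    have Kseg: "closed_segment z0 z \<subseteq> K" if "z \<in> K" for z
    proof -
      from that obtain y where y: "y \<in> cball x d" "z \<in> closed_segment z0 y" unfolding K_def by blast
      hence "closed_segment z0 z \<subseteq> closed_segment z0 y" by (simp add: subset_closed_segment)
      thus ?thesis using y unfolding K_def by blast
    qed
    have "bounded ((\<lambda>z. norm (P z) + norm (Q z)) ` K)"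
      by (intro compact_imp_bounded compact_continuous_image K continuous_intros
          holomorphic_on_imp_continuous_on holomorphic_on_subset[OF P KS] holomorphic_on_subset[OF Q KS])
    then obtain M0 where M0: "\<And>z. z \<in> K \<Longrightarrow> norm (P z) + norm (Q z) \<le> M0"
      unfolding bounded_iff by (metis (no_types, lifting) imageI abs_le_iff real_norm_def)
    \<comment> \<open>With \<open>M\<close> at least 1 the same constant also covers the equation u'
      = v, whose coefficient is 1.\<close>
    define M where "M = max 1 M0"
    have M: "M \<ge> 1" "\<And>z. z \<in> K \<Longrightarrow> norm (P z) + norm (Q z) \<le> M" using M0 unfolding M_def by fastforce+
    have growth: "\<forall>z\<in>K. norm (u n z) \<le> D * (M * norm (z - z0)) ^ n / fact n \<and>
        norm (v n z) \<le> D * (M * norm (z - z0)) ^ n / fact n" for n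
    proof (induction n)
      case 0
      show ?case by (auto simp: u0 v0 D_def)
    next
      case (Suc n)
      show ?case
      proof (intro ballI conjI)
        fix z assume z: "z \<in> K"
        note segK = Kseg[OF z]
        show "norm (u (Suc n) z) \<le> D * (M * norm (z - z0)) ^ Suc n / fact (Suc n)"
        proof (rule segment_growth)
          fix w assume w: "w \<in> closed_segment z0 z"
          show "(u (Suc n) has_field_derivative v n w) (at w)"
            using der(1)[of w "Suc n"] w segK KS by (auto simp: u'_def)
          have "norm (v n w) \<le> 1 * (D * (M * norm (w - z0)) ^ n / fact n)"
            using Suc w segK by auto
          also have "\<dots> \<le> M * (D * (M * norm (w - z0)) ^ n / fact n)"
            using M by (intro mult_right_mono) (auto simp: D_def)
          finally show "norm (v n w) \<le> D * M * (M * norm (w - z0)) ^ n / fact n"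
            by (simp add: mult_ac)
        qed (use hol in \<open>auto simp: uS I0\<close>)
        show "norm (v (Suc n) z) \<le> D * (M * norm (z - z0)) ^ Suc n / fact (Suc n)"
        proof (rule segment_growth)
          fix w assume w: "w \<in> closed_segment z0 z"
          show "(v (Suc n) has_field_derivative P w * v n w + Q w * u n w) (at w)"
            using der(2)[of w "Suc n"] w segK KS by (auto simp: v'_def)
          have "norm (P w * v n w + Q w * u n w) \<le> norm (P w) * norm (v n w) + norm (Q w) * norm (u n w)"
            by (metis norm_mult norm_triangle_ineq)
          also have "\<dots> \<le> norm (P w) * (D * (M * norm (w - z0)) ^ n / fact n) + norm (Q w) * (D * (M * norm (w - z0)) ^ n / fact n)"
            using Suc w segK by (intro add_mono mult_left_mono) auto
          also have "\<dots> = (norm (P w) + norm (Q w)) * (D * (M * norm (w - z0)) ^ n / fact n)"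
            by (rule distrib_right[symmetric])
          also have "\<dots> \<le> M * (D * (M * norm (w - z0)) ^ n / fact n)"
            using M w segK by (intro mult_right_mono) (auto simp: D_def)
          finally show "norm (P w * v n w + Q w * u n w) \<le> D * M * (M * norm (w - z0)) ^ n / fact n"
            by (simp add: mult_ac)
        qed (use hol' in \<open>auto simp: vS I0\<close>)
      qed
    qed
    define R where "R = norm (x - z0) + d"
    define h where "h = (\<lambda>n. D * (M * R) ^ n / fact n)"
    have R: "norm (y - z0) \<le> R" if "y \<in> ball x d" for y
    proof -
      have "norm (y - z0) \<le> norm (y - x) + norm (x - z0)"
        by (metis add.commute diff_add_cancel norm_triangle_ineq add_diff_eq)
      thus ?thesis using that unfolding R_def by (simp add: dist_norm norm_minus_commute)
    qed
    have "(\<lambda>n. (M * R) ^ n /\<^sub>R fact n) sums exp (M * R)" by (rule exp_converges)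
    hence "summable (\<lambda>n. D * ((M * R) ^ n /\<^sub>R fact n))" by (intro summable_mult sums_summable)
    hence sh: "summable (\<lambda>n. complex_of_real (h n))"
      unfolding summable_of_real_iff h_def by (simp add: divide_inverse mult_ac)
    have hn: "D * (M * norm (y - z0)) ^ n / fact n \<le> h n" if "y \<in> ball x d" for y n
      unfolding h_def using R[OF that] M
      by (intro divide_right_mono mult_left_mono power_mono) (auto simp: D_def)
    have "y \<in> K" if "y \<in> ball x d" for y
      unfolding K_def using that by (auto intro!: bexI[of _ y])
    hence "\<forall>n. \<forall>y\<in>ball x d \<inter> S. norm (u n y) \<le> h n \<and> norm (v n y) \<le> h n"
      using growth hn by (meson IntD1 order_trans)
    moreover have "\<forall>n. h n \<ge> 0" unfolding h_def using M d
      by (auto simp: R_def D_def intro!: divide_nonneg_nonneg mult_nonneg_nonneg)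
    ultimately show ?thesis using d sh by blast
  qed
  have bound': "\<exists>d h. 0 < d \<and> summable h \<and> range h \<subseteq> \<real>\<^sub>\<ge>\<^sub>0 \<and> (\<forall>\<^sub>F n in sequentially. \<forall>y\<in>ball x d \<inter> S. norm (f n y) \<le> cmod (h n))"
    if x: "x \<in> S" and f: "f = u \<or> f = v" for x and f :: "nat \<Rightarrow> complex \<Rightarrow> complex"
  proof -
    from bound[OF x] obtain d h where dh: "0 < d" "summable (\<lambda>n. complex_of_real (h n))" "\<forall>n. h n \<ge> 0"
      "\<forall>n. \<forall>y\<in>ball x d \<inter> S. norm (u n y) \<le> h n \<and> norm (v n y) \<le> h n" by blast
    show ?thesis
      by (rule exI[of _ d], rule exI[of _ "\<lambda>n. complex_of_real (h n)"]) (use dh f in auto)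
  qed
  obtain w w' where w: "\<forall>x\<in>S. (\<lambda>n. u n x) sums w x \<and> (\<lambda>n. u' n x) sums w' x \<and> (w has_field_derivative w' x) (at x)"
    using series_and_derivative_comparison_complex[OF S der(1) bound'[of _ u]] by auto
  obtain y y' where y: "\<forall>x\<in>S. (\<lambda>n. v n x) sums y x \<and> (\<lambda>n. v' n x) sums y' x \<and> (y has_field_derivative y' x) (at x)"
    using series_and_derivative_comparison_complex[OF S der(2) bound'[of _ v]] by auto
  \<comment> \<open>Differentiation shifts the index: the derivative of the increment n + 1 of u is
    the increment n of v, and the increment 0 is constant.\<close>
  have w'y: "w' x = y x" if "x \<in> S" for x
  proof -
    have "(\<lambda>n. u' (Suc n) x) sums y x" using y that by (simp add: u'_def)
    hence "(\<lambda>n. u' n x) sums y x" by (subst (asm) sums_Suc_iff) (simp add: u'_def)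
    thus ?thesis using w that sums_unique2 by blast
  qed
  have y'eq: "y' x = P x * y x + Q x * w x" if "x \<in> S" for x
  proof -
    have "(\<lambda>n. v' (Suc n) x) sums (P x * y x + Q x * w x)"
      using y w that by (auto simp: v'_def intro!: sums_add sums_mult)
    hence "(\<lambda>n. v' n x) sums (P x * y x + Q x * w x)" by (subst (asm) sums_Suc_iff) (simp add: v'_def)
    thus ?thesis using y that sums_unique2 by blast
  qed
  \<comment> \<open>Apart from the constants all increments vanish at \<open>z0\<close>, so the sums
    take the prescribed initial values.\<close>
  have "(\<lambda>n. u n z0) sums A"
  proof -
    have "u n z0 = 0" if "n \<notin> {0}" for n
      using that hol by (cases n) (auto simp: uS I0)
    from sums_finite[of "{0}" "\<lambda>n. u n z0", OF _ this] show ?thesis by (simp add: u0)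
  qed
  hence "w z0 = A" using w z0 sums_unique2 by blast
  moreover have "(\<lambda>n. v n z0) sums B"
  proof -
    have "v n z0 = 0" if "n \<notin> {0}" for n
      using that hol' by (cases n) (auto simp: vS I0)
    from sums_finite[of "{0}" "\<lambda>n. v n z0", OF _ this] show ?thesis by (simp add: v0)
  qed
  hence "y z0 = B" using y z0 sums_unique2 by blast
  moreover have "(w has_field_derivative y z) (at z)" if "z \<in> S" for z
    using w w'y that by auto
  moreover have "(y has_field_derivative P z * y z + Q z * w z) (at z)" if "z \<in> S" for z
    using y y'eq that by auto
  ultimately show ?thesis using that by blast
qed

text \<open>The Picard estimate applied to the solution itself: with zero data its size is at most D
  (M |z - z0|)^n / n! for every n.\<close>

lemma linear_ode_unique_starlike:
  fixes P Q f f' :: "complex \<Rightarrow> complex"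
  assumes S: "open S" and z0: "z0 \<in> S" and star: "\<And>z. z \<in> S \<Longrightarrow> closed_segment z0 z \<subseteq> S"
    and P: "continuous_on S P" and Q: "continuous_on S Q"
    and f: "\<And>z. z \<in> S \<Longrightarrow> (f has_field_derivative f' z) (at z)"
    and f': "\<And>z. z \<in> S \<Longrightarrow> (f' has_field_derivative P z * f' z + Q z * f z) (at z)"
    and init: "f z0 = 0" "f' z0 = 0" and z: "z \<in> S"
  shows "f z = 0"
proof -
  define K where "K = closed_segment z0 z"
  have KS: "K \<subseteq> S" using star z unfolding K_def by blast
  have K: "compact K" unfolding K_def by simp
  have Kseg: "closed_segment z0 y \<subseteq> K" if "y \<in> K" for y
    using that unfolding K_def by (simp add: subset_closed_segment)
  have "bounded ((\<lambda>z. norm (P z) + norm (Q z)) ` K)"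
    by (intro compact_imp_bounded compact_continuous_image K continuous_intros
        continuous_on_subset[OF P KS] continuous_on_subset[OF Q KS])
  then obtain M0 where M0: "\<And>z. z \<in> K \<Longrightarrow> norm (P z) + norm (Q z) \<le> M0"
    unfolding bounded_iff by (metis (no_types, lifting) imageI abs_le_iff real_norm_def)
  define M where "M = max 1 M0"
  have M: "M \<ge> 1" "\<And>z. z \<in> K \<Longrightarrow> norm (P z) + norm (Q z) \<le> M" using M0 unfolding M_def by fastforce+
  have cont: "continuous_on K f" "continuous_on K f'"
    using KS f f' by (meson DERIV_continuous continuous_at_imp_continuous_on subsetD)+
  have "bounded ((\<lambda>z. norm (f z) + norm (f' z)) ` K)"
    by (intro compact_imp_bounded compact_continuous_image K continuous_intros cont)
  then obtain D where D: "\<And>z. z \<in> K \<Longrightarrow> norm (f z) + norm (f' z) \<le> D"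
    unfolding bounded_iff by (metis (no_types, lifting) imageI abs_le_iff real_norm_def)
  have "z \<in> K" unfolding K_def by simp
  have D0: "D \<ge> 0" using D[OF \<open>z \<in> K\<close>] by (meson add_nonneg_nonneg norm_ge_zero order_trans)
  have growth: "\<forall>z\<in>K. norm (f z) \<le> D * (M * norm (z - z0)) ^ n / fact n \<and>
        norm (f' z) \<le> D * (M * norm (z - z0)) ^ n / fact n" for n
  proof (induction n)
    case 0
    show ?case
    proof
      fix z assume "z \<in> K"
      from D[OF this] show "norm (f z) \<le> D * (M * norm (z - z0)) ^ 0 / fact 0 \<and>
        norm (f' z) \<le> D * (M * norm (z - z0)) ^ 0 / fact 0"
        using norm_ge_zero[of "f z"] norm_ge_zero[of "f' z"] by (simp del: norm_ge_zero)
    qed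
  next
    case (Suc n)
    show ?case
    proof (intro ballI conjI)
      fix z assume z: "z \<in> K"
      note segK = Kseg[OF z]
      show "norm (f z) \<le> D * (M * norm (z - z0)) ^ Suc n / fact (Suc n)"
      proof (rule segment_growth)
        fix w assume w: "w \<in> closed_segment z0 z"
        show "(f has_field_derivative f' w) (at w)" using f w segK KS by auto
        have "norm (f' w) \<le> 1 * (D * (M * norm (w - z0)) ^ n / fact n)"
          using Suc w segK by auto
        also have "\<dots> \<le> M * (D * (M * norm (w - z0)) ^ n / fact n)"
          using M D0 by (intro mult_right_mono) auto
        finally show "norm (f' w) \<le> D * M * (M * norm (w - z0)) ^ n / fact n"
          by (simp add: mult_ac)
      qed (use init in auto)
      show "norm (f' z) \<le> D * (M * norm (z - z0)) ^ Suc n / fact (Suc n)"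
      proof (rule segment_growth)
        fix w assume w: "w \<in> closed_segment z0 z"
        show "(f' has_field_derivative P w * f' w + Q w * f w) (at w)" using f' w segK KS by auto
        have "norm (P w * f' w + Q w * f w) \<le> norm (P w) * norm (f' w) + norm (Q w) * norm (f w)"
          by (metis norm_mult norm_triangle_ineq)
        also have "\<dots> \<le> norm (P w) * (D * (M * norm (w - z0)) ^ n / fact n) + norm (Q w) * (D * (M * norm (w - z0)) ^ n / fact n)"
          using Suc w segK by (intro add_mono mult_left_mono) auto
        also have "\<dots> = (norm (P w) + norm (Q w)) * (D * (M * norm (w - z0)) ^ n / fact n)"
          by (rule distrib_right[symmetric])
        also have "\<dots> \<le> M * (D * (M * norm (w - z0)) ^ n / fact n)"
          using M D0 w segK by (intro mult_right_mono) auto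
        finally show "norm (P w * f' w + Q w * f w) \<le> D * M * (M * norm (w - z0)) ^ n / fact n"
          by (simp add: mult_ac)
      qed (use init in auto)
    qed
  qed
  have "(\<lambda>n. (M * norm (z - z0)) ^ n /\<^sub>R fact n) sums exp (M * norm (z - z0))" by (rule exp_converges)
  hence "(\<lambda>n. D * ((M * norm (z - z0)) ^ n /\<^sub>R fact n)) \<longlonglongrightarrow> D * 0"
    by (intro tendsto_mult tendsto_const summable_LIMSEQ_zero sums_summable)
  hence "(\<lambda>n. D * (M * norm (z - z0)) ^ n / fact n) \<longlonglongrightarrow> 0"
    by (simp add: divide_inverse mult_ac)
  hence "norm (f z) \<le> 0"
    by (rule tendsto_lowerbound) (use growth \<open>z \<in> K\<close> in auto)
  thus ?thesis by simp
qed

text \<open>The solution on \<open>S\<close> with the data of \<open>f\<close> at \<open>z0\<close>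
  agrees with \<open>f\<close> on the convex set \<open>U\<close> by uniqueness.\<close>

lemma linear_ode_continuation:
  fixes P Q f f' :: "complex \<Rightarrow> complex"
  assumes S: "open S" and z0: "z0 \<in> S" and star: "\<And>z. z \<in> S \<Longrightarrow> closed_segment z0 z \<subseteq> S"
    and P: "P holomorphic_on S" and Q: "Q holomorphic_on S"
    and U: "open U" "U \<subseteq> S" "z0 \<in> U" "convex U"
    and f: "\<And>z. z \<in> U \<Longrightarrow> (f has_field_derivative f' z) (at z)"
    and f': "\<And>z. z \<in> U \<Longrightarrow> (f' has_field_derivative P z * f' z + Q z * f z) (at z)"
  obtains w where "w holomorphic_on S" "\<And>z. z \<in> U \<Longrightarrow> w z = f z"
proof -
  obtain w w' where w: "\<And>z. z \<in> S \<Longrightarrow> (w has_field_derivative w' z) (at z)"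
    "\<And>z. z \<in> S \<Longrightarrow> (w' has_field_derivative P z * w' z + Q z * w z) (at z)"
    "w z0 = f z0" "w' z0 = f' z0"
    using linear_ode_starlike[OF S z0 star P Q, of "f z0" "f' z0"] by blast
  have weq: "w z = f z" if z: "z \<in> U" for z
  proof -
    define g where "g = (\<lambda>z. w z - f z)"
    define g' where "g' = (\<lambda>z. w' z - f' z)"
    have seg: "closed_segment z0 z \<subseteq> U" if "z \<in> U" for z
      using U that by (simp add: closed_segment_subset)
    have cont: "continuous_on U P" "continuous_on U Q"
      using P Q U by (meson holomorphic_on_imp_continuous_on continuous_on_subset)+
    have g: "(g has_field_derivative g' z) (at z)" if "z \<in> U" for z
      unfolding g_def g'_def using w(1) f U that by (intro DERIV_diff) auto
    have g': "(g' has_field_derivative P z * g' z + Q z * g z) (at z)" if "z \<in> U" for z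
    proof -
      have "(g' has_field_derivative
          (P z * w' z + Q z * w z) - (P z * f' z + Q z * f z)) (at z)"
        unfolding g'_def using w(2) f' U that by (intro DERIV_diff) auto
      thus ?thesis by (simp add: algebra_simps g_def g'_def)
    qed
    have "g z0 = 0" "g' z0 = 0" using w by (simp_all add: g_def g'_def)
    from linear_ode_unique_starlike[OF U(1) U(3) seg cont g g' this z]
    show ?thesis by (simp add: g_def)
  qed
  moreover have "w holomorphic_on S"
    using w(1) S by (auto simp: holomorphic_on_open)
  ultimately show ?thesis using that weq by blast
qed

subsection \<open>Pfaff's transformation and the analytic continuation\<close>

lemma has_field_derivative_powr_one_minus:
  fixes k z :: complex
  assumes "1 - z \<notin> \<real>\<^sub>\<le>\<^sub>0"
  shows "((\<lambda>z. (1 - z) powr k) has_field_derivative (- k * ((1 - z) powr k / (1 - z)))) (at z)"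
proof -
  have "((\<lambda>z. (1 - z) powr k) has_field_derivative (- k * (1 - z) powr (k - 1))) (at z)"
    using assms by (auto intro!: derivative_eq_intros)
  also have "(1 - z) powr (k - 1) = (1 - z) powr k / (1 - z)"
    using assms by (subst powr_diff) auto
  finally show ?thesis .
qed

lemma norm_div_minus_one_less:
  assumes "Re z < 1 / 2"
  shows "norm (z / (z - 1)) < 1"
proof -
  have "z \<noteq> 1" using assms by auto
  moreover have "(norm z)\<^sup>2 < (norm (z - 1))\<^sup>2"
    using assms unfolding cmod_power2 by (simp add: power2_eq_square algebra_simps)
  hence "norm z < norm (z - 1)" using power2_less_imp_less by fastforce
  ultimately show ?thesis by (simp add: norm_divide)
qed

lemma one_minus_notin_nonpos_Reals:
  assumes "Re z < 1"
  shows "1 - z \<notin> \<real>\<^sub>\<le>\<^sub>0"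
  using assms by (auto simp: complex_nonpos_Reals_iff)

text \<open>The right-hand side of Pfaff's transformation. The map z / (z - 1) carries the
  half-plane Re z < 1/2 into the unit disc, so the series is usable there even for large z.\<close>

definition pfaff :: "complex \<Rightarrow> complex \<Rightarrow> complex \<Rightarrow> complex \<Rightarrow> complex" where
  "pfaff a b c z = (1 - z) powr (- a) * hyp2F1_reg_series a (c - b) c (z / (z - 1))"

lemma pfaff_ode:
  obtains f' f'' where
    "\<And>z. Re z < 1 / 2 \<Longrightarrow> (pfaff a b c has_field_derivative f' z) (at z)"
    "\<And>z. Re z < 1 / 2 \<Longrightarrow> (f' has_field_derivative f'' z) (at z)"
    "\<And>z. Re z < 1 / 2 \<Longrightarrow> z * (1 - z) * f'' z + (c - (a + b + 1) * z) * f' z - a * b * pfaff a b c z = 0"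
    "f' 0 = a * b * rGamma (c + 1)"
proof -
  define d where "d = c - b"
  define S0 where "S0 = hyp2F1_reg_series a d c"
  define S1 where "S1 = (\<lambda>w. a * d * hyp2F1_reg_series (a + 1) (d + 1) (c + 1) w)"
  define S2 where "S2 = (\<lambda>w. a * d * ((a + 1) * (d + 1) * hyp2F1_reg_series (a + 2) (d + 2) (c + 2) w))"
  have dS0: "(S0 has_field_derivative S1 w) (at w)" if "norm w < 1" for w
    unfolding S0_def S1_def by (rule hyp_series_deriv[OF that])
  have dS1: "(S1 has_field_derivative S2 w) (at w)" if "norm w < 1" for w
    unfolding S1_def S2_def using hyp_series_deriv[OF that, of "a + 1" "d + 1" "c + 1"]
    by (intro DERIV_cmult) (simp add: add.assoc)
  have Sode: "w * (1 - w) * S2 w + (c - (a + d + 1) * w) * S1 w - a * d * S0 w = 0" if "norm w < 1" for w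
    unfolding S0_def S1_def S2_def by (rule hyp_series_ode[OF that])
  define m where "m = (\<lambda>z::complex. (1 - z) powr (- a))"
  define w where "w = (\<lambda>z::complex. z / (z - 1))"
  \<comment> \<open>One has w = 1 - T, T' = T^2 and m' = a m T. Hence the derivatives are m times
    polynomials in \<open>T\<close> with values of \<open>S0\<close>, \<open>S1\<close>,
    \<open>S2\<close> as coefficients, and the equation becomes an algebraic identity.\<close>
  define T where "T = (\<lambda>z::complex. 1 / (1 - z))"
  define f' where "f' = (\<lambda>z. m z * (a * (S0 (w z) * T z) - S1 (w z) * T z ^ 2))"
  define f'' where "f'' = (\<lambda>z. m z * (a * (a + 1) * (S0 (w z) * T z ^ 2) - (2 * a + 2) * (S1 (w z) * T z ^ 3) + S2 (w z) * T z ^ 4))"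
  have f: "pfaff a b c = (\<lambda>z. m z * S0 (w z))"
    by (simp add: fun_eq_iff pfaff_def m_def S0_def d_def w_def)
  have dm: "(m has_field_derivative a * (m z * T z)) (at z)" if "Re z < 1 / 2" for z
    unfolding m_def T_def using has_field_derivative_powr_one_minus[of z "-a"] that
    by (simp add: one_minus_notin_nonpos_Reals)
  have dT: "(T has_field_derivative T z ^ 2) (at z)" if "Re z < 1 / 2" for z
  proof -
    have z: "z \<noteq> 1" using that by auto
    thus ?thesis
      unfolding T_def by (auto intro!: derivative_eq_intros simp: power2_eq_square)
  qed
  have dT2: "((\<lambda>z. T z ^ 2) has_field_derivative 2 * T z ^ 3) (at z)" if "Re z < 1 / 2" for z
    using DERIV_power[OF dT[OF that], of 2] by (simp add: power2_eq_square power3_eq_cube)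
  have wT: "w z = 1 - T z" if "Re z < 1 / 2" for z
  proof -
    have "z \<noteq> 1" using that by auto
    thus ?thesis unfolding w_def T_def by (simp add: divide_simps) (simp add: algebra_simps)
  qed
  have dw: "(w has_field_derivative - (T z ^ 2)) (at z)" if "Re z < 1 / 2" for z
  proof -
    have z: "z \<noteq> 1" using that by auto
    have "(w has_field_derivative (1 * (z - 1) - z * 1) / ((z - 1) * (z - 1))) (at z)"
      unfolding w_def using z by (auto intro!: derivative_eq_intros)
    also have "(1 * (z - 1) - z * 1) / ((z - 1) * (z - 1)) = - (T z ^ 2)"
      using z unfolding T_def by (simp add: divide_simps power2_eq_square) (simp add: algebra_simps)
    finally show ?thesis .
  qed
  have nw: "norm (w z) < 1" if "Re z < 1 / 2" for z
    unfolding w_def by (rule norm_div_minus_one_less[OF that])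
  have dS0w: "((\<lambda>z. S0 (w z)) has_field_derivative S1 (w z) * (- (T z ^ 2))) (at z)" if "Re z < 1 / 2" for z
    by (rule DERIV_chain2[OF dS0[OF nw[OF that]] dw[OF that]])
  have dS1w: "((\<lambda>z. S1 (w z)) has_field_derivative S2 (w z) * (- (T z ^ 2))) (at z)" if "Re z < 1 / 2" for z
    by (rule DERIV_chain2[OF dS1[OF nw[OF that]] dw[OF that]])
  show ?thesis
  proof (rule that[of f' f''])
    fix z :: complex assume z: "Re z < 1 / 2"
    have zT: "(1 - z) * T z = 1" unfolding T_def using z by auto
    have "((\<lambda>z. m z * S0 (w z)) has_field_derivative
        a * (m z * T z) * S0 (w z) + S1 (w z) * (- (T z ^ 2)) * m z) (at z)"
      by (rule DERIV_mult[OF dm[OF z] dS0w[OF z]])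
    also have "a * (m z * T z) * S0 (w z) + S1 (w z) * (- (T z ^ 2)) * m z = f' z"
      unfolding f'_def by (simp add: algebra_simps)
    finally show "(pfaff a b c has_field_derivative f' z) (at z)" unfolding f .
    have "(f' has_field_derivative
       a * (m z * T z) * (a * (S0 (w z) * T z) - S1 (w z) * T z ^ 2) +
       (a * (S1 (w z) * (- (T z ^ 2)) * T z + T z ^ 2 * S0 (w z))
        - (S2 (w z) * (- (T z ^ 2)) * T z ^ 2 + 2 * T z ^ 3 * S1 (w z))) * m z) (at z)"
      unfolding f'_def
      by (intro DERIV_mult DERIV_diff DERIV_cmult dm[OF z] dS0w[OF z] dS1w[OF z] dT[OF z] dT2[OF z])
    also have "a * (m z * T z) * (a * (S0 (w z) * T z) - S1 (w z) * T z ^ 2) +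
       (a * (S1 (w z) * (- (T z ^ 2)) * T z + T z ^ 2 * S0 (w z))
        - (S2 (w z) * (- (T z ^ 2)) * T z ^ 2 + 2 * T z ^ 3 * S1 (w z))) * m z = f'' z"
      unfolding f''_def by algebra
    finally show "(f' has_field_derivative f'' z) (at z)" .
    have ode: "(1 - T z) * T z * S2 (w z) + (c - (a + d + 1) * (1 - T z)) * S1 (w z) - a * d * S0 (w z) = 0"
      using Sode[OF nw[OF z]] unfolding wT[OF z] by simp
    \<comment> \<open>The equation for the transformed function is -m T times the equation for the
      series at \<open>w z\<close>.\<close>
    have "z * (1 - z) * f'' z + (c - (a + b + 1) * z) * f' z - a * b * (m z * S0 (w z)) =
       - m z * T z * ((1 - T z) * T z * S2 (w z) + (c - (a + d + 1) * (1 - T z)) * S1 (w z) - a * d * S0 (w z))"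
      unfolding f'_def f''_def d_def using zT by algebra
    thus "z * (1 - z) * f'' z + (c - (a + b + 1) * z) * f' z - a * b * pfaff a b c z = 0"
      unfolding f ode by simp
  next
    have "f' 0 = a * (rGamma c - d * rGamma (c + 1))"
      unfolding f'_def m_def w_def S0_def S1_def T_def by (simp add: algebra_simps)
    \<comment> \<open>This holds at c = 0 as well and turns the factor into c - d = b.\<close>
    also have "rGamma c = c * rGamma (c + 1)" by (simp add: rGamma_plus1)
    finally show "f' 0 = a * b * rGamma (c + 1)" by (simp add: d_def algebra_simps)
  qed
qed

lemma pfaff_holomorphic: "pfaff a b c holomorphic_on {z. Re z < 1 / 2}"
proof -
  obtain f' f'' where f:
    "\<And>z. Re z < 1 / 2 \<Longrightarrow> (pfaff a b c has_field_derivative f' z) (at z)"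
    "\<And>z. Re z < 1 / 2 \<Longrightarrow> (f' has_field_derivative f'' z) (at z)"
    "\<And>z. Re z < 1 / 2 \<Longrightarrow> z * (1 - z) * f'' z + (c - (a + b + 1) * z) * f' z - a * b * pfaff a b c z = 0"
    "f' 0 = a * b * rGamma (c + 1)"
    by (rule pfaff_ode[of a b c]) (rule that)
  show ?thesis
    unfolding holomorphic_on_open[OF open_halfspace_Re_lt] using f(1) by (auto simp del: times_divide_eq_right)
qed

text \<open>Both sides solve the same equation with equal value and derivative at 0; 1/2 is the
  radius of the largest disc about 0 inside the half-plane.\<close>

lemma hyp_series_eq_pfaff_near_0:
  assumes c: "\<And>n. c + of_nat (Suc n) \<noteq> 0" and z: "norm z < 1 / 2"
  shows "hyp2F1_reg_series a b c z = pfaff a b c z"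
proof -
  obtain f' f'' where f:
    "\<And>z. Re z < 1 / 2 \<Longrightarrow> (pfaff a b c has_field_derivative f' z) (at z)"
    "\<And>z. Re z < 1 / 2 \<Longrightarrow> (f' has_field_derivative f'' z) (at z)"
    "\<And>z. Re z < 1 / 2 \<Longrightarrow> z * (1 - z) * f'' z + (c - (a + b + 1) * z) * f' z - a * b * pfaff a b c z = 0"
    "f' 0 = a * b * rGamma (c + 1)"
    by (rule pfaff_ode[of a b c]) (rule that)
  have re: "Re z < 1 / 2" if "z \<in> ball 0 (1 / 2)" for z
    using that complex_Re_le_cmod[of z] by simp
  have "(\<lambda>n. hyp_coeff a b c n * z ^ n) sums pfaff a b c z"
  proof (rule hypergeometric_ode_sums[where r = "1 / 2" and f' = f' and f'' = f'' and a = a and b = b and c = c])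
    show "hyp_coeff a b c 0 = pfaff a b c 0" by (simp add: pfaff_def)
    show "hyp_coeff a b c (Suc 0) = f' 0" by (simp add: f(4) hyp_coeff_1)
    show "z \<in> ball 0 (1 / 2)" using z by simp
  qed (use f(1-3) re c in \<open>auto simp only: hyp_coeff_Suc\<close>)
  moreover have "(\<lambda>n. hyp_coeff a b c n * z ^ n) sums hyp2F1_reg_series a b c z"
    using z by (intro hyp_series_sums) auto
  ultimately show ?thesis using sums_unique2 by blast
qed

lemma hyp_series_eq_pfaff:
  assumes c: "\<And>n. c + of_nat (Suc n) \<noteq> 0" and z: "norm z < 1" "Re z < 1 / 2"
  shows "hyp2F1_reg_series a b c z = pfaff a b c z"
proof (rule analytic_continuation_open[where s = "ball 0 (1 / 2)" and s' = "ball 0 1 \<inter> {z. Re z < 1 / 2}"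
      and f = "hyp2F1_reg_series a b c" and g = "pfaff a b c" and z = z])
  show "connected (ball 0 1 \<inter> {z::complex. Re z < 1 / 2})"
    by (intro convex_connected convex_Int convex_ball convex_halfspace_Re_lt)
  show "open (ball 0 1 \<inter> {z::complex. Re z < 1 / 2})"
    by (intro open_Int open_halfspace_Re_lt) auto
  have "Re z < 1 / 2" if "norm z < 1 / 2" for z
    using that complex_Re_le_cmod[of z] by simp
  thus "ball 0 (1 / 2) \<subseteq> ball 0 1 \<inter> {z::complex. Re z < 1 / 2}" by auto
  show "hyp2F1_reg_series a b c holomorphic_on ball 0 1 \<inter> {z. Re z < 1 / 2}"
    by (rule holomorphic_on_subset[OF hyp_series_holomorphic]) auto
  show "pfaff a b c holomorphic_on ball 0 1 \<inter> {z. Re z < 1 / 2}"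
    by (rule holomorphic_on_subset[OF pfaff_holomorphic]) auto
qed (use z hyp_series_eq_pfaff_near_0[OF c] in auto)

section \<open>Continuation of the series to the plane slit along [1, infinity)\<close>

definition slit_plane :: "complex set" where
  "slit_plane = - complex_of_real ` {1..}"

lemma in_slit_plane_iff: "z \<in> slit_plane \<longleftrightarrow> Im z \<noteq> 0 \<or> Re z < 1"
proof -
  have "z \<in> complex_of_real ` {1..} \<longleftrightarrow> Im z = 0 \<and> Re z \<ge> 1"
    by (auto simp: image_iff complex_eq_iff intro!: bexI[of _ "Re z"])
  thus ?thesis unfolding slit_plane_def Compl_iff by (metis not_le)
qed

lemma open_slit_plane: "open slit_plane"
proof -
  have "slit_plane = {z. Re z < 1} \<union> ({z. Im z < 0} \<union> {z. Im z > 0})"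
    by (auto simp: in_slit_plane_iff)
  moreover have "open \<dots>"
    by (intro open_Un open_halfspace_Re_lt open_halfspace_Im_lt open_halfspace_Im_gt)
  ultimately show ?thesis by simp
qed

lemma closed_segment_subset_slit_plane:
  assumes "z \<in> slit_plane" "x < 1"
  shows "closed_segment (complex_of_real x) z \<subseteq> slit_plane"
proof
  fix w assume "w \<in> closed_segment (complex_of_real x) z"
  then obtain t where t: "0 \<le> t" "t \<le> 1" "w = (1 - t) *\<^sub>R complex_of_real x + t *\<^sub>R z"
    by (auto simp: in_segment)
  show "w \<in> slit_plane"
  proof (cases "Im z = 0 \<or> t = 0")
    case True
    have "(1 - t) * x + t * Re z < 1" if "t > 0" "Re z < 1"
    proof -
      have "t * Re z < t * 1" using that by simp
      moreover have "(1 - t) * x \<le> (1 - t) * 1" using t assms by (intro mult_left_mono) auto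
      ultimately show ?thesis by simp
    qed
    thus ?thesis using True t assms unfolding in_slit_plane_iff by (cases "t = 0") auto
  next
    case False
    thus ?thesis using t unfolding in_slit_plane_iff by simp
  qed
qed

lemma connected_slit_plane: "connected slit_plane"
proof (rule starlike_imp_connected)
  have "(0::complex) \<in> slit_plane" by (simp add: in_slit_plane_iff)
  thus "starlike slit_plane"
    unfolding starlike_def using closed_segment_subset_slit_plane[of _ 0] by auto
qed

text \<open>The point 0 is singular for the equation and cannot be the centre in
  \<open>linear_ode_continuation\<close>. The series is therefore continued from 1/4 over the right
  half of the slit plane, while \<open>pfaff\<close> is taken for Re z < 1/2. The two pieces agree
  on the strip 0 < Re z < 1/2 and glue together.\<close>

lemma hyp2F1_reg_exists:
  assumes c: "\<And>n. c + of_nat (Suc n) \<noteq> 0"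
  shows "\<exists>F. F holomorphic_on slit_plane \<and> (\<forall>z\<in>ball 0 1. F z = hyp2F1_reg_series a b c z)"
proof -
  define V where "V = slit_plane \<inter> {z. Re z > 0}"
  define U where "U = ball 0 1 \<inter> {z::complex. Re z > 0}"
  define H where "H = {z::complex. Re z < 1 / 2}"
  \<comment> \<open>The coefficients of the equation solved for the second derivative; their poles 0
    and 1 lie outside \<open>V\<close>.\<close>
  define P where "P = (\<lambda>z. - ((c - (a + b + 1) * z) / (z * (1 - z))))"
  define Q where "Q = (\<lambda>z. a * b / (z * (1 - z)))"
  have V: "open V" unfolding V_def by (intro open_Int open_slit_plane open_halfspace_Re_gt)
  have U: "open U" "convex U"
    unfolding U_def by (auto intro!: open_halfspace_Re_gt convex_Int convex_halfspace_Re_gt)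
  have H: "open H" "convex H" unfolding H_def
    by (rule open_halfspace_Re_lt convex_halfspace_Re_lt)+
  have nz: "z \<noteq> 0" "1 - z \<noteq> 0" if "z \<in> V" for z
    using that in_slit_plane_iff[of z] unfolding V_def by auto
  have ball_slit: "z \<in> slit_plane" if "norm z < 1" for z
    using that complex_Re_le_cmod[of z] unfolding in_slit_plane_iff by auto
  define f' where "f' = (\<lambda>z. a * b * hyp2F1_reg_series (a + 1) (b + 1) (c + 1) z)"
  define f'' where "f'' = (\<lambda>z. a * b * ((a + 1) * (b + 1) * hyp2F1_reg_series (a + 2) (b + 2) (c + 2) z))"
  obtain w where w: "w holomorphic_on V" "\<And>z. z \<in> U \<Longrightarrow> w z = hyp2F1_reg_series a b c z"
  proof (rule linear_ode_continuation[of V "1 / 4" P Q U "hyp2F1_reg_series a b c" f'])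
    show "1 / 4 \<in> V" "1 / 4 \<in> U" unfolding V_def U_def by (auto simp: in_slit_plane_iff)
    fix z assume "z \<in> V"
    have "closed_segment (complex_of_real (1 / 4)) z \<subseteq> slit_plane"
      using \<open>z \<in> V\<close> by (intro closed_segment_subset_slit_plane) (auto simp: V_def)
    moreover have "closed_segment (complex_of_real (1 / 4)) z \<subseteq> {z. Re z > 0}"
      using \<open>z \<in> V\<close> by (intro closed_segment_subset) (auto simp: V_def convex_halfspace_Re_gt)
    ultimately show "closed_segment (1 / 4) z \<subseteq> V" unfolding V_def by simp
  next
    show "P holomorphic_on V" "Q holomorphic_on V"
      unfolding P_def Q_def using nz by (auto intro!: holomorphic_intros)
    show "U \<subseteq> V" unfolding U_def V_def using ball_slit by auto
    fix z assume z: "z \<in> U"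
    hence nz: "norm z < 1" "z \<noteq> 0" "1 - z \<noteq> 0" unfolding U_def by auto
    show "(hyp2F1_reg_series a b c has_field_derivative f' z) (at z)"
      unfolding f'_def by (rule hyp_series_deriv[OF nz(1)])
    have "(f' has_field_derivative f'' z) (at z)"
      unfolding f'_def f''_def using hyp_series_deriv[OF nz(1), of "a + 1" "b + 1" "c + 1"]
      by (intro DERIV_cmult) (simp add: add.assoc)
    also have "f'' z = P z * f' z + Q z * hyp2F1_reg_series a b c z"
    proof -
      have "z * (1 - z) * f'' z + (c - (a + b + 1) * z) * f' z - a * b * hyp2F1_reg_series a b c z = 0"
        using hyp_series_ode[OF nz(1), of a b c] unfolding f''_def f'_def .
      hence "f'' z * (z * (1 - z)) = - (c - (a + b + 1) * z) * f' z + a * b * hyp2F1_reg_series a b c z"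
        by algebra
      hence "f'' z = (- (c - (a + b + 1) * z) * f' z + a * b * hyp2F1_reg_series a b c z) / (z * (1 - z))"
        using nz by (simp add: eq_divide_eq)
      thus ?thesis unfolding P_def Q_def by (simp add: add_divide_distrib diff_divide_distrib algebra_simps)
    qed
    finally show "(f' has_field_derivative P z * f' z + Q z * hyp2F1_reg_series a b c z) (at z)" .
  qed (use V U in auto)
  \<comment> \<open>The overlap is a convex strip, and on its part inside the unit disc both pieces
    equal the series.\<close>
  have wp: "w z = pfaff a b c z" if "z \<in> V \<inter> H" for z
  proof -
    have eq: "V \<inter> H = {z. Re z > 0} \<inter> {z. Re z < 1 / 2}"
      unfolding V_def H_def in_slit_plane_iff[abs_def] by (auto simp: in_slit_plane_iff)
    show ?thesis
    proof (rule analytic_continuation_open[where s = "U \<inter> H" and s' = "V \<inter> H" and f = w and g = "pfaff a b c" and z = z])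
      have "1 / 4 \<in> U \<inter> H" unfolding U_def H_def by auto
      thus "U \<inter> H \<noteq> {}" by blast
      show "connected (V \<inter> H)" unfolding eq
        by (intro convex_connected convex_Int convex_halfspace_Re_gt convex_halfspace_Re_lt)
      show "U \<inter> H \<subseteq> V \<inter> H" unfolding U_def V_def using ball_slit by auto
      show "w holomorphic_on V \<inter> H" by (rule holomorphic_on_subset[OF w(1)]) auto
      show "pfaff a b c holomorphic_on V \<inter> H"
        by (rule holomorphic_on_subset[OF pfaff_holomorphic]) (auto simp: H_def)
      fix z assume "z \<in> U \<inter> H"
      thus "w z = pfaff a b c z"
        using w(2)[of z] hyp_series_eq_pfaff[OF c, of z] by (auto simp: U_def H_def)
    qed (use U V H that in auto)
  qed
  define F where "F = (\<lambda>z. if z \<in> H then pfaff a b c z else w z)"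
  have "F holomorphic_on H"
    using pfaff_holomorphic[of a b c] unfolding H_def[symmetric]
    by (rule holomorphic_transform) (simp add: F_def)
  moreover have "F holomorphic_on V"
    using w(1) by (rule holomorphic_transform) (use wp in \<open>auto simp: F_def\<close>)
  ultimately have "F holomorphic_on H \<union> V"
    using H V by (intro holomorphic_on_Un) auto
  moreover have "H \<union> V = slit_plane"
    unfolding H_def V_def by (auto simp: in_slit_plane_iff)
  moreover have "F z = hyp2F1_reg_series a b c z" if "z \<in> ball 0 1" for z
    using that w(2)[of z] hyp_series_eq_pfaff[OF c, of z] by (auto simp: F_def H_def U_def)
  ultimately show ?thesis by auto
qed

lemma
  assumes c: "\<And>n. c + of_nat (Suc n) \<noteq> 0"
  shows hyp2F1_reg_holomorphic: "hyp2F1_reg a b c holomorphic_on slit_plane"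
    and hyp2F1_reg_eq_series: "norm z < 1 \<Longrightarrow> hyp2F1_reg a b c z = hyp2F1_reg_series a b c z"
  using someI_ex[OF hyp2F1_reg_exists[OF c, of a b]]
  unfolding hyp2F1_reg_def slit_plane_def[symmetric] by auto

text \<open>By the identity theorem on the half-plane. It evaluates the continuation outside the
  unit disc, in particular at 1 - y^2 for y > 1.\<close>

lemma hyp2F1_reg_pfaff:
  assumes c: "\<And>n. c + of_nat (Suc n) \<noteq> 0" and z: "Re z < 1 / 2"
  shows "hyp2F1_reg a b c z = (1 - z) powr (- a) * hyp2F1_reg_series a (c - b) c (z / (z - 1))"
proof -
  have "hyp2F1_reg a b c z = pfaff a b c z"
  proof (rule analytic_continuation_open[where s = "ball 0 (1 / 2)" and s' = "{z. Re z < 1 / 2}"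
      and f = "hyp2F1_reg a b c" and g = "pfaff a b c" and z = z])
    show "open {z::complex. Re z < 1 / 2}" by (rule open_halfspace_Re_lt)
    show "pfaff a b c holomorphic_on {z. Re z < 1 / 2}" by (rule pfaff_holomorphic)
    show "connected {z::complex. Re z < 1 / 2}"
      by (intro convex_connected convex_halfspace_Re_lt)
    have "Re z < 1 / 2" if "norm z < 1 / 2" for z
      using that complex_Re_le_cmod[of z] by simp
    thus "ball 0 (1 / 2) \<subseteq> {z::complex. Re z < 1 / 2}" by auto
    show "hyp2F1_reg a b c holomorphic_on {z. Re z < 1 / 2}"
      by (rule holomorphic_on_subset[OF hyp2F1_reg_holomorphic[OF c]]) (auto simp: in_slit_plane_iff)
    fix z :: complex assume "z \<in> ball 0 (1 / 2)"
    thus "hyp2F1_reg a b c z = pfaff a b c z"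
      using hyp2F1_reg_eq_series[OF c, of z a b] hyp_series_eq_pfaff_near_0[OF c, of z a b] by simp
  qed (use z in auto)
  thus ?thesis unfolding pfaff_def .
qed

lemma hyp2F1_reg_commute: "hyp2F1_reg a b c = hyp2F1_reg b a c"
  unfolding hyp2F1_reg_def hyp2F1_reg_series_def by (simp add: mult_ac)

text \<open>Permanence of the equation: its left-hand side is holomorphic on the connected slit
  plane and vanishes on the disc.\<close>

lemma hyp2F1_reg_ode:
  assumes c: "\<And>n. c + of_nat (Suc n) \<noteq> 0" and z: "z \<in> slit_plane"
  shows "z * (1 - z) * deriv (deriv (hyp2F1_reg a b c)) z
    + (c - (a + b + 1) * z) * deriv (hyp2F1_reg a b c) z - a * b * hyp2F1_reg a b c z = 0"
proof -
  define F where "F = hyp2F1_reg a b c"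
  define f' where "f' = (\<lambda>z. a * b * hyp2F1_reg_series (a + 1) (b + 1) (c + 1) z)"
  define f'' where "f'' = (\<lambda>z. a * b * ((a + 1) * (b + 1) * hyp2F1_reg_series (a + 2) (b + 2) (c + 2) z))"
  have hol: "F holomorphic_on slit_plane" unfolding F_def by (rule hyp2F1_reg_holomorphic[OF c])
  have ev: "eventually (\<lambda>z. z \<in> ball 0 1) (nhds z)" if "norm z < 1" for z :: complex
    using that by (intro eventually_nhds_in_open) auto
  have d1: "deriv F z = f' z" if "norm z < 1" for z
  proof -
    have "deriv F z = deriv (hyp2F1_reg_series a b c) z"
      using ev[OF that] by (intro deriv_cong_ev) (auto elim!: eventually_mono simp: F_def hyp2F1_reg_eq_series[OF c])
    also have "\<dots> = f' z" unfolding f'_def by (intro DERIV_imp_deriv hyp_series_deriv that)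
    finally show ?thesis .
  qed
  have d2: "deriv (deriv F) z = f'' z" if "norm z < 1" for z
  proof -
    have "deriv (deriv F) z = deriv f' z"
      using ev[OF that] by (intro deriv_cong_ev) (auto elim!: eventually_mono simp: d1)
    also have "\<dots> = f'' z"
      unfolding f'_def f''_def using hyp_series_deriv[OF that, of "a + 1" "b + 1" "c + 1"]
      by (intro DERIV_imp_deriv DERIV_cmult) (simp add: add.assoc)
    finally show ?thesis .
  qed
  define G where "G = (\<lambda>z. z * (1 - z) * deriv (deriv F) z + (c - (a + b + 1) * z) * deriv F z - a * b * F z)"
  have "G z = (\<lambda>_. 0) z"
  proof (rule analytic_continuation_open[where s = "ball 0 1" and s' = slit_plane and f = G and g = "\<lambda>_. 0" and z = z])
    show "ball 0 1 \<subseteq> slit_plane"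
    proof
      fix z :: complex assume "z \<in> ball 0 1"
      thus "z \<in> slit_plane"
        using complex_Re_le_cmod[of z] by (simp add: in_slit_plane_iff)
    qed
    show "G holomorphic_on slit_plane"
      unfolding G_def by (intro holomorphic_intros holomorphic_deriv hol open_slit_plane)
    fix z :: complex assume "z \<in> ball 0 1"
    thus "G z = 0"
      using d1[of z] d2[of z] hyp2F1_reg_eq_series[OF c, of z a b] hyp_series_ode[of z a b c]
      by (simp add: G_def F_def f'_def f''_def)
  qed (use open_slit_plane connected_slit_plane z in auto)
  thus ?thesis unfolding F_def G_def by simp
qed

subsection \<open>Quadratic substitutions\<close>

lemma in_cut_plane_iff: "z \<in> cut_plane \<longleftrightarrow> Im z \<noteq> 0 \<or> Re z > 1"
proof -
  have "z \<in> complex_of_real ` {..1} \<longleftrightarrow> Im z = 0 \<and> Re z \<le> 1"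
    by (auto simp: image_iff complex_eq_iff intro!: bexI[of _ "Re z"])
  thus ?thesis unfolding cut_plane_def Compl_iff by (metis not_le)
qed

lemma open_cut_plane: "open cut_plane"
proof -
  have "cut_plane = {z. Re z > 1} \<union> ({z. Im z < 0} \<union> {z. Im z > 0})"
    by (auto simp: in_cut_plane_iff)
  moreover have "open \<dots>"
    by (intro open_Un open_halfspace_Re_gt open_halfspace_Im_lt open_halfspace_Im_gt)
  ultimately show ?thesis by simp
qed

lemma closed_segment_subset_cut_plane:
  assumes "z \<in> cut_plane"
  shows "closed_segment 2 z \<subseteq> cut_plane"
proof
  fix w assume "w \<in> closed_segment 2 z"
  then obtain t where t: "0 \<le> t" "t \<le> 1" "w = (1 - t) *\<^sub>R 2 + t *\<^sub>R z"
    by (auto simp: in_segment)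
  show "w \<in> cut_plane"
  proof (cases "Im z = 0 \<or> t = 0")
    case True
    have "(1 - t) * 2 + t * Re z > 1" if "Re z > 1"
    proof (cases "t = 0")
      case False
      hence "t * Re z > t * 1" using that t by simp
      thus ?thesis using t by argo
    qed auto
    thus ?thesis using True t assms by (cases "t = 0") (auto simp: in_cut_plane_iff)
  next
    case False
    thus ?thesis using t by (simp add: in_cut_plane_iff)
  qed
qed

text \<open>Composition with 1 - y^2 does not suffice: for imaginary nonzero y this value lies on
  the branch cut although y lies in \<open>cut_plane\<close>. The equation pulled back to y is
  singular only at 0, 1 and -1, outside \<open>cut_plane\<close>, which is starlike about 2; so the
  composition is continued from the half-plane Re y > 1.\<close>

lemma hyp2F1_reg_square_continuation:
  assumes c: "\<And>n. c + of_nat (Suc n) \<noteq> 0"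
  obtains \<Psi> where "\<Psi> holomorphic_on cut_plane"
    "\<And>y. y > 1 \<Longrightarrow> \<Psi> (of_real y) = hyp2F1_reg a b c (of_real (1 - y\<^sup>2))"
proof -
  define F where "F = hyp2F1_reg a b c"
  \<comment> \<open>By the chain rule the second derivative in y is 4 y^2 F'' - 2 F', taken at 1 -
    y^2; F'' is then eliminated by the hypergeometric equation.\<close>
  define P where "P = (\<lambda>y. 1 / y + 2 * (c - (a + b + 1) * (1 - y\<^sup>2)) / (y * (1 - y\<^sup>2)))"
  define Q where "Q = (\<lambda>y::complex. 4 * a * b / (1 - y\<^sup>2))"
  define U where "U = {z::complex. Re z > 1}"
  have hol: "F holomorphic_on slit_plane" unfolding F_def by (rule hyp2F1_reg_holomorphic[OF c])
  have hol': "deriv F holomorphic_on slit_plane" by (intro holomorphic_deriv hol open_slit_plane)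
  have dF: "(F has_field_derivative deriv F z) (at z)"
    and dF': "(deriv F has_field_derivative deriv (deriv F) z) (at z)" if "z \<in> slit_plane" for z
    using that hol hol' open_slit_plane holomorphic_derivI by blast+
  have slit: "1 - y\<^sup>2 \<in> slit_plane" if "Re y > 1" for y
  proof (cases "Im y = 0")
    case True
    thus ?thesis using that by (simp add: in_slit_plane_iff power2_eq_square)
  next
    case False
    thus ?thesis using that by (simp add: in_slit_plane_iff power2_eq_square)
  qed
  have nz: "y \<noteq> 0" "1 - y\<^sup>2 \<noteq> 0" if "y \<in> cut_plane" for y
  proof -
    show "y \<noteq> 0" using that by (auto simp: in_cut_plane_iff)
    have "y \<noteq> 1" "y \<noteq> -1" using that by (auto simp: in_cut_plane_iff)
    thus "1 - y\<^sup>2 \<noteq> 0" by (simp add: power2_eq_1_iff)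
  qed
  obtain w where w: "w holomorphic_on cut_plane" "\<And>y. y \<in> U \<Longrightarrow> w y = F (1 - y\<^sup>2)"
  proof (rule linear_ode_continuation[of cut_plane 2 P Q U "\<lambda>y. F (1 - y\<^sup>2)" "\<lambda>y. deriv F (1 - y\<^sup>2) * (- (2 * y))"])
    show "P holomorphic_on cut_plane" "Q holomorphic_on cut_plane"
      unfolding P_def Q_def using nz by (auto intro!: holomorphic_intros)
    show "U \<subseteq> cut_plane" unfolding U_def by (auto simp: in_cut_plane_iff)
    show "open U" "convex U" unfolding U_def by (rule open_halfspace_Re_gt convex_halfspace_Re_gt)+
    show "2 \<in> U" "2 \<in> cut_plane" by (auto simp: U_def in_cut_plane_iff)
    fix y assume y: "y \<in> U"
    hence y': "y \<in> cut_plane" unfolding U_def by (auto simp: in_cut_plane_iff)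
    have s: "1 - y\<^sup>2 \<in> slit_plane" using y unfolding U_def by (intro slit) auto
    have dq: "((\<lambda>y. 1 - y\<^sup>2) has_field_derivative - (2 * y)) (at y)"
      by (auto intro!: derivative_eq_intros)
    show "((\<lambda>y. F (1 - y\<^sup>2)) has_field_derivative deriv F (1 - y\<^sup>2) * (- (2 * y))) (at y)"
      by (rule DERIV_chain2[OF dF[OF s] dq])
    have dl: "((\<lambda>y. - (2 * y)) has_field_derivative - 2) (at y)"
      by (auto intro!: derivative_eq_intros)
    have "((\<lambda>y. deriv F (1 - y\<^sup>2) * (- (2 * y))) has_field_derivative
        deriv (deriv F) (1 - y\<^sup>2) * (- (2 * y)) * (- (2 * y)) + (- 2) * deriv F (1 - y\<^sup>2)) (at y)"
      by (rule DERIV_mult[OF DERIV_chain2[OF dF'[OF s] dq] dl])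
    also have "deriv (deriv F) (1 - y\<^sup>2) * (- (2 * y)) * (- (2 * y)) + (- 2) * deriv F (1 - y\<^sup>2) =
       P y * (deriv F (1 - y\<^sup>2) * (- (2 * y))) + Q y * F (1 - y\<^sup>2)"
    proof -
      define E0 E1 E2 where "E0 = F (1 - y\<^sup>2)" and "E1 = deriv F (1 - y\<^sup>2)" and "E2 = deriv (deriv F) (1 - y\<^sup>2)"
      have "(1 - y\<^sup>2) * (1 - (1 - y\<^sup>2)) * E2 + (c - (a + b + 1) * (1 - y\<^sup>2)) * E1 - a * b * E0 = 0"
        using hyp2F1_reg_ode[OF c s, of a b] unfolding F_def E0_def E1_def E2_def .
      hence "(E2 * (- (2 * y)) * (- (2 * y)) + (- 2) * E1) * (1 - y\<^sup>2) =
         (- 2 * (1 - y\<^sup>2) - 4 * (c - (a + b + 1) * (1 - y\<^sup>2))) * E1 + 4 * a * b * E0"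
        by algebra
      also have "\<dots> = (P y * (E1 * (- (2 * y))) + Q y * E0) * (1 - y\<^sup>2)"
      proof -
        have "P y * (- (2 * y)) * (1 - y\<^sup>2) = - 2 * (1 - y\<^sup>2) - 4 * (c - (a + b + 1) * (1 - y\<^sup>2))"
          unfolding P_def using nz[OF y'] by (simp add: field_simps)
        moreover have "Q y * (1 - y\<^sup>2) = 4 * a * b"
          unfolding Q_def using nz[OF y'] by simp
        ultimately show ?thesis by algebra
      qed
      finally show ?thesis unfolding E0_def[symmetric] E1_def[symmetric] E2_def[symmetric]
        using nz[OF y'] mult_right_cancel by blast
    qed
    finally show "((\<lambda>y. deriv F (1 - y\<^sup>2) * (- (2 * y))) has_field_derivative
       P y * (deriv F (1 - y\<^sup>2) * (- (2 * y))) + Q y * F (1 - y\<^sup>2)) (at y)" .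
  qed (use open_cut_plane closed_segment_subset_cut_plane in auto)
  show ?thesis
  proof (rule that[of w])
    fix y :: real assume "y > 1"
    thus "w (of_real y) = hyp2F1_reg a b c (of_real (1 - y\<^sup>2))"
      using w(2)[of "of_real y"] by (simp add: U_def F_def)
  qed (rule w(1))
qed

lemma Re_inverse_pos:
  assumes "Re x > 0"
  shows "Re (inverse x) > 0"
  using assms by (simp add: add_pos_nonneg)

lemma csqrt_one_minus:
  assumes "norm w < 1"
  shows "Re (csqrt (1 - w)) > 0" "csqrt (1 - w) ^ 2 = 1 - w"
    "((\<lambda>w. csqrt (1 - w)) has_field_derivative - (1 / (2 * csqrt (1 - w)))) (at w)"
proof -
  have "Re w < 1" using assms complex_Re_le_cmod[of w] by simp
  hence 1: "1 - w \<notin> \<real>\<^sub>\<le>\<^sub>0" by (rule one_minus_notin_nonpos_Reals)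
  have "Re (1 - w) > 0" using \<open>Re w < 1\<close> by simp
  hence "(cmod (1 - w) + Re (1 - w)) / 2 > 0"
    by (intro divide_pos_pos add_nonneg_pos norm_ge_zero) auto
  thus "Re (csqrt (1 - w)) > 0"
    unfolding csqrt.sel by (rule real_sqrt_gt_zero)
  show "csqrt (1 - w) ^ 2 = 1 - w" by simp
  have "(csqrt has_field_derivative inverse (2 * csqrt (1 - w))) (at (1 - w))"
    using 1 by (rule has_field_derivative_csqrt)
  moreover have "((\<lambda>w. 1 - w) has_field_derivative - 1) (at w)"
    by (auto intro!: derivative_eq_intros)
  ultimately have "((\<lambda>w. csqrt (1 - w)) has_field_derivative inverse (2 * csqrt (1 - w)) * (- 1)) (at w)"
    by (rule DERIV_chain2)
  thus "((\<lambda>w. csqrt (1 - w)) has_field_derivative - (1 / (2 * csqrt (1 - w)))) (at w)"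
    by (simp only: inverse_eq_divide mult_minus_right mult_1_right)
qed

text \<open>A quadratic transformation, verified through the differential equation. At w = 1 - r it
  evaluates the Gegenbauer function at 1 / sqrt r. The lower parameter has to be nonzero here
  because the derivative at 0 is read off from the equation at w = 0.\<close>

lemma hyp2F1_reg_quadratic:
  assumes c: "\<And>n. A + B + 1 / 2 + of_nat n \<noteq> 0" and w: "norm w < 1"
  shows "(1 - w) powr (- A) * hyp2F1_reg (2 * A) (2 * B) (A + B + 1 / 2) ((1 - inverse (csqrt (1 - w))) / 2) =
    hyp2F1_reg_series A (A + 1 / 2) (A + B + 1 / 2) w"
proof -
  define c where "c = A + B + 1 / 2"
  have c': "c + of_nat (Suc n) \<noteq> 0" for n using assms(1)[of "Suc n"] by (simp add: c_def)
  have c0: "c \<noteq> 0" using assms(1)[of 0] by (simp add: c_def)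
  define F where "F = hyp2F1_reg (2 * A) (2 * B) c"
  define F1 where "F1 = deriv F"
  define F2 where "F2 = deriv F1"
  have hol: "F holomorphic_on slit_plane" unfolding F_def by (rule hyp2F1_reg_holomorphic[OF c'])
  have hol': "deriv F holomorphic_on slit_plane" by (intro holomorphic_deriv hol open_slit_plane)
  have dF: "(F has_field_derivative F1 z) (at z)"
    and dF': "(F1 has_field_derivative F2 z) (at z)" if "z \<in> slit_plane" for z
    unfolding F1_def F2_def
    using that hol hol' open_slit_plane holomorphic_derivI by blast+
  \<comment> \<open>With q^2 = T, T' = T^2 and q' = q T / 2 all derivatives stay polynomial in
    \<open>q\<close> and \<open>T\<close>.\<close>
  define q where "q = (\<lambda>w. inverse (csqrt (1 - w)))"
  define \<zeta> where "\<zeta> = (\<lambda>w. (1 - q w) / 2)"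
  define T where "T = (\<lambda>w::complex. 1 / (1 - w))"
  define m where "m = (\<lambda>w::complex. (1 - w) powr (- A))"
  define f where "f = (\<lambda>w. m w * F (\<zeta> w))"
  define f' where "f' = (\<lambda>w. m w * (A * (T w * F (\<zeta> w)) - 1 / 4 * (q w * T w * F1 (\<zeta> w))))"
  define f'' where "f'' = (\<lambda>w. m w * ((A + A^2) * T w ^ 2 * F (\<zeta> w) - (A / 2 + 3 / 8) * q w * T w ^ 2 * F1 (\<zeta> w)
     + 1 / 16 * T w ^ 3 * F2 (\<zeta> w)))"
  have lt1: "Re w < 1" if "norm w < 1" for w using that complex_Re_le_cmod[of w] by simp
  have q2: "q w ^ 2 = T w" if "norm w < 1" for w
    unfolding q_def T_def by (simp add: power_inverse divide_inverse)
  have wT: "(1 - w) * T w = 1" if "norm w < 1" for w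
    unfolding T_def using lt1[OF that] by auto
  \<comment> \<open>The principal root has positive real part, hence so has its inverse, and the
    argument stays to the left of the cut.\<close>
  have \<zeta>s: "\<zeta> w \<in> slit_plane" if "norm w < 1" for w
  proof -
    have "Re (q w) > 0" unfolding q_def
      by (intro Re_inverse_pos csqrt_one_minus(1) that)
    hence "Re (\<zeta> w) < 1" unfolding \<zeta>_def by simp
    thus ?thesis by (simp add: in_slit_plane_iff)
  qed
  have dT: "(T has_field_derivative T w ^ 2) (at w)" if "norm w < 1" for w
  proof -
    have "w \<noteq> 1" using that by auto
    thus ?thesis
      unfolding T_def by (auto intro!: derivative_eq_intros simp: power2_eq_square)
  qed
  have dm: "(m has_field_derivative A * (m w * T w)) (at w)" if "norm w < 1" for w
    unfolding m_def T_def using has_field_derivative_powr_one_minus[of w "-A"] lt1[OF that]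
    by (simp add: one_minus_notin_nonpos_Reals)
  have dq: "(q has_field_derivative 1 / 2 * (q w * T w)) (at w)" if "norm w < 1" for w
  proof -
    have nz: "csqrt (1 - w) \<noteq> 0" using csqrt_one_minus(1)[OF that] by auto
    have "(q has_field_derivative - (inverse (csqrt (1 - w)) * (- (1 / (2 * csqrt (1 - w)))) * inverse (csqrt (1 - w)))) (at w)"
      unfolding q_def by (rule DERIV_inverse'[OF csqrt_one_minus(3)[OF that] nz])
    also have "- (inverse (csqrt (1 - w)) * (- (1 / (2 * csqrt (1 - w)))) * inverse (csqrt (1 - w))) = 1 / 2 * (q w * q w ^ 2)"
      unfolding q_def using nz by (simp add: field_simps power2_eq_square)
    finally show ?thesis unfolding q2[OF that] .
  qed
  have d\<zeta>: "(\<zeta> has_field_derivative - (1 / 4 * (q w * T w))) (at w)" if "norm w < 1" for w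
    unfolding \<zeta>_def using dq[OF that] by (auto intro!: derivative_eq_intros)
  have dF\<zeta>: "((\<lambda>w. F (\<zeta> w)) has_field_derivative F1 (\<zeta> w) * (- (1 / 4 * (q w * T w)))) (at w)" if "norm w < 1" for w
    by (rule DERIV_chain2[OF dF[OF \<zeta>s[OF that]] d\<zeta>[OF that]])
  have dF1\<zeta>: "((\<lambda>w. F1 (\<zeta> w)) has_field_derivative F2 (\<zeta> w) * (- (1 / 4 * (q w * T w)))) (at w)" if "norm w < 1" for w
    by (rule DERIV_chain2[OF dF'[OF \<zeta>s[OF that]] d\<zeta>[OF that]])
  have df: "(f has_field_derivative f' w) (at w)" if "norm w < 1" for w
  proof -
    have "(f has_field_derivative A * (m w * T w) * F (\<zeta> w) + F1 (\<zeta> w) * (- (1 / 4 * (q w * T w))) * m w) (at w)"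
      unfolding f_def by (rule DERIV_mult[OF dm[OF that] dF\<zeta>[OF that]])
    also have "A * (m w * T w) * F (\<zeta> w) + F1 (\<zeta> w) * (- (1 / 4 * (q w * T w))) * m w = f' w"
      unfolding f'_def by (simp add: algebra_simps)
    finally show ?thesis .
  qed
  have df': "(f' has_field_derivative f'' w) (at w)" if w: "norm w < 1" for w
  proof -
    have "(f' has_field_derivative A * (m w * T w) * (A * (T w * F (\<zeta> w)) - 1 / 4 * (q w * T w * F1 (\<zeta> w)))
        + (A * (T w ^ 2 * F (\<zeta> w) + F1 (\<zeta> w) * (- (1 / 4 * (q w * T w))) * T w)
         - 1 / 4 * ((1 / 2 * (q w * T w) * T w + T w ^ 2 * q w) * F1 (\<zeta> w)
            + F2 (\<zeta> w) * (- (1 / 4 * (q w * T w))) * (q w * T w))) * m w) (at w)"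
      unfolding f'_def
      by (intro DERIV_mult DERIV_diff DERIV_cmult dm[OF w] dF\<zeta>[OF w] dF1\<zeta>[OF w] dT[OF w] dq[OF w])
    also have "A * (m w * T w) * (A * (T w * F (\<zeta> w)) - 1 / 4 * (q w * T w * F1 (\<zeta> w)))
        + (A * (T w ^ 2 * F (\<zeta> w) + F1 (\<zeta> w) * (- (1 / 4 * (q w * T w))) * T w)
         - 1 / 4 * ((1 / 2 * (q w * T w) * T w + T w ^ 2 * q w) * F1 (\<zeta> w)
            + F2 (\<zeta> w) * (- (1 / 4 * (q w * T w))) * (q w * T w))) * m w = f'' w"
    proof -
      have "T w ^ 3 = q w * q w * (T w * T w)"
        using q2[OF w] by (simp add: power3_eq_cube power2_eq_square)
      thus ?thesis unfolding f''_def by (simp add: field_simps power2_eq_square)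
    qed
    finally show ?thesis .
  qed
  have fode: "w * (1 - w) * f'' w + (c - (A + (A + 1 / 2) + 1) * w) * f' w - A * (A + 1 / 2) * f w = 0"
    if w: "norm w < 1" for w
  proof -
    define E0 E1 E2 where "E0 = F (\<zeta> w)" and "E1 = F1 (\<zeta> w)" and "E2 = F2 (\<zeta> w)"
    have "\<zeta> w * (1 - \<zeta> w) * E2 + (c - (2 * A + 2 * B + 1) * \<zeta> w) * E1 - (2 * A) * (2 * B) * E0 = 0"
      using hyp2F1_reg_ode[OF c' \<zeta>s[OF w], of "2 * A" "2 * B"]
      unfolding F_def E0_def E1_def E2_def F1_def F2_def .
    moreover have "q w = 1 - 2 * \<zeta> w" unfolding \<zeta>_def by (simp add: field_simps)
    \<comment> \<open>Here \<zeta> (1 - \<zeta>) = (1 - T) / 4, and the coefficient of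
      \<open>E1\<close> is c (1 - 2 \<zeta>) = c q because 2 c = 2 A + 2 B + 1.\<close>
    ultimately have ode: "(1 - T w) / 4 * E2 + c * q w * E1 - 4 * A * B * E0 = 0"
      using q2[OF w] unfolding c_def by algebra
    have "w * (1 - w) * f'' w + (c - (A + (A + 1 / 2) + 1) * w) * f' w - A * (A + 1 / 2) * f w =
       - m w * T w / 4 * ((1 - T w) / 4 * E2 + c * q w * E1 - 4 * A * B * E0)"
      unfolding f''_def f'_def f_def E0_def[symmetric] E1_def[symmetric] E2_def[symmetric] c_def
      using wT[OF w] by algebra
    thus ?thesis unfolding ode by simp
  qed
  have "(\<lambda>n. hyp_coeff A (A + 1 / 2) c n * w ^ n) sums f w"
  proof (rule hypergeometric_ode_sums[where r = 1 and f' = f' and f'' = f'' and a = A and b = "A + 1 / 2" and c = c])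
    have f0: "f 0 = rGamma c"
      using hyp2F1_reg_eq_series[OF c', of 0 "2 * A" "2 * B"] by (simp add: f_def m_def \<zeta>_def q_def F_def)
    thus "hyp_coeff A (A + 1 / 2) c 0 = f 0" by simp
    have "c * f' 0 = A * (A + 1 / 2) * f 0" using fode[of 0] by simp
    also have "\<dots> = c * (A * (A + 1 / 2) * rGamma (c + 1))"
      unfolding f0 rGamma_plus1[of c, symmetric] by (simp only: mult_ac)
    finally show "hyp_coeff A (A + 1 / 2) c (Suc 0) = f' 0" using c0 by (simp add: hyp_coeff_1)
    show "w \<in> ball 0 1" using assms by simp
  qed (use df df' fode c' hyp_coeff_Suc in auto)
  moreover have "(\<lambda>n. hyp_coeff A (A + 1 / 2) c n * w ^ n) sums hyp2F1_reg_series A (A + 1 / 2) c w"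
    using assms by (intro hyp_series_sums) auto
  ultimately have "f w = hyp2F1_reg_series A (A + 1 / 2) c w" by (rule sums_unique2)
  thus ?thesis unfolding f_def m_def F_def \<zeta>_def q_def c_def .
qed

section \<open>Powers of 1 + sqrt (1 - z)\<close>

text \<open>The Taylor coefficients of (1 + sqrt (1 - z))^(-s) / sqrt (1 - z), which is 2^(-s) times
  the unregularized F((s+1)/2, (s+2)/2; s+1; z). The quotient (s+1)_(2n) / (s+1)_n is written as one
  shifted symbol, so that no division occurs and a reciprocal Gamma value can absorb it
  later.\<close>

definition sqrt_power_coeff :: "complex \<Rightarrow> nat \<Rightarrow> complex" where
  "sqrt_power_coeff s n = 2 powr (- s) * (pochhammer (s + 1 + of_nat n) n / (fact n * 4 ^ n))"

lemma sqrt_power_coeff_Suc: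
  "of_nat (Suc n) * (s + 1 + of_nat n) * sqrt_power_coeff s (Suc n) =
   ((s + 1) / 2 + of_nat n) * ((s + 2) / 2 + of_nat n) * sqrt_power_coeff s n"
proof -
  define d where "d = s + 1 + of_nat n"
  have "d * pochhammer (d + 1) (Suc n) = pochhammer d (Suc (Suc n))"
    by (rule pochhammer_rec[symmetric])
  also have "\<dots> = pochhammer d n * (d + of_nat n) * (d + of_nat n + 1)"
    by (simp add: pochhammer_Suc add_ac)
  finally have p: "d * pochhammer (s + 1 + of_nat (Suc n)) (Suc n) = pochhammer d n * (d + of_nat n) * (d + of_nat n + 1)"
    by (simp add: d_def add_ac)
  have "of_nat (Suc n) * d * sqrt_power_coeff s (Suc n) =
    2 powr (- s) * (d * pochhammer (s + 1 + of_nat (Suc n)) (Suc n)) * (of_nat (Suc n) / fact (Suc n)) / 4 ^ Suc n"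
    unfolding sqrt_power_coeff_def by simp
  also have "of_nat (Suc n) / fact (Suc n) = (1 / fact n :: complex)"
    by (simp add: divide_simps del: of_nat_Suc)
  also note p
  also have "2 powr (- s) * (pochhammer d n * (d + of_nat n) * (d + of_nat n + 1)) * (1 / fact n) / 4 ^ Suc n =
     ((d + of_nat n) * (d + of_nat n + 1) / 4) * sqrt_power_coeff s n"
    unfolding sqrt_power_coeff_def d_def[symmetric] by (simp add: mult_ac)
  also have "(d + of_nat n) * (d + of_nat n + 1) / 4 = ((s + 1) / 2 + of_nat n) * ((s + 2) / 2 + of_nat n)"
    unfolding d_def by (simp add: field_simps)
  finally show ?thesis unfolding d_def .
qed

lemma sqrt_power_sums:
  assumes s: "\<And>n. s + 1 + of_nat (Suc n) \<noteq> 0" and z: "norm z < 1"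
  shows "(\<lambda>n. sqrt_power_coeff s n * z ^ n) sums ((1 + csqrt (1 - z)) powr (- s) / csqrt (1 - z))"
proof -
  define R where "R = (\<lambda>z. csqrt (1 - z))"
  \<comment> \<open>The derivatives are R' = -V / 2, V' = V^3 / 2 and Q' = Q^2 V / 2, so everything
    stays polynomial in \<open>V\<close> and \<open>Q\<close> up to the factor
    \<open>m\<close>.\<close>
  define V where "V = (\<lambda>z. inverse (R z))"
  define Q where "Q = (\<lambda>z. inverse (1 + R z))"
  define m where "m = (\<lambda>z. (1 + R z) powr (- s))"
  define f where "f = (\<lambda>z. m z * V z)"
  define f' where "f' = (\<lambda>z. 1 / 2 * (m z * (s * (Q z * V z ^ 2) + V z ^ 3)))"
  define f'' where "f'' = (\<lambda>z. 1 / 2 * (m z * (1 / 2 * s * Q z * V z * (s * (Q z * V z ^ 2) + V z ^ 3)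
     + 1 / 2 * s * Q z ^ 2 * V z ^ 3 + s * Q z * V z ^ 4 + 3 / 2 * V z ^ 5)))"
  have R: "Re (R z) > 0" "R z ^ 2 = 1 - z" "R z \<noteq> 0" "1 + R z \<noteq> 0"
    "R z * V z = 1" "(1 + R z) * Q z = 1" if "norm z < 1" for z
  proof -
    show 1: "Re (R z) > 0" "R z ^ 2 = 1 - z" using csqrt_one_minus[OF that] by (simp_all add: R_def)
    show 2: "R z \<noteq> 0" using 1 by auto
    have "Re (1 + R z) \<noteq> 0" using 1 by simp
    thus 3: "1 + R z \<noteq> 0" by (metis zero_complex.sel(1))
    show "R z * V z = 1" "(1 + R z) * Q z = 1" using 2 3 by (simp_all add: V_def Q_def)
  qed
  have dR: "(R has_field_derivative - (1 / 2 * V z)) (at z)" if "norm z < 1" for z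
  proof -
    have "1 / (2 * csqrt (1 - z)) = 1 / 2 * V z" unfolding V_def R_def by (simp add: inverse_eq_divide)
    thus ?thesis using csqrt_one_minus(3)[OF that] unfolding R_def by (simp only:)
  qed
  have dV: "(V has_field_derivative 1 / 2 * V z ^ 3) (at z)" if "norm z < 1" for z
  proof -
    have "(V has_field_derivative - (inverse (R z) * (- (1 / 2 * V z)) * inverse (R z))) (at z)"
      unfolding V_def[abs_def] by (rule DERIV_inverse'[OF dR[OF that, unfolded V_def] R(3)[OF that]])
    also have "- (inverse (R z) * (- (1 / 2 * V z)) * inverse (R z)) = 1 / 2 * V z ^ 3"
      unfolding V_def by (simp add: power3_eq_cube)
    finally show ?thesis .
  qed
  have dQ: "(Q has_field_derivative 1 / 2 * (Q z ^ 2 * V z)) (at z)" if "norm z < 1" for z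
  proof -
    have d1: "((\<lambda>z. 1 + R z) has_field_derivative 0 + - (1 / 2 * V z)) (at z)"
      by (intro DERIV_add DERIV_const dR[OF that])
    have "(Q has_field_derivative - (inverse (1 + R z) * (0 + - (1 / 2 * V z)) * inverse (1 + R z))) (at z)"
      unfolding Q_def by (rule DERIV_inverse'[OF d1 R(4)[OF that]])
    also have "- (inverse (1 + R z) * (0 + - (1 / 2 * V z)) * inverse (1 + R z)) = 1 / 2 * (Q z ^ 2 * V z)"
      unfolding Q_def by (simp add: power2_eq_square)
    finally show ?thesis .
  qed
  have dm: "(m has_field_derivative 1 / 2 * s * (m z * Q z * V z)) (at z)" if "norm z < 1" for z
  proof -
    have np: "1 + R z \<notin> \<real>\<^sub>\<le>\<^sub>0" using R(1)[OF that] by (auto simp: complex_nonpos_Reals_iff)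
    have d1: "((\<lambda>z. 1 + R z) has_field_derivative 0 + - (1 / 2 * V z)) (at z)"
      by (intro DERIV_add DERIV_const dR[OF that])
    have "((\<lambda>u. u powr (- s)) has_field_derivative - s * (1 + R z) powr (- s - 1)) (at (1 + R z))"
      using np by (rule has_field_derivative_powr)
    from DERIV_chain2[OF this d1]
    have "(m has_field_derivative - s * (1 + R z) powr (- s - 1) * (0 + - (1 / 2 * V z))) (at z)"
      unfolding m_def .
    also have "(1 + R z) powr (- s - 1) = m z * Q z"
      unfolding m_def Q_def using R(4)[OF that] by (simp add: powr_diff inverse_eq_divide)
    also have "- s * (m z * Q z) * (0 + - (1 / 2 * V z)) = 1 / 2 * s * (m z * Q z * V z)" by simp
    finally show ?thesis .
  qed
  have df: "(f has_field_derivative f' z) (at z)" if "norm z < 1" for z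
  proof -
    have "(f has_field_derivative 1 / 2 * s * (m z * Q z * V z) * V z + 1 / 2 * V z ^ 3 * m z) (at z)"
      unfolding f_def by (rule DERIV_mult[OF dm[OF that] dV[OF that]])
    also have "1 / 2 * s * (m z * Q z * V z) * V z + 1 / 2 * V z ^ 3 * m z = f' z"
      unfolding f'_def by algebra
    finally show ?thesis .
  qed
  have dV2: "((\<lambda>z. V z ^ 2) has_field_derivative V z ^ 4) (at z)" if "norm z < 1" for z
  proof -
    have "((\<lambda>z. V z ^ 2) has_field_derivative of_nat 2 * (1 / 2 * V z ^ 3 * V z ^ (2 - Suc 0))) (at z)"
      by (rule DERIV_power[OF dV[OF that]])
    also have "of_nat 2 * (1 / 2 * V z ^ 3 * V z ^ (2 - Suc 0)) = V z ^ 4"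
      by (simp add: power3_eq_cube power4_eq_xxxx)
    finally show ?thesis .
  qed
  have dV3: "((\<lambda>z. V z ^ 3) has_field_derivative 3 / 2 * V z ^ 5) (at z)" if "norm z < 1" for z
  proof -
    have "((\<lambda>z. V z ^ 3) has_field_derivative of_nat 3 * (1 / 2 * V z ^ 3 * V z ^ (3 - Suc 0))) (at z)"
      by (rule DERIV_power[OF dV[OF that]])
    also have "of_nat 3 * (1 / 2 * V z ^ 3 * V z ^ (3 - Suc 0)) = 3 / 2 * V z ^ 5"
      by (simp add: power_add[of _ 3 2, simplified])
    finally show ?thesis .
  qed
  have df': "(f' has_field_derivative f'' z) (at z)" if z: "norm z < 1" for z
  proof -
    have "(f' has_field_derivative 1 / 2 * (1 / 2 * s * (m z * Q z * V z) * (s * (Q z * V z ^ 2) + V z ^ 3)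
        + (s * (1 / 2 * (Q z ^ 2 * V z) * V z ^ 2 + V z ^ 4 * Q z) + 3 / 2 * V z ^ 5) * m z)) (at z)"
      unfolding f'_def
      by (intro DERIV_mult DERIV_add DERIV_cmult dm[OF z] dQ[OF z] dV2[OF z] dV3[OF z])
    also have "1 / 2 * (1 / 2 * s * (m z * Q z * V z) * (s * (Q z * V z ^ 2) + V z ^ 3)
        + (s * (1 / 2 * (Q z ^ 2 * V z) * V z ^ 2 + V z ^ 4 * Q z) + 3 / 2 * V z ^ 5) * m z) = f'' z"
      unfolding f''_def by algebra
    finally show ?thesis .
  qed
  have fode: "z * (1 - z) * f'' z + (s + 1 - ((s + 1) / 2 + (s + 2) / 2 + 1) * z) * f' z - (s + 1) / 2 * ((s + 2) / 2) * f z = 0"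
    if z: "norm z < 1" for z
  proof -
    define r where "r = R z"
    define M where "M = m z"
    have nz: "r \<noteq> 0" "1 + r \<noteq> 0" using R(3,4)[OF z] by (simp_all add: r_def)
    have nz2: "k + r * k \<noteq> 0" if "k \<noteq> 0" for k
      using that nz by (metis distrib_right mult_1 mult_eq_0_iff)
    have v: "V z = 1 / r" and q: "Q z = 1 / (1 + r)"
      by (simp_all add: V_def Q_def r_def inverse_eq_divide)
    \<comment> \<open>Replacing z by the root makes the equation a rational identity in
      \<open>r\<close>.\<close>
    have zr: "z = 1 - r * r" using R(2)[OF z] by (simp add: r_def power2_eq_square)
    show ?thesis
      unfolding f''_def f'_def f_def v q M_def[symmetric] unfolding zr using nz nz2[of 2] nz2[of 4] nz2[of 8] nz2[of 16]
      by (simp add: divide_simps power2_eq_square power3_eq_cube power4_eq_xxxx numeral_eq_Suc)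
        (simp add: algebra_simps)
  qed
  have "(\<lambda>n. sqrt_power_coeff s n * z ^ n) sums f z"
  proof (rule hypergeometric_ode_sums[where r = 1 and f' = f' and f'' = f''
        and a = "(s + 1) / 2" and b = "(s + 2) / 2" and c = "s + 1"])
    show "sqrt_power_coeff s 0 = f 0"
      by (simp add: sqrt_power_coeff_def f_def m_def V_def R_def)
    show "sqrt_power_coeff s (Suc 0) = f' 0"
      by (simp add: sqrt_power_coeff_def f'_def m_def V_def R_def Q_def field_simps)
    show "z \<in> ball 0 1" using z by simp
  qed (use df df' fode s sqrt_power_coeff_Suc in auto)
  thus ?thesis by (simp add: f_def m_def V_def R_def inverse_eq_divide)
qed

subsection \<open>Gauss's summation theorem\<close>

text \<open>The growth estimates give terms of order n^(Re (a + b - c) - 1), and this exponent is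
  below -1.\<close>

lemma summable_norm_hyp_coeff_at_1:
  assumes c: "Re c > 0" and abc: "Re (c - a - b) > 0"
  obtains K where "\<And>n. n > 0 \<Longrightarrow> norm (hyp_coeff a b c n) \<le> K * real n powr (Re (a + b - c) - 1)"
    "summable (\<lambda>n. norm (hyp_coeff a b c n))"
proof -
  obtain Ka where Ka: "\<And>n. n > 0 \<Longrightarrow> norm (pochhammer a n) \<le> Ka * fact (n - 1) * real n powr Re a"
    using pochhammer_bound[of a] by blast
  obtain Kb where Kb: "\<And>n. n > 0 \<Longrightarrow> norm (pochhammer b n) \<le> Kb * fact (n - 1) * real n powr Re b"
    using pochhammer_bound[of b] by blast
  obtain Kc where Kc: "\<And>n. n > 0 \<Longrightarrow> norm (rGamma (c + of_nat n)) \<le> Kc / (fact (n - 1) * real n powr Re c)"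
    using rGamma_bound_pos[OF c] by blast
  have K: "norm (hyp_coeff a b c n) \<le> Ka * Kb * Kc * real n powr (Re (a + b - c) - 1)" if n: "n > 0" for n
  proof -
    have "norm (hyp_coeff a b c n) = norm (pochhammer a n) * norm (pochhammer b n) * norm (rGamma (c + of_nat n)) / fact n"
      by (simp add: hyp_coeff_def norm_mult norm_divide)
    also have "\<dots> \<le> (Ka * fact (n - 1) * real n powr Re a) * (Kb * fact (n - 1) * real n powr Re b) *
        (Kc / (fact (n - 1) * real n powr Re c)) / fact n"
      by (intro divide_right_mono mult_mono Ka Kb Kc n mult_nonneg_nonneg norm_ge_zero
          order_trans[OF norm_ge_zero Ka[OF n]] order_trans[OF norm_ge_zero Kb[OF n]]) auto
    also have "\<dots> = Ka * Kb * Kc * (real n powr (Re a + Re b - Re c)) * (fact (n - 1) / fact n)"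
      by (simp add: powr_add powr_diff)
    also have "fact (n - 1) / (fact n :: real) = real n powr (- 1)"
      using n by (simp add: fact_reduce[of n] powr_minus inverse_eq_divide)
    also have "Ka * Kb * Kc * (real n powr (Re a + Re b - Re c)) * real n powr (- 1) =
       Ka * Kb * Kc * real n powr (Re (a + b - c) - 1)"
      by (simp only: mult.assoc powr_add[symmetric]) simp
    finally show ?thesis .
  qed
  have "summable (\<lambda>n. Ka * Kb * Kc * real n powr (Re (a + b - c) - 1))"
    using abc by (intro summable_mult) (simp add: summable_real_powr_iff)
  hence "summable (\<lambda>n. norm (hyp_coeff a b c n))"
    by (rule summable_comparison_test'[where N = 1]) (use K in auto)
  thus ?thesis using K that by blast
qed

lemma norm_pochhammer_ge:
  assumes "Re c > 0"
  shows "pochhammer (Re c) n \<le> norm (pochhammer c n)"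
proof -
  have "pochhammer (Re c) n = (\<Prod>i<n. Re c + real i)"
    by (simp add: pochhammer_prod lessThan_atLeast0)
  also have "\<dots> \<le> (\<Prod>i<n. norm (c + of_nat i))"
  proof (intro prod_mono conjI)
    fix i
    show "Re c + real i \<le> norm (c + of_nat i)"
      using complex_Re_le_cmod[of "c + of_nat i"] by simp
  qed (use assms in auto)
  also have "\<dots> = norm (pochhammer c n)"
    by (simp add: pochhammer_prod prod_norm[symmetric] lessThan_atLeast0)
  finally show ?thesis .
qed

text \<open>Summation of \<open>hyp_coeff_contiguous\<close>: its first two terms telescope, and the
  boundary term, n times the n-th coefficient, tends to 0 by the rate of decay.\<close>

lemma hyp_coeff_sum_shift:
  assumes c: "Re c > 0" and abc: "Re (c - a - b) > 0"
  shows "(c - a - b) * (\<Sum>n. hyp_coeff a b c n) = (c - a) * (c - b) * (\<Sum>n. hyp_coeff a b (c + 1) n)"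
proof -
  obtain K where K: "\<And>n. n > 0 \<Longrightarrow> norm (hyp_coeff a b c n) \<le> K * real n powr (Re (a + b - c) - 1)"
    "summable (\<lambda>n. norm (hyp_coeff a b c n))"
    using summable_norm_hyp_coeff_at_1[OF c abc] by blast
  have s2: "summable (\<lambda>n. norm (hyp_coeff a b (c + 1) n))"
    using summable_norm_hyp_coeff_at_1[of "c + 1" a b] c abc by force
  have "(\<lambda>n. of_nat n * hyp_coeff a b c n) \<longlonglongrightarrow> 0"
  proof (rule Lim_null_comparison)
    show "eventually (\<lambda>n. norm (of_nat n * hyp_coeff a b c n) \<le> K * real n powr (Re (a + b - c))) sequentially"
      using eventually_gt_at_top[of 0]
    proof eventually_elim
      case (elim n)
      have "norm (of_nat n * hyp_coeff a b c n) \<le> real n * (K * real n powr (Re (a + b - c) - 1))"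
        using K(1)[OF elim] by (simp add: norm_mult mult_left_mono)
      also have "\<dots> = K * (real n powr 1 * real n powr (Re (a + b - c) - 1))"
        using elim by simp
      also have "\<dots> = K * real n powr (Re (a + b - c))"
        unfolding powr_add[symmetric] by (simp add: algebra_simps)
      finally show ?case .
    qed
    have "((\<lambda>n. real n powr (Re (a + b - c))) \<longlongrightarrow> 0) sequentially"
      using abc by (intro tendsto_neg_powr filterlim_real_sequentially) auto
    thus "(\<lambda>n. K * real n powr (Re (a + b - c))) \<longlonglongrightarrow> 0"
      by (rule tendsto_mult_right_zero)
  qed
  hence "(\<lambda>n. of_nat (Suc n) * hyp_coeff a b c (Suc n) - of_nat n * hyp_coeff a b c n) sums
     (0 - of_nat 0 * hyp_coeff a b c 0)"
    by (rule telescope_sums)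
  hence "(\<lambda>n. of_nat (Suc n) * hyp_coeff a b c (Suc n) - of_nat n * hyp_coeff a b c n + (c - a - b) * hyp_coeff a b c n) sums
     (0 + (c - a - b) * (\<Sum>n. hyp_coeff a b c n))"
    by (intro sums_add sums_mult summable_sums summable_norm_cancel[OF K(2)]) simp
  moreover have "(\<lambda>n. (c - a) * (c - b) * hyp_coeff a b (c + 1) n) sums
     ((c - a) * (c - b) * (\<Sum>n. hyp_coeff a b (c + 1) n))"
    by (intro sums_mult summable_sums summable_norm_cancel[OF s2])
  ultimately show ?thesis
    unfolding hyp_coeff_contiguous using sums_unique2 by fastforce
qed

lemma hyp_coeff_sum_shift_n:
  assumes c: "Re c > 0" and abc: "Re (c - a - b) > 0"
  shows "pochhammer (c - a - b) m * (\<Sum>n. hyp_coeff a b c n) =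
    pochhammer (c - a) m * pochhammer (c - b) m * (\<Sum>n. hyp_coeff a b (c + of_nat m) n)"
proof (induction m)
  case (Suc m)
  have "pochhammer (c - a - b) (Suc m) * (\<Sum>n. hyp_coeff a b c n) =
    pochhammer (c - a) m * pochhammer (c - b) m * ((c + of_nat m - a - b) * (\<Sum>n. hyp_coeff a b (c + of_nat m) n))"
    using Suc.IH by (simp add: pochhammer_Suc algebra_simps)
  also have "(c + of_nat m - a - b) * (\<Sum>n. hyp_coeff a b (c + of_nat m) n) =
    (c + of_nat m - a) * (c + of_nat m - b) * (\<Sum>n. hyp_coeff a b (c + of_nat m + 1) n)"
    using c abc by (intro hyp_coeff_sum_shift) auto
  finally show ?case by (simp add: pochhammer_Suc algebra_simps)
qed simp

text \<open>The factor \<open>pochhammer c m\<close> turns term 0 into \<open>rGamma c\<close>,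
  while each later term is at most a constant times 1 / (Re c + m) times the term of a fixed
  summable sequence. Only term 0 survives.\<close>

lemma hyp_coeff_sum_limit:
  assumes c: "Re c > 0" and abc: "Re (c - a - b) > 0"
  shows "(\<lambda>m. pochhammer c m * (\<Sum>n. hyp_coeff a b (c + of_nat m) n)) \<longlonglongrightarrow> rGamma c"
proof -
  \<comment> \<open>For m at least 1 the shifted parameter has real part at least \<open>d\<close>,
    so the terms at \<open>d\<close> can serve as majorant; they are summable since Re (d - a - b)
    is still positive.\<close>
  define d where "d = Re c + 1"
  have d: "d > 1" using c by (simp add: d_def)
  define h where "h = (\<lambda>n. norm (hyp_coeff a b (of_real d) n))"
  have h: "summable h"
    unfolding h_def using summable_norm_hyp_coeff_at_1[of "of_real d" a b] d abc by (force simp: d_def)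
  define L where "L = norm (rGamma c) * Gamma d * d * (\<Sum>n. h (Suc n))"
  have bound: "norm (pochhammer c m * (\<Sum>n. hyp_coeff a b (c + of_nat m) n) - rGamma c) \<le> L / (Re c + real m)"
    if m: "m \<ge> 1" for m
  proof -
    have sm: "summable (\<lambda>n. norm (hyp_coeff a b (c + of_nat m) n))"
      using summable_norm_hyp_coeff_at_1[of "c + of_nat m" a b] c abc by force
    have t0: "pochhammer c m * hyp_coeff a b (c + of_nat m) 0 = rGamma c"
      using pochhammer_rGamma[of c m] by simp
    have tm: "norm (pochhammer c m * hyp_coeff a b (c + of_nat m) (Suc n)) \<le>
        norm (rGamma c) * Gamma d * d / (Re c + real m) * h (Suc n)" for n
    proof -
      define N where "N = Suc n"
      have p0: "pochhammer (c + of_nat m) N \<noteq> 0"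
      proof -
        have "c + of_nat m \<notin> \<int>\<^sub>\<le>\<^sub>0" using c by (auto elim!: nonpos_Ints_cases' simp: complex_eq_iff)
        thus ?thesis using pochhammer_eq_0_imp_nonpos_Int by blast
      qed
      have "pochhammer c m * rGamma (c + of_nat m + of_nat N) * pochhammer (c + of_nat m) N = rGamma c"
        using pochhammer_rGamma[of c m] pochhammer_rGamma[of "c + of_nat m" N] by (simp add: mult_ac)
      hence "norm (pochhammer c m * rGamma (c + of_nat m + of_nat N)) = norm (rGamma c) / norm (pochhammer (c + of_nat m) N)"
        using p0 by (metis nonzero_mult_div_cancel_right norm_divide)
      also have "\<dots> \<le> norm (rGamma c) / ((Re c + real m) / d * pochhammer d N)"
      proof (intro divide_left_mono)
        \<comment> \<open>Only the factors after the first are lowered to those of \<open>d\<close>;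
          the first one, Re c + m, is kept and provides the decay in m.\<close>
        have "(Re c + real m) / d * pochhammer d N = (Re c + real m) * pochhammer (d + 1) n"
          using d by (simp add: N_def pochhammer_rec)
        also have "pochhammer (d + 1) n \<le> pochhammer (Re c + real m + 1) n"
          using m d by (auto simp: pochhammer_prod d_def intro!: prod_mono)
        hence "(Re c + real m) * pochhammer (d + 1) n \<le> (Re c + real m) * pochhammer (Re c + real m + 1) n"
          using c by (intro mult_left_mono) auto
        also have "\<dots> = pochhammer (Re (c + of_nat m)) N"
          by (simp add: N_def pochhammer_rec)
        also have "\<dots> \<le> norm (pochhammer (c + of_nat m) N)"
          using c by (intro norm_pochhammer_ge) auto
        finally show "(Re c + real m) / d * pochhammer d N \<le> norm (pochhammer (c + of_nat m) N)" .
        show "0 < norm (pochhammer (c + of_nat m) N) * ((Re c + real m) / d * pochhammer d N)"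
          using p0 c d by (intro mult_pos_pos divide_pos_pos pochhammer_pos) auto
      qed auto
      also have "\<dots> = norm (rGamma c) * d / (Re c + real m) * (1 / pochhammer d N)"
        by simp
      also have "1 / pochhammer d N = Gamma d * norm (rGamma (of_real d + of_nat N :: complex))"
      proof -
        have "norm (rGamma (of_real d + of_nat N :: complex)) = norm (rGamma (of_real (d + real N) :: complex))"
          by simp
        also have "\<dots> = rGamma (d + real N)"
          unfolding rGamma_complex_of_real norm_of_real
          using d Gamma_real_pos[of "d + real N"] by (simp add: rGamma_inverse_Gamma)
        finally have e: "norm (rGamma (of_real d + of_nat N :: complex)) = rGamma (d + real N)" .
        have "Gamma d > 0" using d by (intro Gamma_real_pos) simp
        hence "Gamma d * rGamma d = 1" by (simp add: rGamma_inverse_Gamma)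
        hence "Gamma d * (pochhammer d N * rGamma (d + real N)) = 1"
          by (simp add: pochhammer_rGamma[of d N, symmetric])
        thus ?thesis unfolding e
          using d pochhammer_pos[of d N] by (simp add: divide_eq_eq mult_ac)
      qed
      finally have *: "norm (pochhammer c m * rGamma (c + of_nat m + of_nat N)) \<le>
         norm (rGamma c) * d / (Re c + real m) * (Gamma d * norm (rGamma (of_real d + of_nat N :: complex)))" .
      have "norm (pochhammer c m * hyp_coeff a b (c + of_nat m) N) =
        norm (pochhammer a N * pochhammer b N / fact N) * norm (pochhammer c m * rGamma (c + of_nat m + of_nat N))"
        by (simp add: hyp_coeff_def norm_mult norm_divide)
      also have "\<dots> \<le> norm (pochhammer a N * pochhammer b N / fact N) *
         (norm (rGamma c) * d / (Re c + real m) * (Gamma d * norm (rGamma (of_real d + of_nat N :: complex))))"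
        by (intro mult_left_mono * norm_ge_zero)
      also have "\<dots> = norm (rGamma c) * Gamma d * d / (Re c + real m) * h N"
        by (simp add: h_def hyp_coeff_def norm_mult norm_divide mult_ac)
      finally show ?thesis unfolding N_def .
    qed
    have s1: "summable (\<lambda>n. pochhammer c m * hyp_coeff a b (c + of_nat m) n)"
      by (intro summable_mult summable_norm_cancel[OF sm])
    have "pochhammer c m * (\<Sum>n. hyp_coeff a b (c + of_nat m) n) = (\<Sum>n. pochhammer c m * hyp_coeff a b (c + of_nat m) n)"
      by (intro suminf_mult[symmetric] summable_norm_cancel[OF sm])
    also have "\<dots> = (\<Sum>n. pochhammer c m * hyp_coeff a b (c + of_nat m) (Suc n)) + rGamma c"
      using suminf_split_head[OF s1] t0 by simp
    finally have "norm (pochhammer c m * (\<Sum>n. hyp_coeff a b (c + of_nat m) n) - rGamma c) =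
      norm (\<Sum>n. pochhammer c m * hyp_coeff a b (c + of_nat m) (Suc n))" by simp
    also have "\<dots> \<le> (\<Sum>n. norm (rGamma c) * Gamma d * d / (Re c + real m) * h (Suc n))"
      by (intro norm_suminf_le tm summable_mult) (use h in \<open>simp add: summable_Suc_iff\<close>)
    also have "\<dots> = L / (Re c + real m)"
      unfolding L_def by (subst suminf_mult) (use h in \<open>simp_all add: summable_Suc_iff\<close>)
    finally show ?thesis .
  qed
  have "(\<lambda>m. pochhammer c m * (\<Sum>n. hyp_coeff a b (c + of_nat m) n) - rGamma c) \<longlonglongrightarrow> 0"
  proof (rule Lim_null_comparison)
    show "eventually (\<lambda>m. norm (pochhammer c m * (\<Sum>n. hyp_coeff a b (c + of_nat m) n) - rGamma c) \<le> L / (Re c + real m)) sequentially"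
      using eventually_ge_at_top[of 1] by eventually_elim (rule bound)
    show "(\<lambda>m. L / (Re c + real m)) \<longlonglongrightarrow> 0"
      by (intro tendsto_divide_0[OF tendsto_const] filterlim_at_top_imp_at_infinity
          filterlim_tendsto_add_at_top[OF tendsto_const] filterlim_real_sequentially)
  qed
  thus ?thesis by (simp add: LIM_zero_iff)
qed

text \<open>The recursion in \<open>c\<close> reduces the sum to the limit \<open>c \<rightarrow> \<infinity>\<close>.\<close>

lemma gauss_sum:
  assumes c: "Re c > 0" and abc: "Re (c - a - b) > 0"
  shows "(\<Sum>n. hyp_coeff a b c n) = Gamma (c - a - b) * rGamma (c - a) * rGamma (c - b)"
proof -
  define R where "R = (\<Sum>n. hyp_coeff a b c n)"
  have np: "c \<notin> \<int>\<^sub>\<le>\<^sub>0" "c - a - b \<notin> \<int>\<^sub>\<le>\<^sub>0"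
    using c abc by (auto elim!: nonpos_Ints_cases' simp: complex_eq_iff)
  have nz: "pochhammer c m \<noteq> 0" "pochhammer (c - a - b) m \<noteq> 0" for m
    using np pochhammer_eq_0_imp_nonpos_Int by blast+
  have gz: "rGamma c \<noteq> 0" "rGamma (c - a - b) \<noteq> 0" using np by (simp_all add: rGamma_eq_zero_iff)
  \<comment> \<open>Gauss's product for the four reciprocal Gamma values; factorials and powers of m
    cancel because (c - a) + (c - b) = (c - a - b) + c.\<close>
  define r where "r = (\<lambda>m. rGamma_series (c - a) m * rGamma_series (c - b) m / (rGamma_series (c - a - b) m * rGamma_series c m))"
  have "r \<longlonglongrightarrow> rGamma (c - a) * rGamma (c - b) / (rGamma (c - a - b) * rGamma c)"
    unfolding r_def by (intro tendsto_intros) (use gz in simp)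
  \<comment> \<open>\<open>rGamma_series\<close> at m contains the Pochhammer symbol of index m + 1,
    hence the shifted sequence.\<close>
  moreover have "(\<lambda>m. pochhammer c (Suc m) * (\<Sum>n. hyp_coeff a b (c + of_nat (Suc m)) n)) \<longlonglongrightarrow> rGamma c"
    using hyp_coeff_sum_limit[OF assms] by (rule LIMSEQ_Suc)
  ultimately have "(\<lambda>m. r m * (pochhammer c (Suc m) * (\<Sum>n. hyp_coeff a b (c + of_nat (Suc m)) n))) \<longlonglongrightarrow>
      rGamma (c - a) * rGamma (c - b) / (rGamma (c - a - b) * rGamma c) * rGamma c"
    by (rule tendsto_mult)
  moreover have "eventually (\<lambda>m. r m * (pochhammer c (Suc m) * (\<Sum>n. hyp_coeff a b (c + of_nat (Suc m)) n)) = R) sequentially"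
    using eventually_gt_at_top[of 0]
  proof eventually_elim
    case (elim m)
    define E where "E = (\<lambda>z::complex. exp (z * of_real (ln (of_nat m))))"
    have E: "E (c - a) * E (c - b) = E (c - a - b) * E c" "E z \<noteq> 0" for z
      unfolding E_def exp_add[symmetric] by (simp_all add: algebra_simps)
    have "r m = pochhammer (c - a) (Suc m) * pochhammer (c - b) (Suc m) / (pochhammer (c - a - b) (Suc m) * pochhammer c (Suc m))
       * ((E (c - a - b) * E c) / (E (c - a) * E (c - b)))"
      unfolding r_def rGamma_series_def E_def Suc_eq_plus1 by (simp add: divide_simps)
    also have "(E (c - a - b) * E c) / (E (c - a) * E (c - b)) = 1"
      using E by simp
    finally have "r m * (pochhammer c (Suc m) * (\<Sum>n. hyp_coeff a b (c + of_nat (Suc m)) n)) =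
       pochhammer (c - a) (Suc m) * pochhammer (c - b) (Suc m) * (\<Sum>n. hyp_coeff a b (c + of_nat (Suc m)) n) / pochhammer (c - a - b) (Suc m)"
      using nz by (simp del: of_nat_Suc)
    also have "\<dots> = R"
      using hyp_coeff_sum_shift_n[OF assms, of "Suc m"] nz unfolding R_def
      by (metis nonzero_mult_div_cancel_left)
    finally show ?case .
  qed
  ultimately have "(\<lambda>m. R) \<longlonglongrightarrow> rGamma (c - a) * rGamma (c - b) / (rGamma (c - a - b) * rGamma c) * rGamma c"
    by (rule Lim_transform_eventually)
  hence "R = rGamma (c - a) * rGamma (c - b) / (rGamma (c - a - b) * rGamma c) * rGamma c"
    by (simp add: LIMSEQ_const_iff)
  thus ?thesis unfolding R_def using gz by (simp add: Gamma_def field_simps)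
qed

subsection \<open>Beta integrals\<close>

text \<open>Exchange of sum and integral by absolute convergence: the Lebesgue statement, applied to
  the functions cut off by the indicator of \<open>S\<close>, is carried over to the gauge
  integral.\<close>

lemma absolutely_integrable_suminf:
  fixes f :: "nat \<Rightarrow> real \<Rightarrow> complex"
  assumes ai: "\<And>i. f i absolutely_integrable_on S"
    and sm: "\<And>x. x \<in> S \<Longrightarrow> summable (\<lambda>i. norm (f i x))"
    and si: "summable (\<lambda>i. integral S (\<lambda>x. norm (f i x)))"
  shows "(\<lambda>x. \<Sum>i. f i x) absolutely_integrable_on S"
    and "(\<lambda>i. integral S (f i)) sums integral S (\<lambda>x. \<Sum>i. f i x)"
proof -
  define g where "g = (\<lambda>i x. indicator S x *\<^sub>R f i x)"
  have g1: "integrable lebesgue (g i)" for i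
    using ai[of i] unfolding set_integrable_def g_def .
  have g2: "AE x in lebesgue. summable (\<lambda>i. norm (g i x))"
  proof (rule AE_I2)
    fix x show "summable (\<lambda>i. norm (g i x))"
      using sm[of x] by (cases "x \<in> S") (simp_all add: g_def)
  qed
  have n: "integral\<^sup>L lebesgue (\<lambda>x. norm (g i x)) = integral S (\<lambda>x. norm (f i x))" for i
  proof -
    have "(\<lambda>x. norm (f i x)) absolutely_integrable_on S"
      by (intro set_integrable_norm ai)
    from set_lebesgue_integral_eq_integral(2)[OF this]
    show ?thesis by (simp add: set_lebesgue_integral_def g_def)
  qed
  have g3: "summable (\<lambda>i. integral\<^sup>L lebesgue (\<lambda>x. norm (g i x)))"
    unfolding n by (rule si)
  have gs: "(\<Sum>i. g i x) = indicator S x *\<^sub>R (\<Sum>i. f i x)" for x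
    by (cases "x \<in> S") (simp_all add: g_def)
  have "integrable lebesgue (\<lambda>x. \<Sum>i. g i x)"
    by (rule integrable_suminf[OF g1 g2 g3])
  thus *: "(\<lambda>x. \<Sum>i. f i x) absolutely_integrable_on S"
    unfolding gs set_integrable_def .
  have "(\<lambda>i. integral\<^sup>L lebesgue (g i)) sums (\<integral>x. (\<Sum>i. g i x) \<partial>lebesgue)"
    by (rule sums_integral[OF g1 g2 g3])
  moreover have "integral\<^sup>L lebesgue (g i) = integral S (f i)" for i
    using set_lebesgue_integral_eq_integral(2)[OF ai[of i]] by (simp add: set_lebesgue_integral_def g_def)
  moreover have "(\<integral>x. (\<Sum>i. g i x) \<partial>lebesgue) = integral S (\<lambda>x. \<Sum>i. f i x)"
    unfolding gs using set_lebesgue_integral_eq_integral(2)[OF *] by (simp add: set_lebesgue_integral_def)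
  ultimately show "(\<lambda>i. integral S (f i)) sums integral S (\<lambda>x. \<Sum>i. f i x)"
    by simp
qed

lemma absolutely_integrable_continuous_bounded:
  fixes f :: "real \<Rightarrow> complex"
  assumes "continuous_on S f" "S \<in> sets lebesgue" "g integrable_on S" "\<And>x. x \<in> S \<Longrightarrow> norm (f x) \<le> g x"
  shows "f absolutely_integrable_on S"
  by (rule measurable_bounded_by_integrable_imp_absolutely_integrable[OF _ assms(2-4)])
    (intro continuous_imp_measurable_on_sets_lebesgue assms)

definition beta_kernel :: "complex \<Rightarrow> complex \<Rightarrow> real \<Rightarrow> complex" where
  "beta_kernel p q t = of_real t powr (p - 1) * of_real (1 - t) powr (q - 1)"

lemma continuous_on_of_real_powr:
  fixes g :: "real \<Rightarrow> real" and z :: complex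
  assumes "continuous_on S g" "\<And>x. x \<in> S \<Longrightarrow> g x > 0"
  shows "continuous_on S (\<lambda>x. of_real (g x) powr z)"
proof -
  have "continuous_on S (\<lambda>x. exp (z * of_real (ln (g x))))"
    by (intro continuous_intros assms) (use assms(2) in force)
  also have "?this \<longleftrightarrow> ?thesis"
    using assms(2) by (intro continuous_on_cong) (force simp: powr_def Ln_of_real)+
  finally show ?thesis .
qed

lemma norm_beta_kernel:
  assumes "t \<in> {0<..<1}"
  shows "norm (beta_kernel p q t) = t powr (Re p - 1) * (1 - t) powr (Re q - 1)"
  using assms unfolding beta_kernel_def norm_mult
  by (simp add: norm_powr_real_powr)

lemma beta_kernel_absolutely_integrable:
  assumes "Re p > 0" "Re q > 0"
  shows "beta_kernel p q absolutely_integrable_on {0<..<1}"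
    "integral {0<..<1} (\<lambda>t. norm (beta_kernel p q t)) = Beta (Re p) (Re q)"
proof -
  have I: "((\<lambda>t. t powr (Re p - 1) * (1 - t) powr (Re q - 1)) has_integral Beta (Re p) (Re q)) {0<..<1}"
    using has_integral_Beta_real[OF assms] by (simp add: has_integral_Icc_iff_Ioo)
  show "beta_kernel p q absolutely_integrable_on {0<..<1}"
  proof (rule absolutely_integrable_continuous_bounded)
    show "continuous_on {0<..<1} (beta_kernel p q)"
      unfolding beta_kernel_def[abs_def]
      by (intro continuous_on_mult continuous_on_of_real_powr continuous_intros) auto
    show "(\<lambda>t. t powr (Re p - 1) * (1 - t) powr (Re q - 1)) integrable_on {0<..<1}"
      using I by blast
  qed (auto simp: norm_beta_kernel)
  show "integral {0<..<1} (\<lambda>t. norm (beta_kernel p q t)) = Beta (Re p) (Re q)"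
    using I by (metis (mono_tags, lifting) integral_cong integral_unique norm_beta_kernel)
qed

text \<open>Since (p)_n / (p + 1)_n = p / (p + n), the integrated terms of a binomial series are
  hypergeometric terms at 1.\<close>

lemma hyp_coeff_beta:
  assumes "Re p > 0"
  shows "hyp_coeff a p (p + 1) n = rGamma p * (pochhammer a n / fact n / (p + of_nat n))"
proof -
  have "Re (p + of_nat n) \<noteq> 0" using assms by simp
  hence nz: "p + of_nat n \<noteq> 0" by (metis zero_complex.sel(1))
  have "(p + of_nat n) * rGamma (p + 1 + of_nat n) = rGamma (p + of_nat n)"
    using rGamma_plus1[of "p + of_nat n"] by (simp add: add_ac)
  hence "pochhammer p n * ((p + of_nat n) * rGamma (p + 1 + of_nat n)) = rGamma p"
    by (simp add: pochhammer_rGamma[of p n])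
  hence "pochhammer p n * rGamma (p + 1 + of_nat n) = rGamma p / (p + of_nat n)"
    using nz by (simp add: eq_divide_eq mult_ac)
  thus ?thesis unfolding hyp_coeff_def by (simp add: mult_ac)
qed

text \<open>Expanding \<open>(1 - t) powr (q - 1)\<close> by the binomial series turns the Beta integral into a
  hypergeometric series at \<open>1\<close>.\<close>

lemma integral_beta_kernel:
  assumes p: "Re p > 0" and q: "Re q > 0"
  shows "integral {0<..<1} (beta_kernel p q) = Gamma p * Gamma q * rGamma (p + q)"
proof -
  define f where "f = (\<lambda>n t. pochhammer (1 - q) n / fact n * (complex_of_real t powr (p + of_nat n - 1)))"
  have fb: "f n t = pochhammer (1 - q) n / fact n * beta_kernel (p + of_nat n) 1 t" if "t \<in> {0<..<1}" for n t
    using that by (simp add: f_def beta_kernel_def)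
  have fi: "f n absolutely_integrable_on {0<..<1}" for n
  proof -
    have "(\<lambda>t. pochhammer (1 - q) n / fact n * beta_kernel (p + of_nat n) 1 t) absolutely_integrable_on {0<..<1}"
      using p by (intro set_integrable_mult_right beta_kernel_absolutely_integrable) auto
    thus ?thesis by (rule absolutely_integrable_spike[where S = "{}"]) (auto simp: fb)
  qed
  have fint: "integral {0<..<1} (f n) = pochhammer (1 - q) n / fact n / (p + of_nat n)" for n
  proof -
    define z where "z = p + of_nat n"
    have z: "Re z > 0" using p by (simp add: z_def)
    hence "z \<noteq> 0" by auto
    have "((\<lambda>t. complex_of_real t powr (z - 1)) has_integral
            (of_real 1 powr z / z - of_real 0 powr z / z)) {0..1}" using z \<open>z \<noteq> 0\<close>
      by (intro fundamental_theorem_of_calculus_interior)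
         (auto intro!: continuous_intros derivative_eq_intros has_vector_derivative_real_field)
    hence "((\<lambda>t. complex_of_real t powr (z - 1)) has_integral 1 / z) {0<..<1}"
      by (simp add: has_integral_Icc_iff_Ioo)
    hence "(f n has_integral pochhammer (1 - q) n / fact n * (1 / z)) {0<..<1}"
      unfolding f_def z_def by (intro has_integral_mult_right) (simp add: algebra_simps)
    thus ?thesis by (simp add: integral_unique z_def)
  qed
  \<comment> \<open>The integrals of the norms are coefficients of the same type with Re p in place
    of p, so summability at 1 applies to them.\<close>
  have fnorm: "integral {0<..<1} (\<lambda>t. norm (f n t)) = norm (hyp_coeff (1 - q) (of_real (Re p)) (of_real (Re p) + 1) n) * Gamma (Re p)" for n
  proof -
    have "integral {0<..<1} (\<lambda>t. norm (f n t)) =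
      integral {0<..<1} (\<lambda>t. norm (pochhammer (1 - q) n / fact n) * norm (beta_kernel (p + of_nat n) 1 t))"
      by (intro integral_cong) (simp only: fb norm_mult)
    also have "\<dots> = norm (pochhammer (1 - q) n / fact n) * Beta (Re p + real n) 1"
      using p beta_kernel_absolutely_integrable(2)[of "p + of_nat n" 1] by (simp del: norm_divide)
    also have "Beta (Re p + real n) 1 = 1 / (Re p + real n)"
    proof -
      have pn: "Re p + real n > 0" using p by simp
      hence "Re p + real n \<notin> \<int>\<^sub>\<le>\<^sub>0" by (auto elim!: nonpos_Ints_cases')
      from Gamma_plus1[OF this] have "Beta (Re p + real n) 1 * (Re p + real n) = 1"
        using less_imp_neq[OF Gamma_real_pos[OF pn]] pn by (simp add: Beta_def)
      thus ?thesis using pn by (simp add: eq_divide_eq)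
    qed
    also have "norm (pochhammer (1 - q) n / fact n) * (1 / (Re p + real n)) =
       norm (hyp_coeff (1 - q) (of_real (Re p)) (of_real (Re p) + 1) n) * Gamma (Re p)"
    proof -
      have "norm (of_real (Re p) + of_nat n :: complex) = Re p + real n"
        using p by (metis add_nonneg_nonneg less_eq_real_def norm_of_real abs_of_nonneg of_nat_0_le_iff of_real_add of_real_of_nat_eq)
      moreover have "Gamma (Re p) > 0" using p by (intro Gamma_real_pos)
      hence "norm (rGamma (of_real (Re p) :: complex)) * Gamma (Re p) = 1"
        unfolding rGamma_complex_of_real norm_of_real by (simp add: rGamma_inverse_Gamma)
      ultimately show ?thesis
        using p by (subst hyp_coeff_beta) (simp_all add: norm_mult norm_divide)
    qed
    finally show ?thesis .
  qed
  have sums1: "(\<lambda>n. f n t) sums beta_kernel p q t" and abs1: "summable (\<lambda>n. norm (f n t))"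
    if t: "t \<in> {0<..<1}" for t
  proof -
    have bin: "(\<lambda>n. pochhammer (1 - q) n / fact n * z ^ n) sums (1 - z) powr (q - 1)" if "norm z < 1" for z
    proof -
      have "(\<lambda>n. ((q - 1) gchoose n) * (- z) ^ n) sums (1 + (- z)) powr (q - 1)"
        using that by (intro gen_binomial_complex) simp
      moreover have "((q - 1) gchoose n) * (- z) ^ n = pochhammer (1 - q) n / fact n * z ^ n" for n
        by (simp add: gbinomial_pochhammer power_minus[of z])
      ultimately show ?thesis by simp
    qed
    have pw: "of_real t powr (p + of_nat n - 1) = of_real t powr (p - 1) * of_real t ^ n" for n
    proof -
      have "of_real t powr (p + of_nat n - 1) = of_real t powr ((p - 1) + of_nat n)"
        by (simp add: algebra_simps)
      also have "\<dots> = of_real t powr (p - 1) * of_real t ^ n"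
        using t by (subst powr_add) (simp add: powr_nat)
      finally show ?thesis .
    qed
    have "(\<lambda>n. of_real t powr (p - 1) * (pochhammer (1 - q) n / fact n * of_real t ^ n)) sums
        (of_real t powr (p - 1) * (1 - of_real t) powr (q - 1))"
      using t by (intro sums_mult bin) auto
    thus "(\<lambda>n. f n t) sums beta_kernel p q t"
      unfolding f_def pw beta_kernel_def by (simp add: mult_ac)
    \<comment> \<open>Convergence at the larger point (1 + t) / 2 gives absolute convergence at
      t.\<close>
    have "summable (\<lambda>n. norm (pochhammer (1 - q) n / fact n * of_real t ^ n))"
    proof (rule powser_insidea)
      show "summable (\<lambda>n. pochhammer (1 - q) n / fact n * of_real ((1 + t) / 2) ^ n)"
        using t by (intro sums_summable[OF bin]) (auto simp: norm_of_real simp del: of_real_divide of_real_add)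
      show "norm (complex_of_real t) < norm (complex_of_real ((1 + t) / 2))"
        using t unfolding norm_of_real by auto
    qed
    hence "summable (\<lambda>n. norm (of_real t powr (p - 1)) * norm (pochhammer (1 - q) n / fact n * of_real t ^ n))"
      by (rule summable_mult)
    thus "summable (\<lambda>n. norm (f n t))"
      unfolding f_def pw norm_mult by (simp add: mult_ac)
  qed
  have sn: "summable (\<lambda>n. integral {0<..<1} (\<lambda>t. norm (f n t)))"
    unfolding fnorm
  proof (rule summable_mult2)
    show "summable (\<lambda>n. norm (hyp_coeff (1 - q) (of_real (Re p)) (of_real (Re p) + 1) n))"
      by (rule summable_norm_hyp_coeff_at_1[of "of_real (Re p) + 1" "1 - q" "of_real (Re p)"])
        (use p q in simp_all)
  qed
  have "(\<lambda>n. integral {0<..<1} (f n)) sums integral {0<..<1} (\<lambda>t. \<Sum>n. f n t)"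
    by (rule absolutely_integrable_suminf(2)[OF fi abs1 sn])
  also have "integral {0<..<1} (\<lambda>t. \<Sum>n. f n t) = integral {0<..<1} (beta_kernel p q)"
    by (intro integral_cong) (use sums1 in \<open>simp add: sums_iff\<close>)
  finally have s1: "(\<lambda>n. pochhammer (1 - q) n / fact n / (p + of_nat n)) sums integral {0<..<1} (beta_kernel p q)"
    unfolding fint .
  have "summable (\<lambda>n. norm (hyp_coeff (1 - q) p (p + 1) n))"
    by (rule summable_norm_hyp_coeff_at_1[of "p + 1" "1 - q" p]) (use p q in simp_all)
  hence "(\<lambda>n. hyp_coeff (1 - q) p (p + 1) n) sums (Gamma (p + 1 - (1 - q) - p) * rGamma (p + 1 - (1 - q)) * rGamma (p + 1 - p))"
    using p q by (subst gauss_sum[symmetric]) (auto intro: summable_sums summable_norm_cancel)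
  hence "(\<lambda>n. rGamma p * (pochhammer (1 - q) n / fact n / (p + of_nat n))) sums (Gamma q * rGamma (p + q))"
  proof -
    have e: "p + 1 - (1 - q) - p = q" "p + 1 - (1 - q) = p + q" "p + 1 - p = 1" "p + q - p = q" by simp_all
    have "hyp_coeff (1 - q) p (p + 1) = (\<lambda>n. rGamma p * (pochhammer (1 - q) n / fact n / (p + of_nat n)))"
      using hyp_coeff_beta[OF p] by blast
    thus ?thesis using \<open>(\<lambda>n. hyp_coeff (1 - q) p (p + 1) n) sums _\<close>
      by (simp only: e rGamma_1 mult_1_right)
  qed
  from sums_mult[OF this, of "Gamma p"]
  have "(\<lambda>n. (Gamma p * rGamma p) * (pochhammer (1 - q) n / fact n / (p + of_nat n))) sums (Gamma p * Gamma q * rGamma (p + q))"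
    by (simp add: mult_ac)
  moreover have "p \<notin> \<int>\<^sub>\<le>\<^sub>0" using p by (auto elim!: nonpos_Ints_cases')
  hence "Gamma p * rGamma p = 1" by (simp add: Gamma_def rGamma_eq_zero_iff)
  ultimately show ?thesis using s1 sums_unique2 by simp
qed

text \<open>The exponent c of the weight is also the lower parameter. So the Gamma (c + n) of the
  n-th Beta integral cancels the normalisation of the series, leaving a series at 1 with lower
  parameter s + c for Gauss's theorem.\<close>

lemma integral_hyp_series_beta:
  assumes s: "Re s > 0" and c: "Re c > 0" and sc: "Re (s + c - a - b) > 0"
  shows "(\<lambda>r. beta_kernel s c r * hyp2F1_reg_series a b c (of_real (1 - r))) absolutely_integrable_on {0<..<1}"
    and "integral {0<..<1} (\<lambda>r. beta_kernel s c r * hyp2F1_reg_series a b c (of_real (1 - r))) =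
      Gamma s * Gamma (s + c - a - b) * rGamma (s + c - a) * rGamma (s + c - b)"
proof -
  define f where "f = (\<lambda>n r. hyp_coeff a b c n * beta_kernel s (c + of_nat n) r)"
  have bk: "beta_kernel s (c + of_nat n) r = beta_kernel s c r * of_real (1 - r) ^ n" if "r \<in> {0<..<1}" for n r
  proof -
    have nz: "of_real (1 - r) \<noteq> (0::complex)" using that by (simp del: of_real_diff)
    have "of_real (1 - r) powr (c + of_nat n - 1) = of_real (1 - r) powr ((c - 1) + of_nat n)"
      by (simp add: algebra_simps)
    also have "\<dots> = of_real (1 - r) powr (c - 1) * of_real (1 - r) ^ n"
      using nz by (simp add: powr_add powr_nat del: of_real_diff)
    finally show ?thesis unfolding beta_kernel_def by (simp add: mult_ac)
  qed
  have fi: "f n absolutely_integrable_on {0<..<1}" for n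
    unfolding f_def using s c by (intro set_integrable_mult_right beta_kernel_absolutely_integrable) auto
  have cn: "c + of_nat n \<notin> \<int>\<^sub>\<le>\<^sub>0" for n using c by (auto elim!: nonpos_Ints_cases' simp: complex_eq_iff)
  have fint: "integral {0<..<1} (f n) = Gamma s * hyp_coeff a b (s + c) n" for n
  proof -
    have "integral {0<..<1} (f n) = hyp_coeff a b c n * (Gamma s * Gamma (c + of_nat n) * rGamma (s + (c + of_nat n)))"
      unfolding f_def using s c by (simp add: integral_beta_kernel)
    also have "\<dots> = Gamma s * (pochhammer a n * pochhammer b n * rGamma (s + c + of_nat n) / fact n) * (Gamma (c + of_nat n) * rGamma (c + of_nat n))"
      unfolding hyp_coeff_def by (simp add: add_ac mult_ac)
    also have "Gamma (c + of_nat n) * rGamma (c + of_nat n) = 1"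
      using cn[of n] by (simp add: Gamma_def rGamma_eq_zero_iff)
    finally show ?thesis by (simp add: hyp_coeff_def)
  qed
  define d where "d = Re c"
  \<comment> \<open>A bound for |1 / Gamma (c + n)| Gamma (Re c + n), uniform in n because |(c)_n|
    is at least (Re c)_n.\<close>
  define C where "C = norm (rGamma c) * Gamma d"
  have fnorm: "integral {0<..<1} (\<lambda>t. norm (f n t)) \<le> C * Gamma (Re s) * norm (hyp_coeff a b (of_real (Re s + d)) n)" for n
  proof -
    have "integral {0<..<1} (\<lambda>t. norm (f n t)) = norm (hyp_coeff a b c n) * Beta (Re s) (d + real n)"
      unfolding f_def norm_mult using beta_kernel_absolutely_integrable(2)[of s "c + of_nat n"] s c by (simp add: d_def)
    also have "\<dots> = norm (pochhammer a n * pochhammer b n / fact n) * (Gamma (Re s) * rGamma (Re s + (d + real n))) *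
         (norm (rGamma (c + of_nat n)) * Gamma (d + real n))"
      by (simp add: Beta_altdef hyp_coeff_def norm_mult norm_divide)
    also have "\<dots> \<le> norm (pochhammer a n * pochhammer b n / fact n) * (Gamma (Re s) * rGamma (Re s + (d + real n))) * C"
    proof (intro mult_left_mono)
      have d: "d > 0" using c by (simp add: d_def)
      have pz: "pochhammer c n \<noteq> 0" using cn[of 0] pochhammer_eq_0_imp_nonpos_Int by auto
      have "norm (rGamma (c + of_nat n)) = norm (rGamma c) / norm (pochhammer c n)"
        unfolding pochhammer_rGamma[of c n] using pz by (simp add: norm_mult)
      also have "\<dots> \<le> norm (rGamma c) / pochhammer d n"
        using c d norm_pochhammer_ge[of c n] pochhammer_pos[OF d, of n] pz unfolding d_def
        by (intro divide_left_mono) auto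
      finally have "norm (rGamma (c + of_nat n)) * Gamma (d + real n) \<le> norm (rGamma c) / pochhammer d n * Gamma (d + real n)"
        using d by (intro mult_right_mono less_imp_le[OF Gamma_real_pos]) auto
      also have hg: "Gamma (d + real n) = pochhammer d n * Gamma d"
      proof -
        have "d \<notin> \<int>\<^sub>\<le>\<^sub>0" using d by (auto elim!: nonpos_Ints_cases')
        from pochhammer_Gamma[OF this, of n] Gamma_real_pos[OF d] show ?thesis by simp
      qed
      finally show "norm (rGamma (c + of_nat n)) * Gamma (d + real n) \<le> C"
        unfolding hg using pochhammer_pos[OF d, of n] by (simp add: C_def)
      have "rGamma (Re s + (d + real n)) > 0"
        using s d Gamma_real_pos[of "Re s + (d + real n)"] by (simp add: rGamma_inverse_Gamma)
      moreover have "Gamma (Re s) > 0" using s by (rule Gamma_real_pos)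
      ultimately show "0 \<le> norm (pochhammer a n * pochhammer b n / fact n) * (Gamma (Re s) * rGamma (Re s + (d + real n)))"
        by simp
    qed
    also have "rGamma (Re s + (d + real n)) = norm (rGamma (of_real (Re s + d) + of_nat n :: complex))"
    proof -
      have "rGamma (Re s + (d + real n)) > 0"
        using s c Gamma_real_pos[of "Re s + (d + real n)"] by (simp add: rGamma_inverse_Gamma d_def)
      hence "rGamma (Re s + (d + real n)) = norm (of_real (rGamma (Re s + (d + real n))) :: complex)"
        by simp
      also have "\<dots> = norm (rGamma (of_real (Re s + (d + real n)) :: complex))"
        unfolding rGamma_complex_of_real ..
      finally show ?thesis by (simp add: add_ac)
    qed
    also have "norm (pochhammer a n * pochhammer b n / fact n) * (Gamma (Re s) * norm (rGamma (of_real (Re s + d) + of_nat n :: complex))) * C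
        = C * Gamma (Re s) * norm (hyp_coeff a b (of_real (Re s + d)) n)"
      by (simp add: hyp_coeff_def norm_mult norm_divide)
    finally show ?thesis .
  qed
  have sn: "summable (\<lambda>n. integral {0<..<1} (\<lambda>t. norm (f n t)))"
  proof (rule summable_comparison_test'[where N = 0])
    show "summable (\<lambda>n. C * Gamma (Re s) * norm (hyp_coeff a b (of_real (Re s + d)) n))"
    proof (rule summable_mult)
      show "summable (\<lambda>n. norm (hyp_coeff a b (of_real (Re s + d)) n))"
        by (rule summable_norm_hyp_coeff_at_1[of "of_real (Re s + d)" a b])
          (use s c sc in \<open>simp_all add: d_def\<close>)
    qed
    fix n
    have "integral {0<..<1} (\<lambda>t. norm (f n t)) \<ge> 0"
      by (intro integral_nonneg absolutely_integrable_on_def[THEN iffD1, THEN conjunct2]) (use fi in \<open>auto simp: absolutely_integrable_on_def\<close>)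
    thus "norm (integral {0<..<1} (\<lambda>t. norm (f n t))) \<le> C * Gamma (Re s) * norm (hyp_coeff a b (of_real (Re s + d)) n)"
      using fnorm[of n] by simp
  qed
  have abs1: "summable (\<lambda>n. norm (f n r))" and suminf1: "(\<Sum>n. f n r) = beta_kernel s c r * hyp2F1_reg_series a b c (of_real (1 - r))"
    if r: "r \<in> {0<..<1}" for r
  proof -
    have nr: "norm (of_real (1 - r) :: complex) < 1" using r by (simp only: norm_of_real) auto
    have "summable (\<lambda>n. norm (beta_kernel s c r) * (norm (hyp_coeff a b c n) * (1 - r) ^ n))"
      using r by (intro summable_mult summable_norm_hyp_coeff) auto
    thus "summable (\<lambda>n. norm (f n r))"
      unfolding f_def bk[OF r] norm_mult norm_power norm_of_real using r by (simp add: mult_ac)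
    have "(\<lambda>n. beta_kernel s c r * (hyp_coeff a b c n * of_real (1 - r) ^ n)) sums
       (beta_kernel s c r * hyp2F1_reg_series a b c (of_real (1 - r)))"
      by (intro sums_mult hyp_series_sums nr)
    thus "(\<Sum>n. f n r) = beta_kernel s c r * hyp2F1_reg_series a b c (of_real (1 - r))"
      unfolding f_def bk[OF r] by (simp add: sums_iff mult_ac)
  qed
  have "(\<lambda>r. \<Sum>n. f n r) absolutely_integrable_on {0<..<1}"
    by (rule absolutely_integrable_suminf(1)[OF fi abs1 sn])
  thus "(\<lambda>r. beta_kernel s c r * hyp2F1_reg_series a b c (of_real (1 - r))) absolutely_integrable_on {0<..<1}"
    by (rule absolutely_integrable_spike[where S = "{}"]) (auto simp: suminf1 simp del: of_real_diff)
  have "(\<lambda>n. integral {0<..<1} (f n)) sums integral {0<..<1} (\<lambda>t. \<Sum>n. f n t)"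
    by (rule absolutely_integrable_suminf(2)[OF fi abs1 sn])
  also have "integral {0<..<1} (\<lambda>t. \<Sum>n. f n t) =
      integral {0<..<1} (\<lambda>r. beta_kernel s c r * hyp2F1_reg_series a b c (of_real (1 - r)))"
    by (intro integral_cong suminf1)
  finally have s1: "(\<lambda>n. Gamma s * hyp_coeff a b (s + c) n) sums
      integral {0<..<1} (\<lambda>r. beta_kernel s c r * hyp2F1_reg_series a b c (of_real (1 - r)))"
    unfolding fint .
  have "summable (\<lambda>n. norm (hyp_coeff a b (s + c) n))"
    by (rule summable_norm_hyp_coeff_at_1[of "s + c" a b]) (use s c sc in simp_all)
  hence "(\<lambda>n. Gamma s * hyp_coeff a b (s + c) n) sums (Gamma s * (\<Sum>n. hyp_coeff a b (s + c) n))"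
    by (rule sums_mult[OF summable_sums[OF summable_norm_cancel]])
  with s1 have "integral {0<..<1} (\<lambda>r. beta_kernel s c r * hyp2F1_reg_series a b c (of_real (1 - r))) =
     Gamma s * (\<Sum>n. hyp_coeff a b (s + c) n)" by (rule sums_unique2)
  also have "(\<Sum>n. hyp_coeff a b (s + c) n) = Gamma (s + c - a - b) * rGamma (s + c - a) * rGamma (s + c - b)"
    by (rule gauss_sum) (use s c sc in simp_all)
  finally show "integral {0<..<1} (\<lambda>r. beta_kernel s c r * hyp2F1_reg_series a b c (of_real (1 - r))) =
      Gamma s * Gamma (s + c - a - b) * rGamma (s + c - a) * rGamma (s + c - b)" by (simp add: mult_ac)
qed

subsection \<open>The Burchnall--Chaundy expansion\<close>

text \<open>With the Pochhammer factors included, the coefficient of z^k is (a)_(n+k) (b)_(n+k) /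
  (Gamma (c + 2n + k) k!), the form in which the kernel moments produce it.\<close>

definition hyp_shifted :: "complex \<Rightarrow> complex \<Rightarrow> complex \<Rightarrow> nat \<Rightarrow> complex \<Rightarrow> complex" where
  "hyp_shifted a b c n z = pochhammer a n * pochhammer b n *
     hyp2F1_reg_series (a + of_nat n) (b + of_nat n) (c + 2 * of_nat n) z"

lemma hyp_shifted_sums:
  assumes "norm z < 1"
  shows "(\<lambda>k. pochhammer a (n + k) * pochhammer b (n + k) * rGamma (c + of_nat (2 * n + k)) / fact k * z ^ k)
    sums hyp_shifted a b c n z"
proof -
  have "(\<lambda>k. pochhammer a n * pochhammer b n * (hyp_coeff (a + of_nat n) (b + of_nat n) (c + 2 * of_nat n) k * z ^ k))
     sums hyp_shifted a b c n z"
    unfolding hyp_shifted_def by (intro sums_mult hyp_series_sums assms)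
  thus ?thesis
    unfolding pochhammer_product' by (simp add: hyp_coeff_def mult_ac add_ac)
qed

text \<open>On a fixed disc the double coefficient bound leaves polynomial growth in n, which any
  geometric factor outweighs.\<close>

lemma hyp_shifted_bound:
  assumes "0 \<le> \<rho>" "\<rho> < (1::real)"
  obtains K N where "K \<ge> 0" "\<And>n z. norm z \<le> \<rho> \<Longrightarrow> norm (hyp_shifted a b c n z) \<le> K * real (Suc n) ^ N"
proof -
  obtain K N where KN: "K \<ge> 0"
    "\<And>n k. norm (pochhammer a (n + k) * pochhammer b (n + k) * rGamma (c + of_nat (2 * n + k)) / fact k)
       \<le> K * real (Suc n) ^ N * real (Suc k) ^ N"
    using hyp_double_coeff_bound[of a b c] by blast
  define M where "M = (\<Sum>k. real (Suc k) ^ N * \<rho> ^ k)"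
  have sm: "summable (\<lambda>k. real (Suc k) ^ N * \<rho> ^ k)"
    using assms by (intro summable_poly_powser) auto
  have "norm (hyp_shifted a b c n z) \<le> K * M * real (Suc n) ^ N" if z: "norm z \<le> \<rho>" for n z
  proof -
    have "norm z < 1" using z assms by simp
    hence "hyp_shifted a b c n z = (\<Sum>k. pochhammer a (n + k) * pochhammer b (n + k) * rGamma (c + of_nat (2 * n + k)) / fact k * z ^ k)"
      using hyp_shifted_sums[of z] by (simp only: sums_iff)
    also have "norm \<dots> \<le> (\<Sum>k. K * real (Suc n) ^ N * (real (Suc k) ^ N * \<rho> ^ k))"
    proof (rule norm_suminf_le)
      fix k
      have "norm (pochhammer a (n + k) * pochhammer b (n + k) * rGamma (c + of_nat (2 * n + k)) / fact k * z ^ k)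
        \<le> (K * real (Suc n) ^ N * real (Suc k) ^ N) * \<rho> ^ k"
        unfolding norm_mult[of _ "z ^ k"] norm_power
        by (intro mult_mono KN(2) power_mono z) (use KN(1) in auto)
      thus "norm (pochhammer a (n + k) * pochhammer b (n + k) * rGamma (c + of_nat (2 * n + k)) / fact k * z ^ k)
        \<le> K * real (Suc n) ^ N * (real (Suc k) ^ N * \<rho> ^ k)" by (simp only: mult.assoc)
    qed (intro summable_mult sm)
    also have "\<dots> = K * real (Suc n) ^ N * M"
      unfolding M_def by (intro suminf_mult sm)
    finally show ?thesis by (simp add: mult_ac)
  qed
  moreover have "M \<ge> 0" unfolding M_def by (intro suminf_nonneg sm) (use assms in auto)
  ultimately show ?thesis using that[of "K * M" N] KN(1) by simp
qed

text \<open>As a function of \<open>x\<close> the sum of the series satisfies the hypergeometric equation, because the hypergeometric operator applied to its terms telescopes.\<close>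

lemma burchnall_chaundy:
  fixes a b c x :: complex and y :: real
  assumes c: "\<And>n. c + of_nat (Suc n) \<noteq> 0" and y: "0 < y" "y < 1" and x: "norm x < 1"
  shows "(\<lambda>n. hyp_coeff (c - a) (c - b) c n * (x * of_real y) ^ n *
            hyp_shifted a b c n (of_real y + x * (1 - of_real y))) sums
         (hyp2F1_reg_series a b c x * hyp2F1_reg_series a b c (of_real y))"
proof -
  define Y where "Y = complex_of_real y"
  define q where "q = 1 - Y"
  \<comment> \<open>For fixed y the argument x + y - x y is affine in x with slope \<open>q\<close>,
    so each derivative in x only brings out a factor \<open>q\<close>.\<close>
  define p where "p = (\<lambda>x. Y + x * q)"
  define A where "A = hyp_coeff (c - a) (c - b) c"
  define G0 where "G0 = hyp_shifted a b c"
  define G1 where "G1 = (\<lambda>n z. pochhammer a n * pochhammer b n * ((a + of_nat n) * (b + of_nat n) *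
     hyp2F1_reg_series (a + of_nat n + 1) (b + of_nat n + 1) (c + 2 * of_nat n + 1) z))"
  define G2 where "G2 = (\<lambda>n z. pochhammer a n * pochhammer b n * ((a + of_nat n) * (b + of_nat n) *
     ((a + of_nat n + 1) * (b + of_nat n + 1) *
     hyp2F1_reg_series (a + of_nat n + 2) (b + of_nat n + 2) (c + 2 * of_nat n + 2) z)))"
  have dG0: "(G0 n has_field_derivative G1 n z) (at z)" if "norm z < 1" for n z
    unfolding G0_def G1_def hyp_shifted_def[abs_def] by (intro DERIV_cmult hyp_series_deriv that)
  have dG1: "(G1 n has_field_derivative G2 n z) (at z)" if "norm z < 1" for n z
    unfolding G1_def G2_def
    using hyp_series_deriv[OF that, of "a + of_nat n + 1" "b + of_nat n + 1" "c + 2 * of_nat n + 1"]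
    by (intro DERIV_cmult) (simp add: add.assoc)
  have Gode: "z * (1 - z) * G2 n z + (c + 2 * of_nat n - (a + of_nat n + (b + of_nat n) + 1) * z) * G1 n z
     - (a + of_nat n) * (b + of_nat n) * G0 n z = 0" if "norm z < 1" for n z
  proof -
    have "pochhammer a n * pochhammer b n * (z * (1 - z) * ((a + of_nat n) * (b + of_nat n) * ((a + of_nat n + 1) * (b + of_nat n + 1) * hyp2F1_reg_series (a + of_nat n + 2) (b + of_nat n + 2) (c + 2 * of_nat n + 2) z))
     + (c + 2 * of_nat n - (a + of_nat n + (b + of_nat n) + 1) * z) * ((a + of_nat n) * (b + of_nat n) * hyp2F1_reg_series (a + of_nat n + 1) (b + of_nat n + 1) (c + 2 * of_nat n + 1) z)
     - (a + of_nat n) * (b + of_nat n) * hyp2F1_reg_series (a + of_nat n) (b + of_nat n) (c + 2 * of_nat n) z) = 0"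
      unfolding hyp_series_ode[OF that] by simp
    thus ?thesis unfolding G0_def G1_def G2_def hyp_shifted_def by (simp only: algebra_simps)
  qed
  \<comment> \<open>The contiguous relation expresses the next shifted function by two derivatives
    of the current one; this is why the operator telescopes.\<close>
  have Gcont: "A (Suc n) * (of_nat (Suc n) * (c + of_nat n)) * G0 (Suc n) z =
     A n * ((1 - z) * G2 n z + (c - a - b - 1) * G1 n z)" if "norm z < 1" for n z
  proof -
    define S1 S2 S3 where "S1 = hyp2F1_reg_series (a + of_nat n + 1) (b + of_nat n + 1) (c + 2 * of_nat n + 1) z"
      and "S2 = hyp2F1_reg_series (a + of_nat n + 2) (b + of_nat n + 2) (c + 2 * of_nat n + 2) z"
      and "S3 = hyp2F1_reg_series (a + of_nat n + 1) (b + of_nat n + 1) (c + 2 * of_nat n + 2) z"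
    define P where "P = pochhammer a n * pochhammer b n * ((a + of_nat n) * (b + of_nat n))"
    have e: "a + of_nat n + 1 + 1 = a + of_nat n + 2" "b + of_nat n + 1 + 1 = b + of_nat n + 2"
      "c + 2 * of_nat n + 1 + 1 = c + 2 * of_nat n + 2" by simp_all
    have "(1 - z) * ((a + of_nat n + 1) * (b + of_nat n + 1) * S2) +
      (c + 2 * of_nat n + 1 - (a + of_nat n + 1) - (b + of_nat n + 1)) * S1 =
      (c + 2 * of_nat n + 1 - (a + of_nat n + 1)) * (c + 2 * of_nat n + 1 - (b + of_nat n + 1)) * S3"
      using hyp_series_contiguous[OF that, of "a + of_nat n + 1" "b + of_nat n + 1" "c + 2 * of_nat n + 1"]
      unfolding S1_def S2_def S3_def e .
    hence c1: "(1 - z) * ((a + of_nat n + 1) * (b + of_nat n + 1) * S2) + (c - a - b - 1) * S1 =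
      (c - a + of_nat n) * (c - b + of_nat n) * S3" by (simp add: algebra_simps)
    have "G0 (Suc n) z = P * S3"
      unfolding G0_def hyp_shifted_def P_def S3_def by (simp add: pochhammer_Suc algebra_simps)
    moreover have "A (Suc n) * (of_nat (Suc n) * (c + of_nat n)) = (c - a + of_nat n) * (c - b + of_nat n) * A n"
      using hyp_coeff_Suc[of n c "c - a" "c - b"] unfolding A_def by (simp only: mult_ac)
    moreover have "(1 - z) * G2 n z + (c - a - b - 1) * G1 n z =
       P * ((1 - z) * ((a + of_nat n + 1) * (b + of_nat n + 1) * S2) + (c - a - b - 1) * S1)"
      unfolding G1_def G2_def P_def S1_def S2_def by (simp only: algebra_simps)
    ultimately show ?thesis unfolding c1 by simp
  qed
  have qr: "q = complex_of_real (1 - y)" by (simp add: q_def Y_def)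
  have normY: "norm Y = y" "norm q = 1 - y"
    using y unfolding qr norm_of_real Y_def by simp_all
  \<comment> \<open>For real y between 0 and 1 the norms of \<open>Y\<close> and of the slope add up
    to 1, so \<open>p\<close> maps the unit disc into itself.\<close>
  have norm_p: "norm (p x) \<le> y + r * (1 - y)" if "norm x \<le> r" for x r
  proof -
    have "norm (p x) \<le> norm Y + norm (x * q)" unfolding p_def by (rule norm_triangle_ineq)
    also have "norm (x * q) \<le> r * (1 - y)"
      unfolding norm_mult normY using that y by (intro mult_right_mono) auto
    finally show ?thesis by (simp add: normY)
  qed
  have rho: "y + r * (1 - y) < 1" if "r < 1" for r
  proof -
    have "r * (1 - y) < 1 * (1 - y)" using that y by (intro mult_strict_right_mono) auto
    thus ?thesis by (simp add: algebra_simps)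
  qed
  have p1: "norm (p x) < 1" if "norm x < 1" for x
    using norm_p[of x "norm x"] rho[OF that] by simp
  have dp: "(p has_field_derivative q) (at x)" for x
    unfolding p_def by (auto intro!: derivative_eq_intros)
  have dpow: "((\<lambda>x::complex. x ^ n) has_field_derivative of_nat n * x ^ (n - Suc 0)) (at x)" for n x
    using DERIV_power[OF DERIV_ident[where F = "at x"], of n] by simp
  define u where "u = (\<lambda>n x. A n * Y ^ n * (x ^ n * G0 n (p x)))"
  define u' where "u' = (\<lambda>n x. A n * Y ^ n * (of_nat n * x ^ (n - 1) * G0 n (p x) + x ^ n * (q * G1 n (p x))))"
  define u'' where "u'' = (\<lambda>n x. A n * Y ^ n * (of_nat n * (of_nat (n - 1) * x ^ (n - 2)) * G0 n (p x)
      + 2 * (of_nat n * x ^ (n - 1)) * (q * G1 n (p x)) + x ^ n * (q * (q * G2 n (p x)))))"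
  have du: "(u n has_field_derivative u' n x) (at x)" if "norm x < 1" for n x
  proof -
    have "(u n has_field_derivative A n * Y ^ n *
       (of_nat n * x ^ (n - Suc 0) * G0 n (p x) + G1 n (p x) * q * x ^ n)) (at x)"
      unfolding u_def
      by (intro DERIV_cmult DERIV_mult dpow DERIV_chain2[OF dG0[OF p1[OF that]] dp])
    thus ?thesis unfolding u'_def by (simp add: mult_ac)
  qed
  have du': "(u' n has_field_derivative u'' n x) (at x)" if "norm x < 1" for n x
  proof -
    have "(u' n has_field_derivative A n * Y ^ n *
       ((of_nat n * (of_nat (n - 1) * x ^ (n - 1 - Suc 0))) * G0 n (p x) + G1 n (p x) * q * (of_nat n * x ^ (n - 1))
       + (of_nat n * x ^ (n - Suc 0) * (q * G1 n (p x)) + q * (G2 n (p x) * q) * x ^ n))) (at x)"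
      unfolding u'_def
      by (intro DERIV_cmult DERIV_add DERIV_mult dpow DERIV_chain2[OF dG0[OF p1[OF that]] dp]
          DERIV_chain2[OF dG1[OF p1[OF that]] dp])
    also have "A n * Y ^ n *
       ((of_nat n * (of_nat (n - 1) * x ^ (n - 1 - Suc 0))) * G0 n (p x) + G1 n (p x) * q * (of_nat n * x ^ (n - 1))
       + (of_nat n * x ^ (n - Suc 0) * (q * G1 n (p x)) + q * (G2 n (p x) * q) * x ^ n)) = u'' n x"
      unfolding u''_def by (simp add: algebra_simps numeral_2_eq_2)
    finally show ?thesis .
  qed
  \<comment> \<open>The boundary terms of the telescoping; \<open>T 0\<close> is 0 because of the
    factor n.\<close>
  define T where "T = (\<lambda>n x. A n * (of_nat n * (of_nat n + c - 1)) * Y ^ n * x ^ (n - 1) * G0 n (p x))"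
  define L where "L = (\<lambda>f f' f'' x. x * (1 - x) * f'' x + (c - (a + b + 1) * x) * f' x - a * b * f x)"
  have Lu: "L (u n) (u' n) (u'' n) x = T n x - T (Suc n) x" if x: "norm x < 1" for n x
  proof -
    define g0 g1 g2 where "g0 = G0 n (p x)" and "g1 = G1 n (p x)" and "g2 = G2 n (p x)"
    define N where "N = (of_nat n :: complex)"
    \<comment> \<open>x^n and its first two derivatives; the factors n and n - 1 vanish wherever an
      exponent is truncated.\<close>
    define X where "X = x ^ n"
    define X1 where "X1 = N * x ^ (n - 1)"
    define X2 where "X2 = N * (of_nat (n - 1) * x ^ (n - 2))"
    have X1: "x * X1 = N * X" unfolding X1_def X_def N_def by (cases n) auto
    have X2: "x * X2 = (N - 1) * X1"
    proof (cases n)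
      case (Suc m)
      thus ?thesis unfolding X1_def X2_def N_def by (cases m) auto
    qed (simp add: X1_def X2_def N_def)
    have ode: "p x * (1 - p x) * g2 + (c + 2 * N - (a + N + (b + N) + 1) * p x) * g1 - (a + N) * (b + N) * g0 = 0"
      unfolding g0_def g1_def g2_def N_def by (rule Gode[OF p1[OF x]])
    have px: "p x = Y + x * (1 - Y)" by (simp add: p_def q_def)
    have qY: "q = 1 - Y" by (simp add: q_def)
    have "T (Suc n) x = A (Suc n) * (of_nat (Suc n) * (c + of_nat n)) * G0 (Suc n) (p x) * (Y * Y ^ n * X)"
      unfolding T_def X_def by (simp add: algebra_simps)
    also have "\<dots> = A n * Y ^ n * (Y * X * ((1 - p x) * g2 + (c - a - b - 1) * g1))"
      unfolding Gcont[OF p1[OF x]] g1_def g2_def by simp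
    finally have T1: "T (Suc n) x = \<dots>" .
    have T0: "T n x = A n * Y ^ n * ((N + c - 1) * X1 * g0)"
      unfolding T_def g0_def X1_def N_def by (simp add: mult_ac)
    have "L (u n) (u' n) (u'' n) x = A n * Y ^ n *
      (x * (1 - x) * (X2 * g0 + 2 * X1 * (q * g1) + X * (q * (q * g2))) +
       (c - (a + b + 1) * x) * (X1 * g0 + X * (q * g1)) - a * b * (X * g0))"
      unfolding L_def u_def u'_def u''_def g0_def[symmetric] g1_def[symmetric] g2_def[symmetric]
        X_def[symmetric] N_def[symmetric] X1_def X2_def by (simp add: algebra_simps)
    also have "x * (1 - x) * (X2 * g0 + 2 * X1 * (q * g1) + X * (q * (q * g2))) +
       (c - (a + b + 1) * x) * (X1 * g0 + X * (q * g1)) - a * b * (X * g0) =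
       (N + c - 1) * X1 * g0 - Y * X * ((1 - p x) * g2 + (c - a - b - 1) * g1)"
      using X1 X2 ode px qY by algebra
    finally show ?thesis unfolding T0 T1 by (simp add: algebra_simps)
  qed
  \<comment> \<open>Polynomial growth times y^n dominates the terms on closed discs and also forces
    the boundary terms to 0.\<close>
  have ubound: "\<exists>h. summable h \<and> (\<forall>n. \<forall>x. norm x \<le> r \<longrightarrow> norm (u n x) \<le> h n) \<and>
      (\<forall>x. norm x \<le> r \<longrightarrow> (\<lambda>n. T n x) \<longlonglongrightarrow> 0)" if r: "0 \<le> r" "r < 1" for r
  proof -
    obtain K N where KN: "K \<ge> 0" "\<And>n z. norm z \<le> y + r * (1 - y) \<Longrightarrow> norm (hyp_shifted a b c n z) \<le> K * real (Suc n) ^ N"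
      using hyp_shifted_bound[of "y + r * (1 - y)" a b c] rho[OF r(2)] y r by auto
    obtain K' N' where KN': "K' \<ge> 0" "\<And>n. norm (A n) \<le> K' * real (Suc n) ^ N'"
      unfolding A_def using hyp_coeff_poly_bound by blast
    define h where "h = (\<lambda>n. K * K' * (real (Suc n) ^ (N + N') * y ^ n))"
    have h: "summable h"
      unfolding h_def using y by (intro summable_mult summable_poly_powser) auto
    have AG: "norm (A n * Y ^ n * G0 n (p x)) \<le> h n" if "norm x \<le> r" for n x
    proof -
      have "norm (A n * Y ^ n * G0 n (p x)) \<le> (K' * real (Suc n) ^ N') * y ^ n * (K * real (Suc n) ^ N)"
        unfolding norm_mult norm_power normY G0_def
        using KN' KN y norm_p[OF that] by (intro mult_mono) auto
      thus ?thesis by (simp add: h_def power_add mult_ac)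
    qed
    have "norm (u n x) \<le> h n" if "norm x \<le> r" for n x
    proof -
      have "norm (u n x) = norm (A n * Y ^ n * G0 n (p x)) * norm x ^ n"
        unfolding u_def by (simp add: norm_mult norm_power)
      also have "\<dots> \<le> h n * 1"
        using AG[OF that] that r by (intro mult_mono power_le_one) (auto intro: order_trans[OF norm_ge_zero])
      finally show ?thesis by simp
    qed
    moreover have "(\<lambda>n. T n x) \<longlonglongrightarrow> 0" if xr: "norm x \<le> r" for x
    proof (rule Lim_null_comparison)
      define C where "C = norm c + 2"
      define h2 where "h2 = (\<lambda>n. C * K * K' * (real (Suc n) ^ (N + N' + 2) * y ^ n))"
      have "summable h2" unfolding h2_def using y by (intro summable_mult summable_poly_powser) auto
      thus "h2 \<longlonglongrightarrow> 0" by (rule summable_LIMSEQ_zero)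
      have "norm (T n x) \<le> h2 n" for n
      proof -
        have "norm (of_nat n + c - 1) \<le> real n + norm c + 1"
          by (metis (no_types, lifting) add_mono_thms_linordered_semiring(3) norm_of_nat norm_one norm_triangle_ineq norm_triangle_ineq4 order_trans)
        also have "\<dots> \<le> C * real (Suc n)" unfolding C_def by (simp add: algebra_simps)
        finally have 1: "norm (of_nat n + c - 1) \<le> C * real (Suc n)" .
        have "norm (T n x) = (real n * norm (of_nat n + c - 1) * norm x ^ (n - 1)) * norm (A n * Y ^ n * G0 n (p x))"
          unfolding T_def by (simp add: norm_mult norm_power)
        also have "\<dots> \<le> (real (Suc n) * (C * real (Suc n)) * 1) * h n"
          using 1 AG[OF xr] xr r
          by (intro mult_mono power_le_one mult_nonneg_nonneg) (auto simp: C_def)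
        also have "\<dots> = h2 n" unfolding h_def h2_def by (simp add: power_add power2_eq_square)
        finally show ?thesis .
      qed
      thus "\<forall>\<^sub>F n in sequentially. norm (T n x) \<le> h2 n" by simp
    qed
    ultimately show ?thesis using h by blast
  qed
  define H where "H = (\<lambda>x. \<Sum>n. u n x)"
  have ulim: "uniform_limit (ball 0 r) (\<lambda>N x. \<Sum>n<N. u n x) H sequentially" if r: "r < 1" for r
  proof (cases "r \<ge> 0")
    case True
    then obtain h where h: "summable h" "\<And>n x. norm x \<le> r \<Longrightarrow> norm (u n x) \<le> h n"
      using ubound[of r] r by blast
    show ?thesis unfolding H_def
      by (rule Weierstrass_m_test[OF _ h(1)]) (use h(2) in auto)
  next
    case False
    hence b: "ball (0::complex) r = {}" by simp
    show ?thesis unfolding b uniform_limit_iff by simp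
  qed
  have uhol: "u n holomorphic_on ball 0 1" for n
    unfolding holomorphic_on_open[OF open_ball] using du[of _ n]
    by (metis dist_0_norm mem_ball)
  have sum_hol: "(\<lambda>x. \<Sum>n<N. u n x) holomorphic_on ball 0 1" for N
    by (intro holomorphic_on_sum uhol)
  have dsum: "deriv (\<lambda>x. \<Sum>n<N. u n x) x = (\<Sum>n<N. u' n x)" if "norm x < 1" for N x
    by (intro DERIV_imp_deriv DERIV_sum du that)
  have dsum2: "deriv (deriv (\<lambda>x. \<Sum>n<N. u n x)) x = (\<Sum>n<N. u'' n x)" if "norm x < 1" for N x
  proof -
    have "eventually (\<lambda>x. x \<in> ball (0::complex) 1) (nhds x)"
      using that by (intro eventually_nhds_in_open) auto
    hence "deriv (deriv (\<lambda>x. \<Sum>n<N. u n x)) x = deriv (\<lambda>x. \<Sum>n<N. u' n x) x"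
      by (intro deriv_cong_ev) (auto elim!: eventually_mono simp: dsum)
    also have "\<dots> = (\<Sum>n<N. u'' n x)" by (intro DERIV_imp_deriv DERIV_sum du' that)
    finally show ?thesis .
  qed
  have lims: "(\<lambda>N. \<Sum>n<N. u n x) \<longlonglongrightarrow> H x" "(\<lambda>N. \<Sum>n<N. u' n x) \<longlonglongrightarrow> deriv H x"
    "(\<lambda>N. \<Sum>n<N. u'' n x) \<longlonglongrightarrow> deriv (deriv H) x" if x: "norm x < 1" for x
  proof -
    obtain r where r: "norm x < r" "r < 1" using x dense by blast
    have hol: "eventually (\<lambda>N. (\<lambda>x. \<Sum>n<N. u n x) holomorphic_on ball 0 r) sequentially"
      using r by (intro always_eventually allI holomorphic_on_subset[OF sum_hol]) auto
    have xr: "x \<in> ball 0 r" using r by simp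
    note lim = higher_deriv_complex_uniform_limit[OF ulim[OF r(2)] hol sequentially_bot open_ball xr]
    show "(\<lambda>N. \<Sum>n<N. u n x) \<longlonglongrightarrow> H x" using lim[of 0] by simp
    show "(\<lambda>N. \<Sum>n<N. u' n x) \<longlonglongrightarrow> deriv H x" using lim[of 1] by (simp add: dsum x)
    show "(\<lambda>N. \<Sum>n<N. u'' n x) \<longlonglongrightarrow> deriv (deriv H) x" using lim[of 2] by (simp add: dsum2 x numeral_2_eq_2)
  qed
  have Hhol: "H holomorphic_on ball 0 1"
  proof (rule holomorphic_uniform_sequence[of "ball 0 1" "\<lambda>N x. \<Sum>n<N. u n x"])
    fix x :: complex assume "x \<in> ball 0 1"
    then obtain r where r: "norm x < r" "r < 1" using dense by auto
    define d where "d = (r - norm x) / 2"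
    have d: "d > 0" using r by (simp add: d_def)
    have sub: "cball x d \<subseteq> ball 0 r"
    proof
      fix z assume "z \<in> cball x d"
      hence "norm (z - x) \<le> d" by (simp add: dist_norm norm_minus_commute)
      moreover have "norm z \<le> norm (z - x) + norm x" by (metis norm_triangle_sub add.commute)
      ultimately show "z \<in> ball 0 r" using r by (simp add: d_def field_simps)
    qed
    have "uniform_limit (cball x d) (\<lambda>N x. \<Sum>n<N. u n x) H sequentially"
      by (rule uniform_limit_on_subset[OF ulim[OF r(2)] sub])
    moreover have "cball x d \<subseteq> ball 0 1" using sub r by auto
    ultimately show "\<exists>d>0. cball x d \<subseteq> ball 0 1 \<and> uniform_limit (cball x d) (\<lambda>N x. \<Sum>n<N. u n x) H sequentially"
      using d by blast
  qed (use sum_hol in auto)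
  have dH: "(H has_field_derivative deriv H x) (at x)" "(deriv H has_field_derivative deriv (deriv H) x) (at x)"
    if "norm x < 1" for x
  proof -
    show "(H has_field_derivative deriv H x) (at x)"
      using that by (intro holomorphic_derivI[OF Hhol]) auto
    show "(deriv H has_field_derivative deriv (deriv H) x) (at x)"
      using that by (intro holomorphic_derivI[OF holomorphic_deriv[OF Hhol]]) auto
  qed
  \<comment> \<open>On the partial sum of the first N terms the operator gives -
    \<open>T N x\<close>, so the equation for \<open>H\<close> results in the limit.\<close>
  have Hode: "x * (1 - x) * deriv (deriv H) x + (c - (a + b + 1) * x) * deriv H x - a * b * H x = 0"
    if x: "norm x < 1" for x
  proof -
    have "(\<lambda>N. x * (1 - x) * (\<Sum>n<N. u'' n x) + (c - (a + b + 1) * x) * (\<Sum>n<N. u' n x) - a * b * (\<Sum>n<N. u n x))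
      \<longlonglongrightarrow> x * (1 - x) * deriv (deriv H) x + (c - (a + b + 1) * x) * deriv H x - a * b * H x"
      by (intro tendsto_intros lims x)
    moreover have "x * (1 - x) * (\<Sum>n<N. u'' n x) + (c - (a + b + 1) * x) * (\<Sum>n<N. u' n x) - a * b * (\<Sum>n<N. u n x) = - T N x" for N
    proof -
      have "x * (1 - x) * (\<Sum>n<N. u'' n x) + (c - (a + b + 1) * x) * (\<Sum>n<N. u' n x) - a * b * (\<Sum>n<N. u n x) =
         (\<Sum>n<N. L (u n) (u' n) (u'' n) x)"
        unfolding L_def by (simp only: sum_distrib_left sum.distrib sum_subtractf)
      also have "\<dots> = (\<Sum>n<N. T n x - T (Suc n) x)" by (simp only: Lu[OF x])
      also have "\<dots> = T 0 x - T N x" by (rule sum_lessThan_telescope')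
      finally show ?thesis by (simp add: T_def)
    qed
    moreover have "(\<lambda>N. - T N x) \<longlonglongrightarrow> - 0"
      using ubound[of "norm x"] x by (intro tendsto_minus) auto
    ultimately show ?thesis using LIMSEQ_unique by fastforce
  qed
  define s where "s = hyp2F1_reg_series a b c Y"
  have Y1: "norm Y < 1" using normY y by simp
  have "(\<lambda>n. hyp_coeff a b c n * s * x ^ n) sums H x"
  proof (rule hypergeometric_ode_sums[where r = 1 and f' = "deriv H" and f'' = "deriv (deriv H)" and a = a and b = b and c = c])
    have u0: "u n 0 = 0" if "n > 0" for n using that by (simp add: u_def)
    have "(\<lambda>n. u n 0) sums (\<Sum>n\<in>{0}. u n 0)" by (rule sums_finite) (auto intro: u0)
    hence "H 0 = u 0 0" unfolding H_def by (simp add: sums_iff)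
    also have "\<dots> = rGamma c * s" by (simp add: u_def A_def G0_def hyp_shifted_def p_def s_def)
    finally show "hyp_coeff a b c 0 * s = H 0" by simp
    \<comment> \<open>At x = 0 the terms 0 and 1 are the only ones contributing to the
      derivative.\<close>
    have u0': "u' n 0 = 0" if "n \<notin> {0, 1}" for n using that by (simp add: u'_def power_0_left)
    have "(\<lambda>n. u' n 0) sums (\<Sum>n\<in>{0, 1}. u' n 0)" by (rule sums_finite) (auto intro: u0')
    moreover have "(\<lambda>n. u' n 0) sums deriv H 0" using lims(2)[of 0] by (simp add: sums_def)
    ultimately have "deriv H 0 = u' 0 0 + u' 1 0" using sums_unique2 by fastforce
    also have "\<dots> = A 0 * (q * G1 0 Y) + A 1 * Y * G0 1 Y"
      by (simp add: u'_def p_def)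
    also have "A 0 = c * rGamma (c + 1)" by (simp add: A_def rGamma_plus1)
    also have "A 1 * Y * G0 1 Y = rGamma (c + 1) * (Y * ((1 - Y) * G2 0 Y + (c - a - b - 1) * G1 0 Y))"
    proof -
      define S1 S2 S3 where "S1 = hyp2F1_reg_series (a + 1) (b + 1) (c + 1) Y"
        and "S2 = hyp2F1_reg_series (a + 2) (b + 2) (c + 2) Y"
        and "S3 = hyp2F1_reg_series (a + 1) (b + 1) (c + 2) Y"
      have "(1 - Y) * ((a + 1) * (b + 1) * S2) + (c + 1 - (a + 1) - (b + 1)) * S1 =
        (c + 1 - (a + 1)) * (c + 1 - (b + 1)) * S3"
        using hyp_series_contiguous[OF Y1, of "a + 1" "b + 1" "c + 1"]
        by (simp only: S1_def S2_def S3_def add.assoc one_add_one)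
      hence e: "(1 - Y) * ((a + 1) * (b + 1) * S2) + (c - a - b - 1) * S1 = (c - a) * (c - b) * S3"
        by (simp add: algebra_simps)
      have g: "G0 1 Y = a * b * S3" "G1 0 Y = a * b * S1" "G2 0 Y = a * b * ((a + 1) * (b + 1) * S2)"
        by (simp_all add: G0_def hyp_shifted_def G1_def G2_def S1_def S2_def S3_def)
      have "(1 - Y) * G2 0 Y + (c - a - b - 1) * G1 0 Y = (c - a) * (c - b) * G0 1 Y"
        unfolding g using e by algebra
      moreover have "A 1 = (c - a) * (c - b) * rGamma (c + 1)" by (simp add: A_def hyp_coeff_1)
      ultimately show ?thesis by simp
    qed
    \<comment> \<open>The hypergeometric equation at the point \<open>Y\<close> collects both
      contributions into a b F(a, b; c; Y), as the product requires.\<close>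
    also have "c * rGamma (c + 1) * (q * G1 0 Y) + rGamma (c + 1) * (Y * ((1 - Y) * G2 0 Y + (c - a - b - 1) * G1 0 Y))
       = rGamma (c + 1) * (a * b * G0 0 Y)"
    proof -
      have "Y * (1 - Y) * G2 0 Y + (c - (a + b + 1) * Y) * G1 0 Y - a * b * G0 0 Y = 0"
        using Gode[OF Y1, of 0] by simp
      hence G0Y: "a * b * G0 0 Y = c * (q * G1 0 Y) + Y * ((1 - Y) * G2 0 Y + (c - a - b - 1) * G1 0 Y)"
        unfolding q_def by algebra
      show ?thesis unfolding G0Y by (simp only: distrib_left mult.assoc mult.left_commute[of c])
    qed
    finally have "deriv H 0 = rGamma (c + 1) * (a * b * G0 0 Y)" .
    thus "hyp_coeff a b c (Suc 0) * s = deriv H 0"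
      by (simp add: hyp_coeff_1 s_def G0_def hyp_shifted_def)
    show "of_nat (Suc n) * (c + of_nat n) * (hyp_coeff a b c (Suc n) * s) =
       (a + of_nat n) * (b + of_nat n) * (hyp_coeff a b c n * s)" for n
      using hyp_coeff_Suc[of n c a b] by (metis mult.assoc)
    show "x \<in> ball 0 1" using x by simp
  qed (use dH Hode c in auto)
  moreover have "(\<lambda>n. hyp_coeff a b c n * x ^ n * s) sums (hyp2F1_reg_series a b c x * s)"
    by (intro sums_mult2 hyp_series_sums x)
  hence "(\<lambda>n. hyp_coeff a b c n * s * x ^ n) sums (hyp2F1_reg_series a b c x * s)"
    by (simp add: mult_ac)
  ultimately have "H x = hyp2F1_reg_series a b c x * s" by (rule sums_unique2)
  moreover have "(\<lambda>n. u n x) sums H x" using lims(1)[OF x] by (simp add: sums_def)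
  moreover have "u n x = hyp_coeff (c - a) (c - b) c n * (x * of_real y) ^ n *
            hyp_shifted a b c n (of_real y + x * (1 - of_real y))" for n
    unfolding u_def A_def G0_def p_def q_def Y_def by (simp add: power_mult_distrib)
  ultimately show ?thesis by (simp add: s_def Y_def)
qed

subsection \<open>The kernel integral\<close>

text \<open>Legendre's duplication for the entire reciprocal: where a factor on the left vanishes, 2
  z is a nonpositive integer and the right-hand side vanishes, too.\<close>

lemma rGamma_duplication:
  fixes z :: complex
  shows "rGamma z * rGamma (z + 1 / 2) = 2 powr (2 * z - 1) / of_real (sqrt pi) * rGamma (2 * z)"
proof (cases "z \<in> \<int>\<^sub>\<le>\<^sub>0 \<or> z + 1 / 2 \<in> \<int>\<^sub>\<le>\<^sub>0")
  case True
  have "2 * z \<in> \<int>\<^sub>\<le>\<^sub>0"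
  proof (cases "z \<in> \<int>\<^sub>\<le>\<^sub>0")
    case True
    then obtain n where "z = - of_nat n" by (auto elim!: nonpos_Ints_cases')
    hence "2 * z = - of_nat (2 * n)" by simp
    thus ?thesis by (metis minus_of_nat_in_nonpos_Ints)
  next
    case False
    with True obtain n where "z + 1 / 2 = - of_nat n" by (auto elim!: nonpos_Ints_cases')
    hence "z = - of_nat n - 1 / 2" by (simp add: eq_diff_eq)
    hence "2 * z = - of_nat (2 * n + 1)" by simp
    thus ?thesis by (metis minus_of_nat_in_nonpos_Ints)
  qed
  hence "rGamma (2 * z) = 0" by (simp add: rGamma_eq_zero_iff)
  moreover have "rGamma z * rGamma (z + 1 / 2) = 0" using True by (auto simp: rGamma_eq_zero_iff)
  ultimately show ?thesis by simp
next
  case False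
  have G: "Gamma z * Gamma (z + 1 / 2) = exp ((1 - 2 * z) * of_real (ln 2)) * of_real (sqrt pi) * Gamma (2 * z)"
    using False by (intro Gamma_legendre_duplication) auto
  have nz: "Gamma z \<noteq> 0" "Gamma (z + 1 / 2) \<noteq> 0" using False by (auto simp: Gamma_eq_zero_iff)
  have "exp ((1 - 2 * z) * of_real (ln 2)) = inverse (2 powr (2 * z - 1))"
    by (simp add: powr_def exp_minus[symmetric] Ln_of_real[of 2, simplified] algebra_simps)
  hence "inverse (Gamma z * Gamma (z + 1 / 2)) = 2 powr (2 * z - 1) / of_real (sqrt pi) * inverse (Gamma (2 * z))"
    unfolding G by (simp add: inverse_eq_divide)
  thus ?thesis by (simp add: rGamma_inverse_Gamma)
qed

lemma absolutely_integrable_mult_bounded: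
  fixes g K :: "real \<Rightarrow> complex"
  assumes K: "K absolutely_integrable_on {0<..<1}" and g: "continuous_on {0<..<1} g"
    and bound: "\<And>r. r \<in> {0<..<1} \<Longrightarrow> norm (g r) \<le> M"
  shows "(\<lambda>r. g r * K r) absolutely_integrable_on {0<..<1}"
proof (rule absolutely_integrable_bounded_measurable_product[OF bilinear_times _ _ _ K])
  show "g \<in> borel_measurable (lebesgue_on {0<..<1})"
    by (intro continuous_imp_measurable_on_sets_lebesgue g) auto
  show "bounded (g ` {0<..<1})" using bound unfolding bounded_iff by (intro exI[of _ M]) auto
qed auto

text \<open>A Weierstrass test with integrable weight: the integrals of the norms are at most
  \<open>M k\<close> times the integral of the norm of \<open>K\<close>.\<close>

lemma integral_series_weight:
  fixes g :: "nat \<Rightarrow> real \<Rightarrow> complex"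
  assumes K: "K absolutely_integrable_on {0<..<1}" and g: "\<And>k. continuous_on {0<..<1} (g k)"
    and bound: "\<And>k r. r \<in> {0<..<1} \<Longrightarrow> norm (g k r) \<le> M k" and M: "summable M"
  shows "(\<lambda>r. (\<Sum>k. g k r) * K r) absolutely_integrable_on {0<..<1}"
    and "(\<lambda>k. integral {0<..<1} (\<lambda>r. g k r * K r)) sums integral {0<..<1} (\<lambda>r. (\<Sum>k. g k r) * K r)"
proof -
  have fi: "(\<lambda>r. g k r * K r) absolutely_integrable_on {0<..<1}" for k
    by (rule absolutely_integrable_mult_bounded[OF K g bound])
  have gs: "summable (\<lambda>k. norm (g k r))" if "r \<in> {0<..<1}" for r
    by (rule summable_comparison_test'[OF M, of 0]) (use bound that in auto)
  have fs: "summable (\<lambda>k. norm (g k r * K r))" if "r \<in> {0<..<1}" for r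
    unfolding norm_mult by (intro summable_mult2 gs that)
  have nK: "(\<lambda>r. norm (K r)) integrable_on {0<..<1}"
    using K by (simp add: absolutely_integrable_on_def)
  have sn: "summable (\<lambda>k. integral {0<..<1} (\<lambda>r. norm (g k r * K r)))"
  proof (rule summable_comparison_test'[where N = 0])
    show "summable (\<lambda>k. M k * integral {0<..<1} (\<lambda>r. norm (K r)))" by (intro summable_mult2 M)
    fix k
    have i: "(\<lambda>r. norm (g k r * K r)) integrable_on {0<..<1}"
      using fi[of k] unfolding absolutely_integrable_on_def by blast
    have "integral {0<..<1} (\<lambda>r. norm (g k r * K r)) \<le> integral {0<..<1} (\<lambda>r. M k * norm (K r))"
      by (rule integral_le[OF i]) (use nK bound in \<open>auto simp: norm_mult intro!: mult_right_mono integrable_on_mult_right\<close>)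
    moreover have "integral {0<..<1} (\<lambda>r. norm (g k r * K r)) \<ge> 0"
      by (intro integral_nonneg i) auto
    ultimately show "norm (integral {0<..<1} (\<lambda>r. norm (g k r * K r))) \<le> M k * integral {0<..<1} (\<lambda>r. norm (K r))"
      by simp
  qed
  have eq: "(\<Sum>k. g k r * K r) = (\<Sum>k. g k r) * K r" if "r \<in> {0<..<1}" for r
    by (rule suminf_mult2[OF summable_norm_cancel[OF gs[OF that]], symmetric])
  have "(\<lambda>r. \<Sum>k. g k r * K r) absolutely_integrable_on {0<..<1}"
    by (rule absolutely_integrable_suminf(1)[OF fi fs sn])
  thus "(\<lambda>r. (\<Sum>k. g k r) * K r) absolutely_integrable_on {0<..<1}"
    by (rule absolutely_integrable_spike[where S = "{}"]) (auto simp: eq)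
  have "(\<lambda>k. integral {0<..<1} (\<lambda>r. g k r * K r)) sums integral {0<..<1} (\<lambda>r. \<Sum>k. g k r * K r)"
    by (rule absolutely_integrable_suminf(2)[OF fi fs sn])
  also have "integral {0<..<1} (\<lambda>r. \<Sum>k. g k r * K r) = integral {0<..<1} (\<lambda>r. (\<Sum>k. g k r) * K r)"
    by (intro integral_cong eq)
  finally show "(\<lambda>k. integral {0<..<1} (\<lambda>r. g k r * K r)) sums integral {0<..<1} (\<lambda>r. (\<Sum>k. g k r) * K r)" .
qed

text \<open>The kernel of the product formula in the variable \<open>r = 1 / C^2\<close>.\<close>

definition product_kernel :: "complex \<Rightarrow> complex \<Rightarrow> complex \<Rightarrow> real \<Rightarrow> complex" where
  "product_kernel a b c r = beta_kernel a (c - a - b + 1 / 2) r *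
     hyp2F1_reg_series (c / 2 - b) (c / 2 - b + 1 / 2) (c - a - b + 1 / 2) (of_real (1 - r))"

text \<open>The upper parameters of the kernel differ by 1/2, so Gauss's theorem returns two
  reciprocal Gamma values half a unit apart, which duplication merges into one at c + 2 m. This is
  the origin of the lower parameters c + 2 n in the final sum.\<close>

lemma product_kernel_moment:
  assumes a: "Re a > 0" and b: "Re b > 0" and c: "Re (c - a - b) > -1 / 2"
  shows "(\<lambda>r. of_real r ^ m * product_kernel a b c r) absolutely_integrable_on {0<..<1}"
    and "integral {0<..<1} (\<lambda>r. of_real r ^ m * product_kernel a b c r) =
      2 powr (c + 2 * of_nat m - 1) / of_real (sqrt pi) *
      (Gamma (a + of_nat m) * Gamma (b + of_nat m) * rGamma (c + 2 * of_nat m))"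
proof -
  define A where "A = c / 2 - b"
  define c0 where "c0 = c - a - b + 1 / 2"
  define s where "s = a + of_nat m"
  have eq: "of_real r ^ m * product_kernel a b c r = beta_kernel s c0 r * hyp2F1_reg_series A (A + 1 / 2) c0 (of_real (1 - r))"
    if "r \<in> {0<..<1}" for r
  proof -
    have "of_real r powr (s - 1) = (of_real r powr ((a - 1) + of_nat m) :: complex)"
      by (simp add: s_def algebra_simps)
    also have "\<dots> = of_real r powr (a - 1) * of_real r ^ m"
      using that by (simp add: powr_add powr_nat)
    finally show ?thesis
      by (simp add: product_kernel_def beta_kernel_def A_def c0_def mult_ac)
  qed
  \<comment> \<open>The last two conditions amount to Re (c - a - b) > -1/2 and Re (b + m) >
    0.\<close>
  have h: "Re s > 0" "Re c0 > 0" "Re (s + c0 - A - (A + 1 / 2)) > 0"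
    using a b c by (simp_all add: s_def c0_def A_def)
  note I = integral_hyp_series_beta[OF h]
  show "(\<lambda>r. of_real r ^ m * product_kernel a b c r) absolutely_integrable_on {0<..<1}"
    using I(1) by (rule absolutely_integrable_spike[where S = "{}"]) (auto simp: eq)
  have "integral {0<..<1} (\<lambda>r. of_real r ^ m * product_kernel a b c r) =
    integral {0<..<1} (\<lambda>r. beta_kernel s c0 r * hyp2F1_reg_series A (A + 1 / 2) c0 (of_real (1 - r)))"
    by (intro integral_cong eq)
  also note I(2)
  also have "Gamma s * Gamma (s + c0 - A - (A + 1 / 2)) * rGamma (s + c0 - A) * rGamma (s + c0 - (A + 1 / 2)) =
    Gamma s * Gamma (s + c0 - A - (A + 1 / 2)) * (rGamma (s + c0 - (A + 1 / 2)) * rGamma (s + c0 - (A + 1 / 2) + 1 / 2))"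
  proof -
    have "s + c0 - A = s + c0 - (A + 1 / 2) + 1 / 2" by simp
    thus ?thesis by (simp only: mult_ac)
  qed
  also note rGamma_duplication
  also have "s + c0 - A - (A + 1 / 2) = b + of_nat m"
    unfolding s_def c0_def A_def by (simp add: field_simps)
  also have "2 * (s + c0 - (A + 1 / 2)) = c + 2 * of_nat m"
    unfolding s_def c0_def A_def by (simp add: field_simps)
  finally show "integral {0<..<1} (\<lambda>r. of_real r ^ m * product_kernel a b c r) =
      2 powr (c + 2 * of_nat m - 1) / of_real (sqrt pi) *
      (Gamma (a + of_nat m) * Gamma (b + of_nat m) * rGamma (c + 2 * of_nat m))"
    by (simp add: s_def mult_ac)
qed

lemma pochhammer_times_Gamma:
  fixes a :: complex
  assumes "Re a > 0"
  shows "Gamma (a + of_nat n) = pochhammer a n * Gamma a"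
proof -
  have "a \<notin> \<int>\<^sub>\<le>\<^sub>0" using assms by (auto elim!: nonpos_Ints_cases')
  thus ?thesis using pochhammer_Gamma[of a n] by (simp add: Gamma_eq_zero_iff)
qed

text \<open>The root power is expanded in powers of p r and integrated termwise; the moments turn
  its coefficients into those of \<open>hyp_shifted\<close>.\<close>

lemma product_kernel_weighted:
  fixes p :: real
  assumes a: "Re a > 0" and b: "Re b > 0" and c: "Re (c - a - b) > -1 / 2" and p: "0 \<le> p" "p < 1"
  shows "integral {0<..<1} (\<lambda>r. of_real r ^ n *
      ((1 + of_real (sqrt (1 - p * r))) powr (- (c - 1 + 2 * of_nat n)) / of_real (sqrt (1 - p * r))) * product_kernel a b c r)
    = Gamma a * Gamma b / of_real (sqrt pi) * hyp_shifted a b c n (of_real p)"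
proof -
  define s where "s = c - 1 + 2 * of_nat n"
  define K where "K = product_kernel a b c"
  have K: "K absolutely_integrable_on {0<..<1}"
    using product_kernel_moment(1)[OF a b c, of 0] unfolding K_def by simp
  have Rec: "Re c > -1 / 2" using a b c by simp
  have s: "s + 1 + of_nat (Suc k) \<noteq> 0" for k
  proof -
    have "Re (s + 1 + of_nat (Suc k)) > 0" using Rec by (simp add: s_def)
    thus ?thesis by (metis zero_complex.sel(1) less_irrefl)
  qed
  define g where "g = (\<lambda>k r. sqrt_power_coeff s k * of_real p ^ k * of_real r ^ (n + k))"
  define M where "M = (\<lambda>k. norm (sqrt_power_coeff s k * of_real p ^ k))"
  have gsum: "(\<lambda>k. g k r) sums (of_real r ^ n * ((1 + of_real (sqrt (1 - p * r))) powr (- s) / of_real (sqrt (1 - p * r))))"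
    if r: "r \<in> {0<..<1}" for r
  proof -
    have "p * r \<le> p * 1" "0 \<le> p * r" using p r by (intro mult_left_mono mult_nonneg_nonneg; simp)+
    hence pr: "\<bar>p * r\<bar> < 1" using p by simp
    have "norm (of_real (p * r) :: complex) < 1" using pr by (simp only: norm_of_real)
    from sqrt_power_sums[OF s this]
    have "(\<lambda>k. sqrt_power_coeff s k * of_real (p * r) ^ k) sums ((1 + csqrt (of_real (1 - p * r))) powr (- s) / csqrt (of_real (1 - p * r)))"
      by simp
    moreover have "csqrt (of_real (1 - p * r)) = of_real (sqrt (1 - p * r))"
      using pr by (intro csqrt_of_real) auto
    ultimately have "(\<lambda>k. of_real r ^ n * (sqrt_power_coeff s k * of_real (p * r) ^ k)) sums
       (of_real r ^ n * ((1 + of_real (sqrt (1 - p * r))) powr (- s) / of_real (sqrt (1 - p * r))))"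
      by (intro sums_mult) (simp only:)
    thus ?thesis by (simp add: g_def power_add power_mult_distrib mult_ac)
  qed
  have M: "summable M"
  proof -
    \<comment> \<open>Convergence at a point beyond p gives absolute convergence at p, which
      dominates the terms for all r.\<close>
    obtain q where q: "p < q" "q < 1" using p dense by blast
    have "norm (of_real q :: complex) < 1" using p q by simp
    from sums_summable[OF sqrt_power_sums[OF s this]]
    show ?thesis unfolding M_def
      by (rule powser_insidea) (use p q in simp)
  qed
  have bound: "norm (g k r) \<le> M k" if "r \<in> {0<..<1}" for k r
  proof -
    have "norm (g k r) = M k * r ^ (n + k)"
      unfolding g_def M_def using that by (simp add: norm_mult norm_power)
    also have "\<dots> \<le> M k * 1" using that by (intro mult_left_mono power_le_one) (auto simp: M_def)
    finally show ?thesis by simp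
  qed
  have cont: "continuous_on {0<..<1} (g k)" for k unfolding g_def by (intro continuous_intros)
  have "(\<lambda>k. integral {0<..<1} (\<lambda>r. g k r * K r)) sums integral {0<..<1} (\<lambda>r. (\<Sum>k. g k r) * K r)"
    by (rule integral_series_weight(2)[OF K cont bound M])
  also have "(\<lambda>k. integral {0<..<1} (\<lambda>r. g k r * K r)) =
    (\<lambda>k. Gamma a * Gamma b / of_real (sqrt pi) *
      (pochhammer a (n + k) * pochhammer b (n + k) * rGamma (c + of_nat (2 * n + k)) / fact k * of_real p ^ k))"
  proof
    fix k
    have "integral {0<..<1} (\<lambda>r. g k r * K r) =
      sqrt_power_coeff s k * of_real p ^ k * integral {0<..<1} (\<lambda>r. of_real r ^ (n + k) * K r)"
      unfolding g_def mult.assoc by (simp only: integral_mult_right)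
    also have "integral {0<..<1} (\<lambda>r. of_real r ^ (n + k) * K r) =
      2 powr (c + 2 * of_nat (n + k) - 1) / of_real (sqrt pi) *
      (Gamma (a + of_nat (n + k)) * Gamma (b + of_nat (n + k)) * rGamma (c + 2 * of_nat (n + k)))"
      unfolding K_def by (rule product_kernel_moment(2)[OF a b c])
    also have "Gamma (a + of_nat (n + k)) = pochhammer a (n + k) * Gamma a" by (rule pochhammer_times_Gamma[OF a])
    also have "Gamma (b + of_nat (n + k)) = pochhammer b (n + k) * Gamma b" by (rule pochhammer_times_Gamma[OF b])
    also have "sqrt_power_coeff s k * of_real p ^ k * (2 powr (c + 2 * of_nat (n + k) - 1) / of_real (sqrt pi) *
       (pochhammer a (n + k) * Gamma a * (pochhammer b (n + k) * Gamma b) * rGamma (c + 2 * of_nat (n + k)))) =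
       Gamma a * Gamma b / of_real (sqrt pi) * (pochhammer a (n + k) * pochhammer b (n + k) *
       (pochhammer (s + 1 + of_nat k) k * rGamma (c + 2 * of_nat (n + k))) / fact k * of_real p ^ k) *
       (2 powr (- s) * 2 powr (c + 2 * of_nat (n + k) - 1) / 4 ^ k)"
      unfolding sqrt_power_coeff_def by (simp add: mult_ac)
    \<comment> \<open>As s + 1 = c + 2n, this symbol lowers the reciprocal Gamma value of the moment
      from c + 2n + 2k to c + 2n + k.\<close>
    also have "pochhammer (s + 1 + of_nat k) k * rGamma (c + 2 * of_nat (n + k)) = rGamma (c + of_nat (2 * n + k))"
      using pochhammer_rGamma[of "c + of_nat (2 * n + k)" k] by (simp add: s_def algebra_simps)
    \<comment> \<open>Coefficient and moment together leave 2^(2k), which the 4^k in the coefficient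
      cancels.\<close>
    also have "2 powr (- s) * 2 powr (c + 2 * of_nat (n + k) - 1) / 4 ^ k = (1 :: complex)"
    proof -
      have "2 powr (- s) * 2 powr (c + 2 * of_nat (n + k) - 1) = (2 powr (of_nat (2 * k)) :: complex)"
        unfolding powr_add[symmetric] by (rule arg_cong[of _ _ "\<lambda>t. 2 powr t"]) (simp add: s_def algebra_simps)
      also have "\<dots> = 4 ^ k" by (subst powr_nat) (simp add: power_mult)
      finally show ?thesis by simp
    qed
    finally show "integral {0<..<1} (\<lambda>r. g k r * K r) = Gamma a * Gamma b / of_real (sqrt pi) *
      (pochhammer a (n + k) * pochhammer b (n + k) * rGamma (c + of_nat (2 * n + k)) / fact k * of_real p ^ k)"
      by simp
  qed
  finally have "(\<lambda>k. Gamma a * Gamma b / of_real (sqrt pi) *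
      (pochhammer a (n + k) * pochhammer b (n + k) * rGamma (c + of_nat (2 * n + k)) / fact k * of_real p ^ k))
      sums integral {0<..<1} (\<lambda>r. (\<Sum>k. g k r) * K r)" .
  moreover have "(\<lambda>k. Gamma a * Gamma b / of_real (sqrt pi) *
      (pochhammer a (n + k) * pochhammer b (n + k) * rGamma (c + of_nat (2 * n + k)) / fact k * of_real p ^ k))
      sums (Gamma a * Gamma b / of_real (sqrt pi) * hyp_shifted a b c n (of_real p))"
    using p by (intro sums_mult hyp_shifted_sums) auto
  ultimately have "integral {0<..<1} (\<lambda>r. (\<Sum>k. g k r) * K r) =
     Gamma a * Gamma b / of_real (sqrt pi) * hyp_shifted a b c n (of_real p)" by (rule sums_unique2)
  also have "integral {0<..<1} (\<lambda>r. (\<Sum>k. g k r) * K r) = integral {0<..<1} (\<lambda>r. of_real r ^ n *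
      ((1 + of_real (sqrt (1 - p * r))) powr (- s) / of_real (sqrt (1 - p * r))) * K r)"
  proof (intro integral_cong)
    fix r :: real assume r: "r \<in> {0<..<1}"
    show "(\<Sum>k. g k r) * K r = of_real r ^ n * ((1 + of_real (sqrt (1 - p * r))) powr (- s) / of_real (sqrt (1 - p * r))) * K r"
      using gsum[OF r] by (simp only: sums_iff)
  qed
  finally show ?thesis unfolding s_def K_def .
qed

text \<open>The n-th term of the series in \<open>W\<close> carries (1 + R)^(1 - c - 2n) / R, the
  weight of \<open>product_kernel_weighted\<close>; after integration the sum over n is the
  expansion \<open>burchnall_chaundy\<close>.\<close>

lemma product_kernel_integral:
  fixes a b c :: complex and x y :: real
  defines "p \<equiv> x + y - x * y"
  defines "R \<equiv> (\<lambda>r. sqrt (1 - p * r))"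
  defines "W \<equiv> (\<lambda>r. (1 + of_real (R r)) powr (1 - c) / of_real (R r) *
     hyp2F1_reg_series (c - a) (c - b) c (of_real (x * y * r / (1 + R r)\<^sup>2)))"
  assumes a: "Re a > 0" and b: "Re b > 0" and c: "Re (c - a - b) > -1 / 2"
    and x: "0 < x" "x < 1" and y: "0 < y" "y < 1"
  shows "(\<lambda>r. W r * product_kernel a b c r) absolutely_integrable_on {0<..<1}"
    and "integral {0<..<1} (\<lambda>r. W r * product_kernel a b c r) =
      Gamma a * Gamma b / of_real (sqrt pi) *
      (hyp2F1_reg_series a b c (of_real x) * hyp2F1_reg_series a b c (of_real y))"
proof -
  define K where "K = product_kernel a b c"
  have K: "K absolutely_integrable_on {0<..<1}"
    using product_kernel_moment(1)[OF a b c, of 0] unfolding K_def by simp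
  have Rec: "Re c > -1 / 2" using a b c by simp
  have cS: "c + of_nat (Suc k) \<noteq> 0" for k
  proof -
    have "Re (c + of_nat (Suc k)) > 0" using Rec by simp
    thus ?thesis by (metis zero_complex.sel(1) less_irrefl)
  qed
  have p1: "1 - p = (1 - x) * (1 - y)" by (simp add: p_def algebra_simps)
  hence "1 - p > 0" using x y by simp
  moreover have p2: "p = x + y * (1 - x)" by (simp add: p_def algebra_simps)
  have "p > 0" unfolding p2 using x y by (intro add_pos_pos mult_pos_pos) auto
  ultimately have p: "0 < p" "p < 1" by auto
  have pr: "0 < p * r" "p * r < p" if "r \<in> {0<..<1}" for r
    using that p by auto
  have R: "R r > 0" "R r < 1" "R r \<ge> sqrt (1 - p)" if "r \<in> {0<..<1}" for r
  proof -
    have "p * r < 1" using pr[OF that] p by linarith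
    thus "R r > 0" "R r < 1" "R r \<ge> sqrt (1 - p)"
      using pr[OF that] that unfolding R_def by simp_all
  qed
  define w where "w = (\<lambda>n r. (1 + of_real (R r)) powr (- (c - 1 + 2 * of_nat n)) / of_real (R r))"
  define g where "g = (\<lambda>n r. hyp_coeff (c - a) (c - b) c n * of_real (x * y) ^ n * (of_real r ^ n * w n r))"
  \<comment> \<open>(1 + R)^(-2n) is at most 1, 1 + R is at most 2 and R is at least sqrt (1 - p),
    so one constant bounds the weights for all n.\<close>
  define E where "E = 2 powr \<bar>Re c - 1\<bar> / sqrt (1 - p)"
  have E: "E \<ge> 0" unfolding E_def using p by simp
  have nw: "norm (w n r) \<le> E" if r: "r \<in> {0<..<1}" for n r
  proof -
    have R1: "1 + complex_of_real (R r) = of_real (1 + R r)" by simp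
    have "norm (w n r) = (1 + R r) powr (- (Re c - 1 + 2 * real n)) / R r"
      unfolding w_def R1 norm_divide norm_of_real using R[OF r]
      by (subst norm_powr_real_powr) (auto simp: algebra_simps)
    also have "\<dots> \<le> 2 powr \<bar>Re c - 1\<bar> / sqrt (1 - p)"
    proof (intro frac_le)
      have "(1 + R r) powr (- (Re c - 1 + 2 * real n)) \<le> (1 + R r) powr \<bar>Re c - 1\<bar>"
        using R[OF r] by (intro powr_mono) auto
      also have "\<dots> \<le> 2 powr \<bar>Re c - 1\<bar>" using R[OF r] by (intro powr_mono2) auto
      finally show "(1 + R r) powr (- (Re c - 1 + 2 * real n)) \<le> 2 powr \<bar>Re c - 1\<bar>" .
    qed (use R[OF r] p in auto)
    finally show ?thesis by (simp add: E_def)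
  qed
  have contR: "continuous_on {0<..<1} R" unfolding R_def by (intro continuous_intros)
  have cont: "continuous_on {0<..<1} (g n)" for n
  proof -
    have "continuous_on {0<..<1} (\<lambda>r. of_real (1 + R r) powr (- (c - 1 + 2 * of_nat n)) :: complex)"
      by (intro continuous_on_of_real_powr continuous_intros contR) (use R in fastforce)
    hence "continuous_on {0<..<1} (w n)"
      unfolding w_def of_real_add of_real_1 using R
      by (intro continuous_on_divide continuous_on_of_real contR) force+
    thus ?thesis unfolding g_def by (intro continuous_intros)
  qed
  have xy: "0 < x * y" "x * y < 1" using x y mult_strict_mono[of x 1 y 1] by auto
  define M where "M = (\<lambda>n. norm (hyp_coeff (c - a) (c - b) c n) * (x * y) ^ n * E)"
  have M: "summable M"
    unfolding M_def using xy by (intro summable_mult2 summable_norm_hyp_coeff) auto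
  have bound: "norm (g n r) \<le> M n" if r: "r \<in> {0<..<1}" for n r
  proof -
    have "norm (g n r) = norm (hyp_coeff (c - a) (c - b) c n) * (x * y) ^ n * (r ^ n * norm (w n r))"
      unfolding g_def using x y r by (simp add: norm_mult norm_power)
    also have "r ^ n * norm (w n r) \<le> 1 * E"
      using r nw[OF r] E by (intro mult_mono power_le_one) auto
    hence "norm (hyp_coeff (c - a) (c - b) c n) * (x * y) ^ n * (r ^ n * norm (w n r)) \<le> M n"
      unfolding M_def using xy by (intro mult_left_mono) auto
    finally show ?thesis .
  qed
  have gsum: "(\<Sum>n. g n r) = W r" if r: "r \<in> {0<..<1}" for r
  proof -
    define z where "z = x * y * r / (1 + R r)\<^sup>2"
    have "x * y * r < 1 * 1" using xy r by (intro mult_strict_mono) auto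
    moreover have "(1 + R r)\<^sup>2 > 1" using R[OF r] by (simp add: one_less_power)
    ultimately have "z < 1" unfolding z_def by (simp add: divide_less_eq)
    moreover have "z \<ge> 0" unfolding z_def using xy r by simp
    ultimately have "norm (of_real z :: complex) < 1" by simp
    from hyp_series_sums[OF this, of "c - a" "c - b" c]
    have s: "(\<lambda>n. (1 + of_real (R r)) powr (1 - c) / of_real (R r) * (hyp_coeff (c - a) (c - b) c n * of_real z ^ n)) sums W r"
      unfolding W_def z_def by (rule sums_mult)
    have t: "g n r = (1 + of_real (R r)) powr (1 - c) / of_real (R r) * (hyp_coeff (c - a) (c - b) c n * of_real z ^ n)" for n
    proof -
      have nz: "1 + complex_of_real (R r) \<noteq> 0"
      proof -
        have "Re (1 + complex_of_real (R r)) \<noteq> 0" using R[OF r] by simp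
        thus ?thesis by (metis zero_complex.sel(1))
      qed
      have "(1 + complex_of_real (R r)) powr (- (c - 1 + 2 * of_nat n)) = (1 + complex_of_real (R r)) powr ((1 - c) - of_nat (2 * n))"
        by (simp add: algebra_simps)
      also have "\<dots> = (1 + complex_of_real (R r)) powr (1 - c) / ((1 + complex_of_real (R r))\<^sup>2) ^ n"
        using nz by (simp only: powr_diff powr_nat power_mult) simp
      finally have e: "w n r = (1 + complex_of_real (R r)) powr (1 - c) / ((1 + complex_of_real (R r))\<^sup>2) ^ n / of_real (R r)"
        unfolding w_def by (rule arg_cong)
      show ?thesis unfolding g_def e z_def
        by (simp add: power_divide power_mult_distrib mult_ac)
    qed
    show ?thesis using s unfolding t[symmetric] by (simp only: sums_iff)
  qed
  have "(\<lambda>r. (\<Sum>n. g n r) * K r) absolutely_integrable_on {0<..<1}"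
    by (rule integral_series_weight(1)[OF K cont bound M])
  thus "(\<lambda>r. W r * product_kernel a b c r) absolutely_integrable_on {0<..<1}"
    unfolding K_def by (rule absolutely_integrable_spike[where S = "{}"]) (auto simp: gsum)
  have "(\<lambda>n. integral {0<..<1} (\<lambda>r. g n r * K r)) sums integral {0<..<1} (\<lambda>r. (\<Sum>n. g n r) * K r)"
    by (rule integral_series_weight(2)[OF K cont bound M])
  also have "integral {0<..<1} (\<lambda>r. (\<Sum>n. g n r) * K r) = integral {0<..<1} (\<lambda>r. W r * K r)"
    by (intro integral_cong) (simp only: gsum)
  also have "(\<lambda>n. integral {0<..<1} (\<lambda>r. g n r * K r)) =
     (\<lambda>n. Gamma a * Gamma b / of_real (sqrt pi) * (hyp_coeff (c - a) (c - b) c n * of_real (x * y) ^ n * hyp_shifted a b c n (of_real p)))"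
  proof
    fix n
    have "integral {0<..<1} (\<lambda>r. g n r * K r) = hyp_coeff (c - a) (c - b) c n * of_real (x * y) ^ n *
        integral {0<..<1} (\<lambda>r. of_real r ^ n * w n r * K r)"
      unfolding g_def mult.assoc by (simp only: integral_mult_right)
    also have "integral {0<..<1} (\<lambda>r. of_real r ^ n * w n r * K r) = Gamma a * Gamma b / of_real (sqrt pi) * hyp_shifted a b c n (of_real p)"
      using product_kernel_weighted[OF a b c, of p n] p unfolding w_def R_def K_def by simp
    finally show "integral {0<..<1} (\<lambda>r. g n r * K r) = Gamma a * Gamma b / of_real (sqrt pi) *
      (hyp_coeff (c - a) (c - b) c n * of_real (x * y) ^ n * hyp_shifted a b c n (of_real p))" by simp
  qed
  finally have 1: "(\<lambda>n. Gamma a * Gamma b / of_real (sqrt pi) * (hyp_coeff (c - a) (c - b) c n * of_real (x * y) ^ n * hyp_shifted a b c n (of_real p)))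
    sums integral {0<..<1} (\<lambda>r. W r * K r)" .
  have nx: "norm (of_real x :: complex) < 1" using x by simp
  have pe: "of_real y + of_real x * (1 - of_real y) = complex_of_real p" by (simp add: p_def algebra_simps)
  from burchnall_chaundy[OF cS y nx, of a b]
  have "(\<lambda>n. hyp_coeff (c - a) (c - b) c n * of_real (x * y) ^ n * hyp_shifted a b c n (of_real p)) sums
    (hyp2F1_reg_series a b c (of_real x) * hyp2F1_reg_series a b c (of_real y))"
    unfolding pe by simp
  from sums_unique2[OF 1 sums_mult[OF this]]
  show "integral {0<..<1} (\<lambda>r. W r * product_kernel a b c r) =
      Gamma a * Gamma b / of_real (sqrt pi) *
      (hyp2F1_reg_series a b c (of_real x) * hyp2F1_reg_series a b c (of_real y))"
    unfolding K_def .
qed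

subsection \<open>The product formula\<close>

lemma of_real_powr_exp:
  fixes t :: real and z :: complex
  assumes "t > 0"
  shows "of_real t powr z = exp (z * of_real (ln t))"
  using assms by (simp add: powr_def Ln_of_real)

lemma jacobi_fun_altdef:
  "jacobi_fun \<gamma> \<alpha> \<beta> (of_real (2 * y\<^sup>2 - 1)) = Gamma (\<alpha> + \<gamma> + 1) / Gamma (\<gamma> + 1) *
     hyp2F1_reg (- \<gamma>) (\<alpha> + \<beta> + \<gamma> + 1) (\<alpha> + 1) (of_real (1 - y\<^sup>2))"
proof -
  have "(1 - complex_of_real (2 * y\<^sup>2 - 1)) / 2 = of_real (1 - y\<^sup>2)" by simp
  thus ?thesis unfolding jacobi_fun_def by (simp only:)
qed

lemma hyp2F1_reg_series_commute: "hyp2F1_reg_series a b c z = hyp2F1_reg_series b a c z"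
  unfolding hyp2F1_reg_series_def by (simp add: mult_ac)

text \<open>For y^2 = 1 / (1 - x) the Pfaff argument of 1 - y^2 is x. The order of the numerator
  parameters selects the elementary factor and the series: one order is used under the integral, the
  other for the left-hand side.\<close>

lemma hyp2F1_reg_pfaff_real:
  assumes c: "\<And>n. c + of_nat (Suc n) \<noteq> 0" and x: "0 < x" "x < 1" and y: "y > 0" "y\<^sup>2 = 1 / (1 - x)"
  shows "hyp2F1_reg a b c (of_real (1 - y\<^sup>2)) = of_real y powr (- (2 * a)) * hyp2F1_reg_series a (c - b) c (of_real x)"
proof -
  have y2: "y\<^sup>2 > 1" unfolding y(2) using x by simp
  have "(1 - y\<^sup>2) / (1 - y\<^sup>2 - 1) = x" unfolding y(2) using x by (simp add: field_simps)
  hence e: "of_real (1 - y\<^sup>2) / (of_real (1 - y\<^sup>2) - 1) = complex_of_real x"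
    by (metis of_real_1 of_real_diff of_real_divide)
  have "1 - complex_of_real (1 - y\<^sup>2) = of_real (y\<^sup>2)" by simp
  moreover have "complex_of_real (y\<^sup>2) powr (- a) = of_real y powr (- (2 * a))"
    using y(1) by (simp add: of_real_powr_exp ln_realpow mult_ac del: of_real_power)
  moreover have "Re (of_real (1 - y\<^sup>2)) < 1 / 2" using y2 by simp
  ultimately show ?thesis using hyp2F1_reg_pfaff[OF c, of "of_real (1 - y\<^sup>2)" a b] e by simp
qed

text \<open>The quadratic transformation at w = 1 - r, where the inverse root is 1 / sqrt r. Degree
  and index are written as -2 B and A + B to fit it.\<close>

lemma gegenbauer_fun_real:
  assumes AB: "Re (A + B) > -1 / 2" and r: "0 < r" "r < 1"
  shows "gegenbauer_fun (- (2 * B)) (A + B) (of_real (1 / sqrt r)) =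
    of_real (sqrt pi) * Gamma (2 * A) / (2 powr (2 * (A + B) - 1) * Gamma (A + B) * Gamma (1 - 2 * B)) *
    (of_real r powr A * hyp2F1_reg_series A (A + 1 / 2) (A + B + 1 / 2) (of_real (1 - r)))"
proof -
  have c: "A + B + 1 / 2 + of_nat n \<noteq> 0" for n
  proof -
    have "Re (A + B + 1 / 2 + of_nat n) > 0" using AB by simp
    thus ?thesis by (metis zero_complex.sel(1) less_irrefl)
  qed
  have n: "norm (of_real (1 - r) :: complex) < 1" unfolding norm_of_real using r by simp
  have r1: "1 - complex_of_real (1 - r) = of_real r" by simp
  have cs: "inverse (csqrt (of_real r)) = complex_of_real (1 / sqrt r)"
    using r by (simp add: csqrt_of_real inverse_eq_divide)
  have "of_real r powr (- A) * hyp2F1_reg (2 * A) (2 * B) (A + B + 1 / 2) ((1 - of_real (1 / sqrt r)) / 2) =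
     hyp2F1_reg_series A (A + 1 / 2) (A + B + 1 / 2) (of_real (1 - r))"
    using hyp2F1_reg_quadratic[OF c n] unfolding r1 cs .
  moreover have "of_real r powr A * of_real r powr (- A) = (1 :: complex)"
    using r by (simp add: powr_minus)
  ultimately have h: "hyp2F1_reg (2 * A) (2 * B) (A + B + 1 / 2) ((1 - of_real (1 / sqrt r)) / 2) =
     of_real r powr A * hyp2F1_reg_series A (A + 1 / 2) (A + B + 1 / 2) (of_real (1 - r))"
    by (metis mult.assoc mult_1)
  have e: "2 * (A + B) + - (2 * B) = 2 * A" "- (2 * B) + 1 = 1 - 2 * B" "- (- (2 * B)) = 2 * B" by simp_all
  show ?thesis
    unfolding gegenbauer_fun_def e hyp2F1_reg_commute[of "2 * B"] h by simp
qed

text \<open>Because y^2 - 1 = x / (1 - x) for each pair, numerator and denominator acquire the same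
  factor 1 / D.\<close>

lemma C_arg_eq:
  assumes x: "0 < x1" "x1 < 1" "0 < x2" "x2 < 1" "0 < x3" "x3 < 1"
    and y: "y1 > 0" "y2 > 0" "y3 > 0" "y1\<^sup>2 = 1 / (1 - x1)" "y2\<^sup>2 = 1 / (1 - x2)" "y3\<^sup>2 = 1 / (1 - x3)"
  shows "C_arg y1 y2 y3 = (x1 * x2 + x1 * x3 + x2 * x3 - x1 * x2 * x3) / (2 * sqrt (x1 * x2 * x3))"
proof -
  define D where "D = (1 - x1) * (1 - x2) * (1 - x3)"
  have D: "D > 0" using x by (simp add: D_def)
  have "y1 * y2 * y3 * sqrt ((y1\<^sup>2 - 1) * (y2\<^sup>2 - 1) * (y3\<^sup>2 - 1)) =
     sqrt (y1\<^sup>2 * y2\<^sup>2 * y3\<^sup>2 * ((y1\<^sup>2 - 1) * (y2\<^sup>2 - 1) * (y3\<^sup>2 - 1)))"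
    using y(1-3) by (simp add: real_sqrt_mult)
  also have "y1\<^sup>2 * y2\<^sup>2 * y3\<^sup>2 * ((y1\<^sup>2 - 1) * (y2\<^sup>2 - 1) * (y3\<^sup>2 - 1)) = x1 * x2 * x3 / D\<^sup>2"
  proof -
    have "y1\<^sup>2 - 1 = x1 / (1 - x1)" "y2\<^sup>2 - 1 = x2 / (1 - x2)" "y3\<^sup>2 - 1 = x3 / (1 - x3)"
      unfolding y using x by (simp_all add: field_simps)
    thus ?thesis unfolding y by (simp add: D_def power2_eq_square)
  qed
  also have "sqrt (x1 * x2 * x3 / D\<^sup>2) = sqrt (x1 * x2 * x3) / D"
    using D by (simp add: real_sqrt_divide)
  finally have den: "2 * y1 * y2 * y3 * sqrt ((y1\<^sup>2 - 1) * (y2\<^sup>2 - 1) * (y3\<^sup>2 - 1)) = 2 * sqrt (x1 * x2 * x3) / D"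
    by (simp add: mult.assoc)
  have num: "1 - y1\<^sup>2 * y2\<^sup>2 - y1\<^sup>2 * y3\<^sup>2 - y2\<^sup>2 * y3\<^sup>2 + 2 * y1\<^sup>2 * y2\<^sup>2 * y3\<^sup>2 =
     (x1 * x2 + x1 * x3 + x2 * x3 - x1 * x2 * x3) / D"
    unfolding y D_def using x by (simp add: divide_simps) (simp add: algebra_simps)
  show ?thesis unfolding C_arg_def den num using D by simp
qed

text \<open>The substitution \<open>r = 1 / C^2\<close>, solved for \<open>x3 = 1 - 1 / y3^2\<close> and for \<open>y3\<close>,
  with \<open>p = 1 - (1 - x1) * (1 - x2)\<close>.\<close>

definition subst_x :: "real \<Rightarrow> real \<Rightarrow> real \<Rightarrow> real" where
  "subst_x x1 x2 r = x1 * x2 * r / (1 + sqrt (1 - (x1 + x2 - x1 * x2) * r))\<^sup>2"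

definition subst_y :: "real \<Rightarrow> real \<Rightarrow> real \<Rightarrow> real" where
  "subst_y x1 x2 r = 1 / sqrt (1 - subst_x x1 x2 r)"

context
  fixes x1 x2 :: real
  assumes x: "0 < x1" "x1 < 1" "0 < x2" "x2 < 1"
begin

lemma subst_p: "0 < x1 + x2 - x1 * x2" "x1 + x2 - x1 * x2 < 1"
proof -
  have "1 - (x1 + x2 - x1 * x2) = (1 - x1) * (1 - x2)" by (simp add: algebra_simps)
  moreover have "(1 - x1) * (1 - x2) > 0" using x by simp
  ultimately show "x1 + x2 - x1 * x2 < 1" by linarith
  have "x1 + x2 - x1 * x2 = x1 + x2 * (1 - x1)" by (simp add: algebra_simps)
  moreover have "x2 * (1 - x1) > 0" using x by simp
  ultimately show "0 < x1 + x2 - x1 * x2" using x by linarith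
qed

lemma subst_pr:
  assumes "0 \<le> r" "r \<le> 1"
  shows "(x1 + x2 - x1 * x2) * r < 1"
proof -
  have "(x1 + x2 - x1 * x2) * r \<le> (x1 + x2 - x1 * x2) * 1"
    using assms subst_p by (intro mult_left_mono) auto
  also have "\<dots> = x1 + x2 - x1 * x2" by (rule mult_1_right)
  also have "\<dots> < 1" by (rule subst_p(2))
  finally show ?thesis .
qed

lemma subst_x_bounds:
  assumes "0 \<le> r" "r \<le> 1"
  shows "0 \<le> subst_x x1 x2 r" "subst_x x1 x2 r < 1" "0 < r \<Longrightarrow> 0 < subst_x x1 x2 r"
proof -
  define R where "R = sqrt (1 - (x1 + x2 - x1 * x2) * r)"
  have R: "R > 0" using subst_pr[OF assms] by (simp add: R_def)
  have s: "subst_x x1 x2 r = x1 * x2 * r / (1 + R)\<^sup>2" by (simp add: subst_x_def R_def)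
  have "(1 + R)\<^sup>2 > 1" using R by (simp add: one_less_power)
  moreover have "x1 * x2 < 1 * 1" using x by (intro mult_strict_mono) auto
  hence "x1 * x2 * r \<le> 1 * 1" using assms x by (intro mult_mono) auto
  ultimately show "subst_x x1 x2 r < 1" unfolding s by (simp add: divide_less_eq)
  show "0 \<le> subst_x x1 x2 r" unfolding s using x assms by simp
  show "0 < subst_x x1 x2 r" if "0 < r" unfolding s using x that R by simp
qed

lemma subst_y_pos:
  assumes "0 \<le> r" "r \<le> 1"
  shows "subst_y x1 x2 r > 0" "(subst_y x1 x2 r)\<^sup>2 = 1 / (1 - subst_x x1 x2 r)"
  using subst_x_bounds[OF assms] by (simp_all add: subst_y_def power_divide)

text \<open>Origin of \<open>subst_x\<close>: with p = x1 + x2 - x1 x2 and t = sqrt x3,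
  \<open>C_arg_eq\<close> reads p t^2 - 2 C sqrt (x1 x2) t + x1 x2 = 0, and \<open>subst_x\<close>
  is the square of the smaller root for C = 1 / sqrt r.\<close>

lemma C_arg_subst_y:
  assumes r: "0 < r" "r < 1"
    and y: "y1 > 0" "y2 > 0" "y1\<^sup>2 = 1 / (1 - x1)" "y2\<^sup>2 = 1 / (1 - x2)"
  shows "C_arg y1 y2 (subst_y x1 x2 r) = 1 / sqrt r"
proof -
  define R where "R = sqrt (1 - (x1 + x2 - x1 * x2) * r)"
  have pr: "(x1 + x2 - x1 * x2) * r < 1" using subst_pr[of r] r by simp
  hence R: "R > 0" by (simp add: R_def)
  \<comment> \<open>This factorisation eliminates p and leaves numerator and denominator as
    multiples of x1 x2 / (1 + R).\<close>
  have R2: "(x1 + x2 - x1 * x2) * r = (1 - R) * (1 + R)"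
    using pr by (simp add: R_def power2_eq_square[symmetric] algebra_simps)
  define x3 where "x3 = subst_x x1 x2 r"
  have x3: "x3 = x1 * x2 * r / (1 + R)\<^sup>2" by (simp add: x3_def subst_x_def R_def)
  have "x1 * x2 * x3 = (x1 * x2)\<^sup>2 * r / (1 + R)\<^sup>2" unfolding x3 by (simp add: power2_eq_square)
  hence sq: "sqrt (x1 * x2 * x3) = x1 * x2 * sqrt r / (1 + R)"
    using x R by (simp add: real_sqrt_divide real_sqrt_mult)
  have "x1 * x2 + x1 * x3 + x2 * x3 - x1 * x2 * x3 = x1 * x2 * (1 + ((x1 + x2 - x1 * x2) * r) / (1 + R)\<^sup>2)"
    unfolding x3 by (simp add: add_divide_distrib diff_divide_distrib algebra_simps)
  also have "1 + ((x1 + x2 - x1 * x2) * r) / (1 + R)\<^sup>2 = 2 / (1 + R)"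
    unfolding R2 using R by (simp add: power2_eq_square divide_simps)
  finally have num: "x1 * x2 + x1 * x3 + x2 * x3 - x1 * x2 * x3 = x1 * x2 * (2 / (1 + R))" .
  have b: "0 < x3" "x3 < 1" unfolding x3_def using subst_x_bounds[of r] r by auto
  have "C_arg y1 y2 (subst_y x1 x2 r) = (x1 * x2 + x1 * x3 + x2 * x3 - x1 * x2 * x3) / (2 * sqrt (x1 * x2 * x3))"
    by (rule C_arg_eq) (use x b y subst_y_pos[of r] r in \<open>auto simp: x3_def\<close>)
  moreover have "x1 \<noteq> 0" "x2 \<noteq> 0" "1 + R \<noteq> 0" using x R by auto
  ultimately show ?thesis unfolding num sq by simp
qed

text \<open>The logarithmic derivative of x3 in r is 1 / (r R), which supplies the 1 / R of the
  kernel weight; the factor y^3 / 2 is the derivative of (1 - x)^(-1/2).\<close>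

lemma subst_y_deriv:
  assumes r: "0 < r" "r < 1"
  shows "(subst_y x1 x2 has_real_derivative
     (1 / 2 * subst_y x1 x2 r ^ 3 * (subst_x x1 x2 r / (r * sqrt (1 - (x1 + x2 - x1 * x2) * r))))) (at r)"
proof -
  define p where "p = x1 + x2 - x1 * x2"
  define R where "R = (\<lambda>r. sqrt (1 - p * r))"
  have pr: "p * r < 1" using subst_pr[of r] r by (simp add: p_def)
  hence R: "R r > 0" by (simp add: R_def)
  have R2: "R r * R r = 1 - p * r" using pr by (simp add: R_def)
  have dR: "(R has_real_derivative - (p / (2 * R r))) (at r)"
    unfolding R_def using pr by (auto intro!: derivative_eq_intros simp: field_simps)
  have d1: "((\<lambda>r. (1 + R r)\<^sup>2) has_real_derivative 2 * (1 + R r) * (- (p / (2 * R r)))) (at r)"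
    using dR R by (auto intro!: derivative_eq_intros simp: field_simps)
  have dx: "((\<lambda>r. x1 * x2 * r / (1 + R r)\<^sup>2) has_real_derivative
     (x1 * x2 * (1 + R r)\<^sup>2 - x1 * x2 * r * (2 * (1 + R r) * (- (p / (2 * R r))))) / ((1 + R r)\<^sup>2 * (1 + R r)\<^sup>2)) (at r)"
    using R by (intro DERIV_divide d1) (auto intro!: derivative_eq_intros)
  have sx: "subst_x x1 x2 r = x1 * x2 * r / (1 + R r)\<^sup>2"
    by (simp add: subst_x_def R_def p_def)
  have eq: "(x1 * x2 * (1 + R r)\<^sup>2 - x1 * x2 * r * (2 * (1 + R r) * (- (p / (2 * R r))))) / ((1 + R r)\<^sup>2 * (1 + R r)\<^sup>2)
     = subst_x x1 x2 r / (r * R r)"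
  proof -
    have "x1 * x2 * (1 + R r)\<^sup>2 - x1 * x2 * r * (2 * (1 + R r) * (- (p / (2 * R r)))) = x1 * x2 * (1 + R r) * (1 + R r + p * r / R r)"
      using R by (simp add: power2_eq_square algebra_simps)
    also have "1 + R r + p * r / R r = (1 + R r) / R r"
    proof -
      have "p * r = 1 - R r * R r" using R2 by simp
      thus ?thesis using R by (simp add: field_simps)
    qed
    finally show ?thesis
      using R r unfolding sx by (simp add: power2_eq_square)
  qed
  have XR: "subst_x x1 x2 = (\<lambda>r. x1 * x2 * r / (1 + R r)\<^sup>2)"
    by (simp add: fun_eq_iff subst_x_def R_def p_def)
  have dX: "(subst_x x1 x2 has_real_derivative subst_x x1 x2 r / (r * R r)) (at r)"
    using dx unfolding eq unfolding XR .
  have X: "subst_x x1 x2 r < 1" using subst_x_bounds[of r] r by simp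
  have ds: "((\<lambda>r. sqrt (1 - subst_x x1 x2 r)) has_real_derivative - (subst_x x1 x2 r / (r * R r)) / (2 * sqrt (1 - subst_x x1 x2 r))) (at r)"
    using X dX by (auto intro!: derivative_eq_intros simp: field_simps)
  have "(subst_y x1 x2 has_real_derivative
     - (inverse (sqrt (1 - subst_x x1 x2 r)) * (- (subst_x x1 x2 r / (r * R r)) / (2 * sqrt (1 - subst_x x1 x2 r))) * inverse (sqrt (1 - subst_x x1 x2 r)))) (at r)"
    unfolding subst_y_def[abs_def] inverse_eq_divide[symmetric] using X
    by (intro DERIV_inverse'[OF ds]) auto
  moreover have "- (inverse Q * (- U / (2 * Q)) * inverse Q) = 1 / 2 * (1 / Q) ^ 3 * U" for Q U :: real
    by (simp add: power3_eq_cube inverse_eq_divide)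
  ultimately show ?thesis unfolding subst_y_def R_def p_def by (simp only:)
qed

lemma subst_y_continuous: "continuous_on {0..1} (subst_y x1 x2)"
proof -
  have "continuous_on {0..1} (subst_x x1 x2)"
    unfolding subst_x_def
  proof (intro continuous_intros ballI)
    fix r :: real assume "r \<in> {0..1}"
    hence "sqrt (1 - (x1 + x2 - x1 * x2) * r) \<ge> 0" using subst_pr[of r] by simp
    hence "1 + sqrt (1 - (x1 + x2 - x1 * x2) * r) \<noteq> 0" by linarith
    thus "(1 + sqrt (1 - (x1 + x2 - x1 * x2) * r))\<^sup>2 \<noteq> 0" by (rule power_not_zero)
  qed
  thus ?thesis unfolding subst_y_def
    using subst_x_bounds(2) by (intro continuous_intros) force+
qed

lemma subst_y_strict_mono:
  assumes "0 \<le> r" "r < s" "s \<le> 1"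
  shows "subst_y x1 x2 r < subst_y x1 x2 s"
proof (rule DERIV_pos_imp_increasing_open[OF assms(2)])
  show "continuous_on {r..s} (subst_y x1 x2)"
    using assms by (intro continuous_on_subset[OF subst_y_continuous]) auto
  fix t assume t: "r < t" "t < s"
  hence t': "0 < t" "t < 1" using assms by auto
  show "\<exists>y. (subst_y x1 x2 has_real_derivative y) (at t) \<and> y > 0"
  proof (intro exI conjI, rule subst_y_deriv[OF t'])
    show "1 / 2 * subst_y x1 x2 t ^ 3 * (subst_x x1 x2 t / (t * sqrt (1 - (x1 + x2 - x1 * x2) * t))) > 0"
      using subst_y_pos[of t] subst_x_bounds[of t] subst_pr[of t] t'
      by (intro mult_pos_pos divide_pos_pos zero_less_power) auto
  qed
qed

lemma subst_y_image: "subst_y x1 x2 ` {0<..<1} = {1<..<subst_y x1 x2 1}"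
proof -
  have 0: "subst_y x1 x2 0 = 1" by (simp add: subst_y_def subst_x_def)
  show ?thesis
  proof (intro equalityI subsetI)
    fix t assume "t \<in> subst_y x1 x2 ` {0<..<1}"
    then obtain r where "0 < r" "r < 1" "t = subst_y x1 x2 r" by auto
    thus "t \<in> {1<..<subst_y x1 x2 1}"
      using subst_y_strict_mono[of 0 r] subst_y_strict_mono[of r 1] 0 by auto
  next
    fix t assume t: "t \<in> {1<..<subst_y x1 x2 1}"
    obtain r where r: "0 \<le> r" "r \<le> 1" "subst_y x1 x2 r = t"
      using IVT'[of "subst_y x1 x2" 0 t 1] t 0 subst_y_continuous by auto
    moreover have "r \<noteq> 0" "r \<noteq> 1" using r t 0 by auto
    ultimately show "t \<in> subst_y x1 x2 ` {0<..<1}" by force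
  qed
qed

lemma subst_y_inj: "inj_on (subst_y x1 x2) {0<..<1}"
proof (rule inj_onI)
  fix r s :: real assume "r \<in> {0<..<1}" "s \<in> {0<..<1}" "subst_y x1 x2 r = subst_y x1 x2 s"
  thus "r = s" using subst_y_strict_mono[of r s] subst_y_strict_mono[of s r] by (cases r s rule: linorder_cases) auto
qed

text \<open>The upper limit of the integral corresponds to r = 1, that is to C = 1; the inner root
  is then 1 / (y1 y2).\<close>

lemma subst_y_1:
  assumes y: "y1 > 0" "y2 > 0" "y1\<^sup>2 = 1 / (1 - x1)" "y2\<^sup>2 = 1 / (1 - x2)"
  shows "subst_y x1 x2 1 = (y1 * y2 + 1) / (y1 + y2)"
proof -
  define Y where "Y = y1 * y2"
  have Y: "Y > 0" using y by (simp add: Y_def)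
  have "1 - (x1 + x2 - x1 * x2) * 1 = (1 - x1) * (1 - x2)" by (simp add: algebra_simps)
  also have "\<dots> = (1 / Y)\<^sup>2" unfolding Y_def power_divide power_mult_distrib y(3,4) by simp
  finally have "sqrt (1 - (x1 + x2 - x1 * x2) * 1) = 1 / Y"
    using Y by (simp add: real_sqrt_divide)
  hence X: "subst_x x1 x2 1 = x1 * x2 / (1 + 1 / Y)\<^sup>2" by (simp add: subst_x_def)
  have x': "x1 = (y1\<^sup>2 - 1) / y1\<^sup>2" "x2 = (y2\<^sup>2 - 1) / y2\<^sup>2"
    unfolding y using x by (simp_all add: field_simps)
  have "x1 * x2 = (y1\<^sup>2 - 1) * (y2\<^sup>2 - 1) / Y\<^sup>2" unfolding x' Y_def by (simp add: power_mult_distrib)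
  moreover have "1 + 1 / Y = (Y + 1) / Y" using Y by (simp add: field_simps)
  ultimately have "subst_x x1 x2 1 = (y1\<^sup>2 - 1) * (y2\<^sup>2 - 1) / (Y + 1)\<^sup>2"
    unfolding X using Y by (simp add: power_divide)
  hence "1 - subst_x x1 x2 1 = ((Y + 1)\<^sup>2 - (y1\<^sup>2 - 1) * (y2\<^sup>2 - 1)) / (Y + 1)\<^sup>2"
    using Y by (simp add: diff_divide_distrib)
  also have "(Y + 1)\<^sup>2 - (y1\<^sup>2 - 1) * (y2\<^sup>2 - 1) = (y1 + y2)\<^sup>2"
    unfolding Y_def by (simp add: power2_eq_square algebra_simps)
  finally have "sqrt (1 - subst_x x1 x2 1) = (y1 + y2) / (Y + 1)"
    using y Y by (simp add: real_sqrt_divide)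
  thus ?thesis by (simp add: subst_y_def Y_def)
qed

end

section \<open>Change of variables and comparison of constants\<close>

text \<open>Apart from constants, the factor 1 / R and two series, both sides are products of powers
  of positive bases, so the claim becomes a linear identity between exponents. \<open>A\<close> is c
  / 2 - b and A + B is c - a - b, which makes the Gegenbauer series the one in
  \<open>product_kernel\<close>.\<close>

lemma product_integrand_subst:
  fixes \<alpha> \<beta> \<gamma> :: complex
  assumes x: "0 < x1" "x1 < 1" "0 < x2" "x2 < 1" and r: "0 < r" "r < 1"
    and y: "y1 > 0" "y2 > 0" "y1\<^sup>2 = 1 / (1 - x1)" "y2\<^sup>2 = 1 / (1 - x2)"
    and c: "\<And>n. \<alpha> + 1 + of_nat (Suc n) \<noteq> 0" and AB: "Re (\<alpha> + \<beta> + 2 * \<gamma>) < - 1 / 2"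
  defines "a \<equiv> \<alpha> + \<gamma> + 1" and "b \<equiv> \<alpha> + \<beta> + \<gamma> + 1"
    and "A \<equiv> - ((\<alpha> + 2 * \<beta> + 2 * \<gamma> + 1) / 2)" and "B \<equiv> - ((\<alpha> + 2 * \<gamma> + 1) / 2)"
    and "R \<equiv> sqrt (1 - (x1 + x2 - x1 * x2) * r)"
  shows "(1 / 2 * subst_y x1 x2 r ^ 3 * (subst_x x1 x2 r / (r * R))) *\<^sub>R
      product_integrand \<alpha> \<beta> \<gamma> y1 y2 (subst_y x1 x2 r) =
    (1 / 2 * (Gamma a / Gamma (\<gamma> + 1)) *
      (of_real (sqrt pi) * Gamma (2 * A) / (2 powr (2 * (A + B) - 1) * Gamma (A + B) * Gamma (1 - 2 * B))) *
      of_real (x1 * x2) powr (\<alpha> / 2)) *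
    ((1 + of_real R) powr (1 - (\<alpha> + 1)) / of_real R *
       hyp2F1_reg_series (\<alpha> + 1 - a) (\<alpha> + 1 - b) (\<alpha> + 1) (of_real (x1 * x2 * r / (1 + R)\<^sup>2)) *
     product_kernel a b (\<alpha> + 1) r)"
proof -
  define Y where "Y = subst_y x1 x2 r"
  define X where "X = subst_x x1 x2 r"
  define G where "G = of_real (sqrt pi) * Gamma (2 * A) / (2 powr (2 * (A + B) - 1) * Gamma (A + B) * Gamma (1 - 2 * B))"
  define S1 where "S1 = hyp2F1_reg_series (- \<gamma>) (- \<beta> - \<gamma>) (\<alpha> + 1) (of_real X)"
  define S2 where "S2 = hyp2F1_reg_series A (A + 1 / 2) (A + B + 1 / 2) (of_real (1 - r))"
  have r': "0 \<le> r" "r \<le> 1" using r by auto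
  have X: "0 < X" "X < 1" unfolding X_def using subst_x_bounds[OF x r'] r by auto
  have Y: "Y > 0" "Y\<^sup>2 = 1 / (1 - X)" unfolding X_def Y_def by (rule subst_y_pos[OF x r'])+
  have R: "R > 0" unfolding R_def using subst_pr[OF x r'] by simp
  have XR: "X = x1 * x2 * r / (1 + R)\<^sup>2" unfolding X_def subst_x_def R_def ..
  have C: "C_arg y1 y2 Y = 1 / sqrt r" unfolding Y_def by (rule C_arg_subst_y[OF x r y])
  have C2: "(C_arg y1 y2 Y)\<^sup>2 - 1 = (1 - r) / r"
    unfolding C using r by (simp add: power_divide diff_divide_distrib)
  have Y21: "Y\<^sup>2 - 1 = X * Y\<^sup>2"
    unfolding Y(2) using X by (simp add: field_simps)
  \<comment> \<open>With -\<gamma> as first parameter Pfaff's transformation yields F(c - a, c - b;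
    c; x3), the series in \<open>product_kernel_integral\<close>.\<close>
  have J: "jacobi_fun \<gamma> \<alpha> \<beta> (of_real (2 * Y\<^sup>2 - 1)) = Gamma a / Gamma (\<gamma> + 1) * (of_real Y powr (2 * \<gamma>) * S1)"
  proof -
    have e: "\<alpha> + 1 - (\<alpha> + \<beta> + \<gamma> + 1) = - \<beta> - \<gamma>" "- (2 * - \<gamma>) = 2 * \<gamma>" by simp_all
    show ?thesis
      unfolding jacobi_fun_altdef hyp2F1_reg_pfaff_real[OF c X Y] e S1_def a_def ..
  qed
  have Geg: "gegenbauer_fun (\<alpha> + 2 * \<gamma> + 1) (- (\<alpha> + \<beta> + 2 * \<gamma> + 1)) (of_real (C_arg y1 y2 Y)) = G * (of_real r powr A * S2)"
  proof -
    have e: "- (2 * B) = \<alpha> + 2 * \<gamma> + 1" "A + B = - (\<alpha> + \<beta> + 2 * \<gamma> + 1)"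
      unfolding A_def B_def by (simp_all add: field_simps)
    have "Re (A + B) > - 1 / 2" unfolding e using AB by simp
    from gegenbauer_fun_real[OF this r] show ?thesis unfolding C e(1) G_def S2_def by (simp only: e(2))
  qed
  have K: "product_kernel a b (\<alpha> + 1) r = of_real r powr (a - 1) * of_real (1 - r) powr (A + B - 1 / 2) * S2"
  proof -
    have e: "(\<alpha> + 1) / 2 - b = A" "\<alpha> + 1 - a - b + 1 / 2 = A + B + 1 / 2"
      unfolding A_def B_def a_def b_def by (simp_all add: field_simps)
    have e2: "A + B + 1 / 2 - 1 = A + B - 1 / 2" by simp
    show ?thesis unfolding product_kernel_def beta_kernel_def e e2 S2_def ..
  qed
  define ly lr l1 lR lp where "ly = complex_of_real (ln Y)" and "lr = complex_of_real (ln r)"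
    and "l1 = complex_of_real (ln (1 - r))" and "lR = complex_of_real (ln (1 + R))"
    and "lp = complex_of_real (ln (x1 * x2))"
  have lX: "ln X = ln (x1 * x2) + ln r - 2 * ln (1 + R)"
    unfolding XR using x r R by (simp add: ln_div ln_mult ln_realpow)
  hence lX': "complex_of_real (ln X) = lp + lr - 2 * lR" by (simp add: lp_def lr_def lR_def)
  have pw: "of_real Y powr z = exp (z * ly)" "of_real r powr z = exp (z * lr)"
    "of_real (1 - r) powr z = exp (z * l1)" "of_real (1 + R) powr z = exp (z * lR)"
    "of_real (x1 * x2) powr z = exp (z * lp)" "of_real (Y\<^sup>2 - 1) powr z = exp (z * (lp + lr - 2 * lR + 2 * ly))"
    "of_real ((C_arg y1 y2 Y)\<^sup>2 - 1) powr z = exp (z * (l1 - lr))" for z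
  proof -
    show "of_real Y powr z = exp (z * ly)" "of_real r powr z = exp (z * lr)"
      "of_real (1 - r) powr z = exp (z * l1)" "of_real (1 + R) powr z = exp (z * lR)"
      "of_real (x1 * x2) powr z = exp (z * lp)"
      unfolding ly_def lr_def l1_def lR_def lp_def by (rule of_real_powr_exp; use Y r R x in simp)+
    have "ln (X * Y\<^sup>2) = ln X + 2 * ln Y" using X(1) Y(1) by (simp add: ln_mult ln_realpow)
    moreover have "X * Y\<^sup>2 > 0" using X(1) Y(1) by simp
    ultimately show "of_real (Y\<^sup>2 - 1) powr z = exp (z * (lp + lr - 2 * lR + 2 * ly))"
      unfolding Y21 by (subst of_real_powr_exp) (simp_all add: lX' ly_def)
    have "ln ((1 - r) / r) = ln (1 - r) - ln r" using r by (simp add: ln_div)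
    moreover have "(1 - r) / r > 0" using r by simp
    ultimately show "of_real ((C_arg y1 y2 Y)\<^sup>2 - 1) powr z = exp (z * (l1 - lr))"
      unfolding C2 by (subst of_real_powr_exp) (simp_all add: l1_def lr_def)
  qed
  have U: "complex_of_real (1 / 2 * Y ^ 3 * (X / (r * R))) = 1 / 2 * exp (3 * ly + (lp - 2 * lR)) / of_real R"
  proof -
    have "complex_of_real (Y ^ 3 * (X / r)) = exp (of_real (3 * ln Y + (ln X - ln r)))"
      using X Y r by (simp only: exp_of_real exp_add exp_diff exp_ln exp_of_nat_mult[of 3, simplified])
    also have "of_real (3 * ln Y + (ln X - ln r)) = 3 * ly + (lp - 2 * lR)"
      by (simp add: lX' ly_def lr_def)
    finally have "complex_of_real (Y ^ 3 * (X / r)) = exp (3 * ly + (lp - 2 * lR))" .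
    moreover have "1 / 2 * Y ^ 3 * (X / (r * R)) = 1 / 2 * (Y ^ 3 * (X / r)) / R" by simp
    ultimately show ?thesis by (simp only: of_real_mult of_real_divide) simp
  qed
  have main: "exp (3 * ly + (lp - 2 * lR)) * (exp (2 * \<gamma> * ly) *
      (exp ((\<alpha> - 2) / 2 * (lp + lr - 2 * lR + 2 * ly)) / exp ((\<alpha> + 2 * \<gamma> + 1) * ly)) *
      exp ((- \<alpha> - \<beta> - 2 * \<gamma> - 3 / 2) * (l1 - lr)) * exp (A * lr)) =
     exp (\<alpha> / 2 * lp) * exp ((1 - (\<alpha> + 1)) * lR) * (exp ((a - 1) * lr) * exp ((A + B - 1 / 2) * l1))"
  proof -
    \<comment> \<open>The coefficients of \<open>ly\<close> add up to 0: the powers of y3 cancel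
      entirely.\<close>
    have "3 * ly + (lp - 2 * lR) + (2 * \<gamma> * ly + ((\<alpha> - 2) / 2 * (lp + lr - 2 * lR + 2 * ly) - (\<alpha> + 2 * \<gamma> + 1) * ly) +
      (- \<alpha> - \<beta> - 2 * \<gamma> - 3 / 2) * (l1 - lr) + A * lr) =
      \<alpha> / 2 * lp + (1 - (\<alpha> + 1)) * lR + ((a - 1) * lr + (A + B - 1 / 2) * l1)"
      unfolding A_def B_def a_def by (simp add: field_simps)
    from arg_cong[OF this, of exp] show ?thesis by (simp only: exp_add exp_diff)
  qed
  have "(1 / 2 * Y ^ 3 * (X / (r * R))) *\<^sub>R product_integrand \<alpha> \<beta> \<gamma> y1 y2 Y =
    1 / 2 * (Gamma a / Gamma (\<gamma> + 1)) * G * (S1 * S2) / of_real R *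
    (exp (3 * ly + (lp - 2 * lR)) * (exp (2 * \<gamma> * ly) *
      (exp ((\<alpha> - 2) / 2 * (lp + lr - 2 * lR + 2 * ly)) / exp ((\<alpha> + 2 * \<gamma> + 1) * ly)) *
      exp ((- \<alpha> - \<beta> - 2 * \<gamma> - 3 / 2) * (l1 - lr)) * exp (A * lr)))"
    unfolding scaleR_conv_of_real U product_integrand_def J Geg pw by (simp add: mult_ac)
  also note main
  also have "1 / 2 * (Gamma a / Gamma (\<gamma> + 1)) * G * (S1 * S2) / of_real R *
     (exp (\<alpha> / 2 * lp) * exp ((1 - (\<alpha> + 1)) * lR) * (exp ((a - 1) * lr) * exp ((A + B - 1 / 2) * l1))) =
    (1 / 2 * (Gamma a / Gamma (\<gamma> + 1)) * G * of_real (x1 * x2) powr (\<alpha> / 2)) *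
    (of_real (1 + R) powr (1 - (\<alpha> + 1)) / of_real R * S1 * product_kernel a b (\<alpha> + 1) r)"
    unfolding K pw by simp
  also have "S1 = hyp2F1_reg_series (\<alpha> + 1 - a) (\<alpha> + 1 - b) (\<alpha> + 1) (of_real (x1 * x2 * r / (1 + R)\<^sup>2))"
    unfolding S1_def XR a_def b_def by (simp add: algebra_simps)
  finally show ?thesis unfolding Y_def X_def G_def by (simp only: of_real_add of_real_1)
qed

lemma jacobi_product_formula_real:
  fixes \<alpha> \<beta> \<gamma> :: complex
  assumes a: "Re (\<alpha> + \<gamma>) > -1" and b: "Re (\<alpha> + \<beta> + \<gamma>) > -1" and AB: "Re (\<alpha> + \<beta> + 2 * \<gamma>) < - 1 / 2"
    and np: "\<alpha> + 2 * \<gamma> + 2 \<notin> \<int>\<^sub>\<le>\<^sub>0" "- \<alpha> - \<beta> - 2 * \<gamma> - 1 \<notin> \<int>\<^sub>\<le>\<^sub>0" "- \<alpha> - 2 * \<beta> - 2 * \<gamma> - 1 \<notin> \<int>\<^sub>\<le>\<^sub>0"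
    and y: "y1 > 1" "y2 > 1"
  shows "product_integrand \<alpha> \<beta> \<gamma> y1 y2 absolutely_integrable_on {1..(y1 * y2 + 1) / (y1 + y2)}"
    and "jacobi_product \<alpha> \<beta> \<gamma> y1 y2 = jacobi_integral \<alpha> \<beta> \<gamma> y1 y2"
proof -
  define a' b' c where "a' = \<alpha> + \<gamma> + 1" and "b' = \<alpha> + \<beta> + \<gamma> + 1" and "c = \<alpha> + 1"
  define A where "A = - ((\<alpha> + 2 * \<beta> + 2 * \<gamma> + 1) / 2)"
  define B where "B = - ((\<alpha> + 2 * \<gamma> + 1) / 2)"
  define x1 where "x1 = 1 - 1 / y1\<^sup>2"
  define x2 where "x2 = 1 - 1 / y2\<^sup>2"
  have y0: "y1 > 0" "y2 > 0" using y by auto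
  have ysq: "y1\<^sup>2 > 1" "y2\<^sup>2 > 1" using y by (simp_all add: one_less_power)
  have x: "0 < x1" "x1 < 1" "0 < x2" "x2 < 1"
    unfolding x1_def x2_def using ysq y0 by (simp_all add: divide_less_eq)
  have yx: "y1\<^sup>2 = 1 / (1 - x1)" "y2\<^sup>2 = 1 / (1 - x2)" unfolding x1_def x2_def using y0 by simp_all
  have par: "Re a' > 0" "Re b' > 0" "Re (c - a' - b') > - 1 / 2"
    using a b AB unfolding a'_def b'_def c_def by simp_all
  have cS: "\<alpha> + 1 + of_nat (Suc n) \<noteq> 0" for n
  proof -
    have "Re (\<alpha> + 1 + of_nat (Suc n)) > 0" using par unfolding a'_def b'_def c_def by simp
    thus ?thesis by (metis zero_complex.sel(1) less_irrefl)
  qed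
  define R where "R = (\<lambda>r. sqrt (1 - (x1 + x2 - x1 * x2) * r))"
  define W where "W = (\<lambda>r. (1 + of_real (R r)) powr (1 - c) / of_real (R r) *
     hyp2F1_reg_series (c - a') (c - b') c (of_real (x1 * x2 * r / (1 + R r)\<^sup>2)) * product_kernel a' b' c r)"
  define \<kappa> where "\<kappa> = 1 / 2 * (Gamma a' / Gamma (\<gamma> + 1)) *
      (of_real (sqrt pi) * Gamma (2 * A) / (2 powr (2 * (A + B) - 1) * Gamma (A + B) * Gamma (1 - 2 * B))) *
      of_real (x1 * x2) powr (\<alpha> / 2)"
  define h where "h = (\<lambda>r. 1 / 2 * subst_y x1 x2 r ^ 3 * (subst_x x1 x2 r / (r * R r)))"
  define Sx where "Sx = hyp2F1_reg_series a' b' c (of_real x1) * hyp2F1_reg_series a' b' c (of_real x2)"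
  define f where "f = product_integrand \<alpha> \<beta> \<gamma> y1 y2"
  have W1: "W absolutely_integrable_on {0<..<1}"
    unfolding W_def R_def by (rule product_kernel_integral(1)[OF par x])
  have W2: "integral {0<..<1} W = Gamma a' * Gamma b' / of_real (sqrt pi) * Sx"
    unfolding W_def R_def Sx_def by (rule product_kernel_integral(2)[OF par x])
  have hpos: "h r > 0" if "r \<in> {0<..<1}" for r
  proof -
    have r: "0 \<le> r" "r \<le> 1" "0 < r" using that by auto
    have "R r > 0" unfolding R_def using subst_pr[OF x r(1,2)] by simp
    thus ?thesis unfolding h_def
      using subst_y_pos[OF x r(1,2)] subst_x_bounds(3)[OF x r] r(3)
      by (intro mult_pos_pos divide_pos_pos zero_less_power) auto
  qed
  have tr: "\<bar>h r\<bar> *\<^sub>R f (subst_y x1 x2 r) = \<kappa> * W r" if "r \<in> {0<..<1}" for r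
  proof -
    have r: "0 < r" "r < 1" using that by auto
    have "h r *\<^sub>R f (subst_y x1 x2 r) = \<kappa> * W r"
      using product_integrand_subst[OF x r y0 yx cS AB]
      unfolding h_def f_def \<kappa>_def W_def R_def A_def B_def a'_def b'_def c_def .
    thus ?thesis using hpos[OF that] by (simp only: abs_of_pos)
  qed
  have i1: "(\<lambda>r. \<bar>h r\<bar> *\<^sub>R f (subst_y x1 x2 r)) absolutely_integrable_on {0<..<1}"
    using set_integrable_mult_right[OF W1, of \<kappa>]
    by (rule absolutely_integrable_spike[where S = "{}"]) (auto simp: tr)
  have i2: "integral {0<..<1} (\<lambda>r. \<bar>h r\<bar> *\<^sub>R f (subst_y x1 x2 r)) = \<kappa> * (Gamma a' * Gamma b' / of_real (sqrt pi) * Sx)"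
  proof -
    have "integral {0<..<1} (\<lambda>r. \<bar>h r\<bar> *\<^sub>R f (subst_y x1 x2 r)) = integral {0<..<1} (\<lambda>r. \<kappa> * W r)"
      by (intro integral_cong tr)
    also have "\<dots> = \<kappa> * integral {0<..<1} W" by (rule integral_mult_right)
    finally show ?thesis unfolding W2 .
  qed
  have dh: "(subst_y x1 x2 has_field_derivative h r) (at r within {0<..<1})" if "r \<in> {0<..<1}" for r
  proof -
    have "0 < r" "r < 1" using that by auto
    from subst_y_deriv[OF x this] show ?thesis
      unfolding h_def R_def by (rule has_field_derivative_at_within)
  qed
  have S: "{0<..<1::real} \<in> sets lebesgue" by simp
  have "f absolutely_integrable_on subst_y x1 x2 ` {0<..<1} \<and>
     integral (subst_y x1 x2 ` {0<..<1}) f = \<kappa> * (Gamma a' * Gamma b' / of_real (sqrt pi) * Sx)"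
    \<comment> \<open>The equivalence for absolutely integrable functions transports integrability
      and value at once.\<close>
    by (rule has_absolute_integral_change_of_variables_real[OF S dh subst_y_inj[OF x], THEN iffD1, OF _ conjI[OF i1 i2]])
  moreover have "subst_y x1 x2 ` {0<..<1} = {1<..<(y1 * y2 + 1) / (y1 + y2)}"
    unfolding subst_y_image[OF x] subst_y_1[OF x y0 yx] ..
  ultimately have f1: "f absolutely_integrable_on {1<..<(y1 * y2 + 1) / (y1 + y2)}"
    and f2: "integral {1<..<(y1 * y2 + 1) / (y1 + y2)} f = \<kappa> * (Gamma a' * Gamma b' / of_real (sqrt pi) * Sx)"
    by simp_all
  show "product_integrand \<alpha> \<beta> \<gamma> y1 y2 absolutely_integrable_on {1..(y1 * y2 + 1) / (y1 + y2)}"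
    using f1 unfolding f_def absolutely_integrable_on_def integrable_on_Icc_iff_Ioo .
  have int: "integral {1..(y1 * y2 + 1) / (y1 + y2)} f = \<kappa> * (Gamma a' * Gamma b' / of_real (sqrt pi) * Sx)"
    using f2 by (simp add: integral_open_interval_real)
  \<comment> \<open>Here \<open>b'\<close> stands first, so that F(a', b'; c; x) appears, the factor
    in the Burchnall--Chaundy product.\<close>
  have J: "jacobi_fun \<gamma> \<alpha> \<beta> (of_real (2 * y\<^sup>2 - 1)) = Gamma a' / Gamma (\<gamma> + 1) * (of_real y powr (- (2 * b')) * hyp2F1_reg_series a' b' c (of_real x))"
    if "0 < x" "x < 1" "y > 0" "y\<^sup>2 = 1 / (1 - x)" for x y :: real
  proof -
    have "hyp2F1_reg (- \<gamma>) b' c (of_real (1 - y\<^sup>2)) = of_real y powr (- (2 * b')) * hyp2F1_reg_series b' (c - - \<gamma>) c (of_real x)"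
      unfolding hyp2F1_reg_commute[of "- \<gamma>"] c_def by (rule hyp2F1_reg_pfaff_real[OF cS that])
    also have "hyp2F1_reg_series b' (c - - \<gamma>) c (of_real x) = hyp2F1_reg_series a' b' c (of_real x)"
      by (subst hyp2F1_reg_series_commute) (simp add: a'_def c_def add_ac)
    finally show ?thesis unfolding jacobi_fun_altdef a'_def b'_def c_def by simp
  qed
  have prod: "jacobi_product \<alpha> \<beta> \<gamma> y1 y2 = (Gamma a' / Gamma (\<gamma> + 1))\<^sup>2 *
     (of_real y1 powr (- (2 * b')) * of_real y2 powr (- (2 * b'))) * Sx"
    unfolding jacobi_product_def J[OF x(1,2) y0(1) yx(1)] J[OF x(3,4) y0(2) yx(2)] Sx_def
    by (simp add: power2_eq_square)
  define \<nu> where "\<nu> = 1 - 2 * B"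
  have e: "\<alpha> + 2 * \<gamma> + 2 = \<nu>" "- \<alpha> - \<beta> - 2 * \<gamma> - 1 = A + B" "- \<alpha> - 2 * \<beta> - 2 * \<gamma> - 1 = 2 * A"
    "2 * \<alpha> + 2 * \<beta> + 4 * \<gamma> + 2 = - (2 * (A + B))"
    unfolding A_def B_def \<nu>_def by (simp_all add: field_simps)
  \<comment> \<open>\<open>Gamma\<close> takes the value 0 at its poles, so excluding nonpositive
    integers is what permits cancelling these factors.\<close>
  have nz: "Gamma \<nu> \<noteq> 0" "Gamma (A + B) \<noteq> 0" "Gamma (2 * A) \<noteq> 0" "Gamma b' \<noteq> 0"
  proof -
    show "Gamma \<nu> \<noteq> 0" "Gamma (A + B) \<noteq> 0" "Gamma (2 * A) \<noteq> 0"
      using np unfolding e by (simp_all add: Gamma_eq_zero_iff)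
    have "b' \<notin> \<int>\<^sub>\<le>\<^sub>0" using par by (auto elim!: nonpos_Ints_cases')
    thus "Gamma b' \<noteq> 0" by (simp add: Gamma_eq_zero_iff)
  qed
  \<comment> \<open>The 1/2 left over here balances the 1/2 that the Jacobian contributes to
    \<open>\<kappa>\<close>.\<close>
  have two: "2 powr (- (2 * (A + B))) * 2 powr (2 * (A + B) - 1) = (1 / 2 :: complex)"
    unfolding powr_add[symmetric] by (simp add: powr_minus)
  define l1 l2 m1 m2 where "l1 = complex_of_real (ln y1)" and "l2 = complex_of_real (ln y2)"
    and "m1 = complex_of_real (ln (y1\<^sup>2 - 1))" and "m2 = complex_of_real (ln (y2\<^sup>2 - 1))"
  have x': "x1 = (y1\<^sup>2 - 1) / y1\<^sup>2" "x2 = (y2\<^sup>2 - 1) / y2\<^sup>2"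
    unfolding x1_def x2_def using y0 by (simp_all add: diff_divide_distrib)
  have "ln (x1 * x2) = ln x1 + ln x2" using x by (simp add: ln_mult)
  also have "\<dots> = (ln (y1\<^sup>2 - 1) - 2 * ln y1) + (ln (y2\<^sup>2 - 1) - 2 * ln y2)"
    unfolding x' using ysq y0 by (simp add: ln_div ln_realpow)
  finally have lx: "ln (x1 * x2) = (ln (y1\<^sup>2 - 1) - 2 * ln y1) + (ln (y2\<^sup>2 - 1) - 2 * ln y2)" .
  have pw: "of_real y1 powr z = exp (z * l1)" "of_real y2 powr z = exp (z * l2)"
    "of_real (y1 * y2) powr z = exp (z * (l1 + l2))"
    "of_real (y1\<^sup>2 - 1) powr z = exp (z * m1)" "of_real (y2\<^sup>2 - 1) powr z = exp (z * m2)"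
    "of_real (x1 * x2) powr z = exp (z * ((m1 - 2 * l1) + (m2 - 2 * l2)))" for z
  proof -
    show "of_real y1 powr z = exp (z * l1)" "of_real y2 powr z = exp (z * l2)"
      "of_real (y1\<^sup>2 - 1) powr z = exp (z * m1)" "of_real (y2\<^sup>2 - 1) powr z = exp (z * m2)"
      unfolding l1_def l2_def m1_def m2_def by (rule of_real_powr_exp; use y0 ysq in simp)+
    show "of_real (y1 * y2) powr z = exp (z * (l1 + l2))"
      using y0 by (subst of_real_powr_exp) (simp_all add: l1_def l2_def ln_mult)
    show "of_real (x1 * x2) powr z = exp (z * ((m1 - 2 * l1) + (m2 - 2 * l2)))"
      using x by (subst of_real_powr_exp) (simp_all add: l1_def l2_def m1_def m2_def lx)
  qed
  \<comment> \<open>Splits the power of x1 x2 into the powers of the prefactor and those produced by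
    Pfaff's transformation on the left-hand side.\<close>
  have "\<alpha> / 2 * ((m1 - 2 * l1) + (m2 - 2 * l2)) = (- (2 * b') * l1 + - (2 * b') * l2) +
     ((\<alpha> + 2 * \<beta> + 2 * \<gamma> + 2) * (l1 + l2) + \<alpha> / 2 * m1 + \<alpha> / 2 * m2)"
    unfolding b'_def by (simp add: field_simps)
  from arg_cong[OF this, of exp]
  have pws: "of_real (x1 * x2) powr (\<alpha> / 2) = (of_real y1 powr (- (2 * b')) * of_real y2 powr (- (2 * b'))) *
     (of_real (y1 * y2) powr (\<alpha> + 2 * \<beta> + 2 * \<gamma> + 2) * of_real (y1\<^sup>2 - 1) powr (\<alpha> / 2) * of_real (y2\<^sup>2 - 1) powr (\<alpha> / 2))"
    unfolding pw by (simp only: exp_add)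
  define E where "E = of_real (y1 * y2) powr (\<alpha> + 2 * \<beta> + 2 * \<gamma> + 2) * of_real (y1\<^sup>2 - 1) powr (\<alpha> / 2) * of_real (y2\<^sup>2 - 1) powr (\<alpha> / 2)"
  have E: "E \<noteq> 0" unfolding E_def pw by simp
  have pre: "product_prefactor \<alpha> \<beta> \<gamma> y1 y2 = Gamma \<nu> * Gamma (A + B) /
     (2 powr (- (2 * (A + B))) * Gamma (\<gamma> + 1) * Gamma b' * Gamma (2 * A) * E)"
    unfolding product_prefactor_def E_def e b'_def by (simp only: mult.assoc)
  have sp: "complex_of_real (sqrt pi) \<noteq> 0" by simp
  have "jacobi_integral \<alpha> \<beta> \<gamma> y1 y2 = product_prefactor \<alpha> \<beta> \<gamma> y1 y2 * (\<kappa> * (Gamma a' * Gamma b' / of_real (sqrt pi) * Sx))"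
    unfolding jacobi_integral_def using int unfolding f_def by simp
  also have "\<dots> = (Gamma a' / Gamma (\<gamma> + 1))\<^sup>2 * (of_real y1 powr (- (2 * b')) * of_real y2 powr (- (2 * b'))) * Sx *
     (1 / 2 / (2 powr (- (2 * (A + B))) * 2 powr (2 * (A + B) - 1)))"
    unfolding pre \<kappa>_def pws E_def[symmetric] \<nu>_def[symmetric] using nz E sp
    by (simp add: power2_eq_square mult_ac)
  finally show "jacobi_product \<alpha> \<beta> \<gamma> y1 y2 = jacobi_integral \<alpha> \<beta> \<gamma> y1 y2"
    unfolding prod two by simp
qed

theorem theorem34:
  fixes \<alpha> \<beta> \<gamma> :: complex
  assumes "\<alpha> \<noteq> 0" and "\<beta> \<noteq> 0" and "\<gamma> \<noteq> 0"
    and "Re (\<alpha> + \<gamma>) > -1"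
    and "Re (\<alpha> + \<beta> + \<gamma>) > -1"
    and "Re (\<alpha> + \<beta> + 2 * \<gamma>) < -1 / 2"
    and "\<gamma> + 1 \<notin> \<int>\<^sub>\<le>\<^sub>0"
    and "\<alpha> + 2 * \<gamma> + 2 \<notin> \<int>\<^sub>\<le>\<^sub>0"
    and "- \<alpha> - \<beta> - 2 * \<gamma> - 1 \<notin> \<int>\<^sub>\<le>\<^sub>0"
    and "- \<alpha> - 2 * \<beta> - 2 * \<gamma> - 1 \<notin> \<int>\<^sub>\<le>\<^sub>0"
  shows "(\<forall>y1>1. \<forall>y2>1.
            product_integrand \<alpha> \<beta> \<gamma> y1 y2 absolutely_integrable_on {1..(y1 * y2 + 1) / (y1 + y2)} \<and>
            jacobi_product \<alpha> \<beta> \<gamma> y1 y2 = jacobi_integral \<alpha> \<beta> \<gamma> y1 y2) \<and>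
         (\<exists>L R. analytic_continuation2 (jacobi_product \<alpha> \<beta> \<gamma>) L \<and>
                analytic_continuation2 (jacobi_integral \<alpha> \<beta> \<gamma>) R \<and>
                (\<forall>y1\<in>cut_plane. \<forall>y2\<in>cut_plane. L y1 y2 = R y1 y2))"
proof -
  have real: "product_integrand \<alpha> \<beta> \<gamma> y1 y2 absolutely_integrable_on {1..(y1 * y2 + 1) / (y1 + y2)}"
    "jacobi_product \<alpha> \<beta> \<gamma> y1 y2 = jacobi_integral \<alpha> \<beta> \<gamma> y1 y2" if "y1 > 1" "y2 > 1" for y1 y2
    using jacobi_product_formula_real[OF assms(4-6,8-10) that] by blast+
  have cS: "\<alpha> + 1 + of_nat (Suc n) \<noteq> 0" for n
  proof -
    \<comment> \<open>Re (\<alpha> + 1) = Re (\<alpha> + \<gamma>) + Re (\<alpha> + \<beta> +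
      \<gamma>) - Re (\<alpha> + \<beta> + 2 \<gamma>) + 1 > -1/2.\<close>
    have "Re (\<alpha> + 1 + of_nat (Suc n)) > 0" using assms(4-6) by simp
    thus ?thesis by (metis zero_complex.sel(1) less_irrefl)
  qed
  obtain \<Psi> where \<Psi>: "\<Psi> holomorphic_on cut_plane"
    "\<And>y. y > 1 \<Longrightarrow> \<Psi> (of_real y) = hyp2F1_reg (- \<gamma>) (\<alpha> + \<beta> + \<gamma> + 1) (\<alpha> + 1) (of_real (1 - y\<^sup>2))"
    using hyp2F1_reg_square_continuation[OF cS, of "- \<gamma>" "\<alpha> + \<beta> + \<gamma> + 1"] by blast
  define P where "P = (\<lambda>y. Gamma (\<alpha> + \<gamma> + 1) / Gamma (\<gamma> + 1) * \<Psi> y)"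
  \<comment> \<open>As a product of functions of one variable each, \<open>L\<close> inherits joint
    continuity and separate holomorphy from \<open>P\<close>.\<close>
  define L where "L = (\<lambda>y1 y2. P y1 * P y2)"
  have P: "P holomorphic_on cut_plane" unfolding P_def by (intro holomorphic_intros \<Psi>(1))
  have Preal: "P (of_real y) = jacobi_fun \<gamma> \<alpha> \<beta> (of_real (2 * y\<^sup>2 - 1))" if "y > 1" for y
    unfolding P_def jacobi_fun_altdef \<Psi>(2)[OF that] ..
  have Lreal: "L (of_real y1) (of_real y2) = jacobi_product \<alpha> \<beta> \<gamma> y1 y2" if "y1 > 1" "y2 > 1" for y1 y2
    unfolding L_def jacobi_product_def Preal[OF that(1)] Preal[OF that(2)] ..
  have cont: "continuous_on (cut_plane \<times> cut_plane) (\<lambda>(y1, y2). L y1 y2)"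
  proof -
    have "continuous_on cut_plane P" using P by (rule holomorphic_on_imp_continuous_on)
    hence "continuous_on (cut_plane \<times> cut_plane) (\<lambda>z. P (fst z))"
      "continuous_on (cut_plane \<times> cut_plane) (\<lambda>z. P (snd z))"
      by (auto intro!: continuous_on_compose2[of cut_plane P] continuous_intros)
    thus ?thesis unfolding L_def case_prod_unfold by (rule continuous_on_mult)
  qed
  have hol: "(\<lambda>y1. L y1 y2) holomorphic_on cut_plane" "(\<lambda>y2. L y1 y2) holomorphic_on cut_plane" for y1 y2
    unfolding L_def by (intro holomorphic_intros P)+
  have "analytic_continuation2 (jacobi_product \<alpha> \<beta> \<gamma>) L"
    unfolding analytic_continuation2_def using cont hol Lreal by blast
  moreover have "analytic_continuation2 (jacobi_integral \<alpha> \<beta> \<gamma>) L"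
    unfolding analytic_continuation2_def using cont hol Lreal real(2) by simp
  ultimately show ?thesis using real by blast
qed

end
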